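(* Let $H$ be the minimal Schrödinger operator in $L^2(\mathbb R^2,\mathbb C^n)$ with point interactions at the distinct points $x_1,\dots,x_m$, and let $\Pi=\{\mathcal H,\Gamma_0,\Gamma_1\}$ be the boundary triplet for $H^*$ described in the context. Then: (i) the Weyl function $M(\cdot)$ corresponding to $\Pi$ has the form $$M(z)=\bigoplus_{s=1}^nM_s(z),\qquad M_s(z)=\Bigl(\frac1{2\pi}\Bigl(\psi(1)-\ln\Bigl(\frac{\sqrt z}{2i}\Bigr)\Bigr)\delta_{jk}+\widetilde G_{\sqrt z}(x_j-x_k)\Bigr)_{j,k=1}^m,\quad z\in\mathbb C_+,$$ where $\psi(1)=\Gamma'(1)/\Gamma(1)$ ($\Gamma$ the Euler gamma function), $\widetilde G_{\sqrt z}(x)=\frac i4H_0^{(1)}(\sqrt z|x|)$ for $x\ne0$, $\widetilde G_{\sqrt z}(0)=0$, and $H_0^{(1)}$ is the Hankel function of the first kind and order $0$; (ii) the corresponding $\gamma$-field is $$\gamma(z)\overline\xi=\sum_{j=1}^m\xi_j\,\frac i4H_0^{(1)}(\sqrt zr_j),\qquad\overline\xi=\{\xi_j\}_{j=1}^m,\ \xi_j\in\mathbb C^n,\quad z\in\mathbb C_+.$$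
   Context: Here $m,n\in\mathbb N$, $X=\{x_1,\dots,x_m\}$, $r_j=|x-x_j|$, $H=-\Delta\otimes I_n$, $\operatorname{dom}(H)=\{f\in W_2^2(\mathbb R^2,\mathbb C^n): f(x_j)=0,\ j=1,\dots,m\}$, and $\operatorname{dom}(H^* )=\{f\in L^2(\mathbb R^2,\mathbb C^n)\cap W^2_{2,\mathrm{loc}}(\mathbb R^2\setminus X,\mathbb C^n):\Delta f\in L^2(\mathbb R^2,\mathbb C^n)\}$ ($\Delta f$ computed on $\mathbb R^2\setminus X$). The boundary triplet is $\mathcal H=\oplus_{j=1}^m\mathbb C^n$, $$\Gamma_0f=-2\pi\Bigl\{\lim_{x\to x_j}\frac{f(x)}{\ln|x-x_j|}\Bigr\}_{j=1}^m,\qquad\Gamma_1f=\Bigl\{\lim_{x\to x_j}\bigl(f(x)-\ln|x-x_j|\,\xi_{0j}\bigr)\Bigr\}_{j=1}^m,\qquad \xi_{0j}=\lim_{x\to x_j}\frac{f(x)}{\ln|x-x_j|}.$$ With $H_0=H^*\upharpoonright\ker\Gamma_0$ and $\mathcal N_z=\ker(H^*-z)$: $\gamma(z)=(\Gamma_0\upharpoonright\mathcal N_z)^{-1}$ and $M(z)=\Gamma_1\gamma(z)$ for $z\in\rho(H_0)$. The branch of $\sqrt{\cdot}$ on $\mathbb C\setminus[0,\infty)$ is fixed by $\sqrt1=1$ (boundary value from the upper half-plane), so $\operatorname{Im}\sqrt z>0$; $\ln$ is the principal branch. For an $m\times m$ matrix $B=(b_{jk})$, $\bigoplus_{s=1}^nB$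 is identified with $\{\xi_j\}_j\mapsto\{\sum_kb_{jk}\xi_k\}_j$ on $\mathcal H$. *)

theory Defs
  imports "HOL-Analysis.Analysis"
begin

text \<open>
  Functions on the plane with values in \<open>\<complex>\<^sup>n\<close> have type \<open>real^2 \<Rightarrow> complex^'n\<close> with
  \<open>n = CARD('n)\<close>; the points \<open>x\<^sub>1, \<dots>, x\<^sub>m\<close> form a family \<open>p :: 'm \<Rightarrow> real^2\<close> with
  \<open>m = CARD('m)\<close>, and the boundary space (the direct sum of \<open>m\<close> copies of \<open>\<complex>\<^sup>n\<close>) is
  \<open>complex^'n^'m\<close>.
\<close>

subsection \<open>Test functions and weak derivatives on an open subset of the plane\<close>

definition partial :: "2 \<Rightarrow> (real^2 \<Rightarrow> real) \<Rightarrow> real^2 \<Rightarrow> real" where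
  "partial i \<phi> x = frechet_derivative \<phi> (at x) (axis i 1)"

primrec cont_diff :: "nat \<Rightarrow> (real^2 \<Rightarrow> real) \<Rightarrow> bool" where
  "cont_diff 0 \<phi> \<longleftrightarrow> continuous_on UNIV \<phi>"
| "cont_diff (Suc k) \<phi> \<longleftrightarrow> (\<forall>x. \<phi> differentiable (at x)) \<and> (\<forall>i. cont_diff k (partial i \<phi>))"

definition test_functions :: "(real^2) set \<Rightarrow> (real^2 \<Rightarrow> real) set" where
  "test_functions \<Omega> =
     {\<phi>. (\<forall>k. cont_diff k \<phi>) \<and> (\<exists>K. compact K \<and> K \<subseteq> \<Omega> \<and> (\<forall>x. x \<notin> K \<longrightarrow> \<phi> x = 0))}"

definition L2 :: "(real^2 \<Rightarrow> complex^'n) set" where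
  "L2 = {f \<in> borel_measurable lborel. integrable lborel (\<lambda>x. (norm (f x))\<^sup>2)}"

definition L2_loc :: "(real^2) set \<Rightarrow> (real^2 \<Rightarrow> complex^'n) set" where
  "L2_loc \<Omega> = {f. \<forall>K. compact K \<and> K \<subseteq> \<Omega> \<longrightarrow>
     set_borel_measurable lborel K f \<and> set_integrable lborel K (\<lambda>x. (norm (f x))\<^sup>2)}"

text \<open>
  Real test functions suffice: complex ones are complex linear combinations of these.
\<close>

definition weak_partial ::
  "(real^2) set \<Rightarrow> 2 \<Rightarrow> (real^2 \<Rightarrow> complex^'n) \<Rightarrow> (real^2 \<Rightarrow> complex^'n) \<Rightarrow> bool" where
  "weak_partial \<Omega> i f g \<longleftrightarrow> (\<forall>\<phi>\<in>test_functions \<Omega>.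
     (LINT x|lborel. partial i \<phi> x *\<^sub>R f x) = - (LINT x|lborel. \<phi> x *\<^sub>R g x))"

primrec W2_loc :: "nat \<Rightarrow> (real^2) set \<Rightarrow> (real^2 \<Rightarrow> complex^'n) set" where
  "W2_loc 0 \<Omega> = L2_loc \<Omega>"
| "W2_loc (Suc k) \<Omega> = {f \<in> L2_loc \<Omega>. \<forall>i. \<exists>g \<in> W2_loc k \<Omega>. weak_partial \<Omega> i f g}"

definition weak_laplacian ::
  "(real^2) set \<Rightarrow> (real^2 \<Rightarrow> complex^'n) \<Rightarrow> (real^2 \<Rightarrow> complex^'n) \<Rightarrow> bool" where
  "weak_laplacian \<Omega> f g \<longleftrightarrow> (\<forall>\<phi>\<in>test_functions \<Omega>.
     (LINT x|lborel. (\<Sum>i\<in>UNIV. partial i (partial i \<phi>) x) *\<^sub>R f x) = (LINT x|lborel. \<phi> x *\<^sub>R g x))"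

subsection \<open>The adjoint of the minimal Schroedinger operator\<close>

text \<open>
  The minimal operator \<open>H = -\<Delta> \<otimes> I\<^sub>n\<close> has domain
  \<open>{f \<in> W\<^sup>2\<^sub>2(\<real>\<^sup>2, \<complex>\<^sup>n). f(x\<^sub>j) = 0 for all j}\<close>. Its adjoint acts as \<open>f \<mapsto> -\<Delta>f\<close>, the Laplacian being
  computed on \<open>\<real>\<^sup>2 \<setminus> X\<close>, on the domain below.

  Elements of \<open>L\<^sup>2\<close> are classes modulo null sets, but point limits are taken of elements of the
  domain. By the Sobolev embedding theorem every class in \<open>W\<^sup>2\<^sub>2\<^sub>,\<^sub>l\<^sub>o\<^sub>c(\<real>\<^sup>2 \<setminus> X)\<close> has exactly one
  representative that is continuous off the finite set \<open>X\<close> and vanishes on \<open>X\<close>, and the domain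
  consists of these representatives. The value \<open>0\<close> on \<open>X\<close> only serves to make the representative
  unique, so that equality of classes is equality of functions.
\<close>

definition dom_H_adj :: "('m::finite \<Rightarrow> real^2) \<Rightarrow> (real^2 \<Rightarrow> complex^'n) set" where
  "dom_H_adj p = {f.
     continuous_on (- range p) f \<and> (\<forall>x \<in> range p. f x = 0) \<and>
     f \<in> L2 \<and> f \<in> W2_loc 2 (- range p) \<and> (\<exists>g\<in>L2. weak_laplacian (- range p) f g)}"

text \<open>
  The graph of the adjoint, with \<open>g\<close> ranging over all representatives of its class.
\<close>

definition H_adj ::
  "('m::finite \<Rightarrow> real^2) \<Rightarrow> ((real^2 \<Rightarrow> complex^'n) \<times> (real^2 \<Rightarrow> complex^'n)) set" where
  "H_adj p = {(f, g). f \<in> dom_H_adj p \<and> g \<in> L2 \<and> weak_laplacian (- range p) f (\<lambda>x. - g x)}"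

definition defect_space ::
  "((real^2 \<Rightarrow> complex^'n) \<times> (real^2 \<Rightarrow> complex^'n)) set \<Rightarrow> complex \<Rightarrow> (real^2 \<Rightarrow> complex^'n) set"
where
  "defect_space A z = {f. (f, \<lambda>x. z *s f x) \<in> A}"

subsection \<open>Boundary mappings, gamma-field and Weyl function\<close>

definition log_coeff :: "('m::finite \<Rightarrow> real^2) \<Rightarrow> (real^2 \<Rightarrow> complex^'n) \<Rightarrow> complex^'n^'m" where
  "log_coeff p f = (\<chi> j. Lim (at (p j)) (\<lambda>x. f x /\<^sub>R ln (dist x (p j))))"

definition \<Gamma>\<^sub>0 :: "('m::finite \<Rightarrow> real^2) \<Rightarrow> (real^2 \<Rightarrow> complex^'n) \<Rightarrow> complex^'n^'m" where
  "\<Gamma>\<^sub>0 p f = (- 2 * pi) *\<^sub>R log_coeff p f"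

definition \<Gamma>\<^sub>1 :: "('m::finite \<Rightarrow> real^2) \<Rightarrow> (real^2 \<Rightarrow> complex^'n) \<Rightarrow> complex^'n^'m" where
  "\<Gamma>\<^sub>1 p f = (\<chi> j. Lim (at (p j)) (\<lambda>x. f x - ln (dist x (p j)) *\<^sub>R (log_coeff p f $ j)))"

definition gamma_field ::
  "('m::finite \<Rightarrow> real^2) \<Rightarrow> complex \<Rightarrow> complex^'n^'m \<Rightarrow> (real^2 \<Rightarrow> complex^'n)" where
  "gamma_field p z = inv_into (defect_space (H_adj p) z) (\<Gamma>\<^sub>0 p)"

definition weyl_function ::
  "('m::finite \<Rightarrow> real^2) \<Rightarrow> complex \<Rightarrow> complex^'n^'m \<Rightarrow> complex^'n^'m" where
  "weyl_function p z = \<Gamma>\<^sub>1 p \<circ> gamma_field p z"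

text \<open>
  The direct sum of \<open>n\<close> copies of an \<open>m \<times> m\<close> matrix, acting on the boundary space.
\<close>

definition direct_sum_copies :: "complex^'m^'m \<Rightarrow> complex^'n^'m \<Rightarrow> complex^'n^'m" where
  "direct_sum_copies B \<xi> = (\<chi> j. \<Sum>k\<in>UNIV. (B $ j $ k) *s (\<xi> $ k))"

subsection \<open>Hankel function and Green function\<close>

text \<open>
  The branch of the square root on \<open>\<complex> \<setminus> [0, \<infinity>)\<close> with positive imaginary part, extended to
  \<open>[0, \<infinity>)\<close> from the upper half-plane; the library's \<open>csqrt\<close> is instead cut along the negative
  real axis.
\<close>

definition upper_sqrt :: "complex \<Rightarrow> complex" where
  "upper_sqrt z = (if Im (csqrt z) < 0 then - csqrt z else csqrt z)"

text \<open>
  Bessel functions of complex order on the plane cut along the negative real axis (principal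
  branches). For integer order, \<open>Y\<^sub>\<nu>\<close> is the limit of the defining quotient in the order.
\<close>

definition bessel_J :: "complex \<Rightarrow> complex \<Rightarrow> complex" where
  "bessel_J \<nu> w =
     (w / 2) powr \<nu> * (\<Sum>k. (- 1) ^ k * (w / 2) ^ (2 * k) * rGamma (\<nu> + of_nat k + 1) / fact k)"

definition bessel_Y :: "complex \<Rightarrow> complex \<Rightarrow> complex" where
  "bessel_Y \<nu> w =
     (let q = (\<lambda>\<mu>. (bessel_J \<mu> w * cos (of_real pi * \<mu>) - bessel_J (- \<mu>) w) / sin (of_real pi * \<mu>))
      in if \<nu> \<in> \<int> then Lim (at \<nu>) q else q \<nu>)"

definition hankel1 :: "complex \<Rightarrow> complex \<Rightarrow> complex" where
  "hankel1 \<nu> w = bessel_J \<nu> w + \<i> * bessel_Y \<nu> w"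

definition green_tilde :: "complex \<Rightarrow> real^2 \<Rightarrow> complex" where
  "green_tilde w x = (if x = 0 then 0 else \<i> / 4 * hankel1 0 (w * of_real (norm x)))"

definition weyl_matrix :: "('m::finite \<Rightarrow> real^2) \<Rightarrow> complex \<Rightarrow> complex^'m^'m" where
  "weyl_matrix p z = (\<chi> j k.
     (if j = k
      then 1 / (2 * of_real pi) * (deriv Gamma 1 / Gamma 1 - ln (upper_sqrt z / (2 * \<i>)))
      else 0)
     + green_tilde (upper_sqrt z) (p j - p k))"

end

theory Submission
  imports Defs "HOL-Complex_Analysis.Complex_Analysis" "HOL-Real_Asymp.Real_Asymp"
begin

text \<open>
  A function in the defect space solves \<open>(\<Delta> + z) f = 0\<close> off the points \<open>x\<^sub>j\<close>, so the statement amounts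
  to this: the square integrable solutions are exactly the superpositions of translates of
  \<open>G(x) = i/4 H\<^sub>0(\<surd>z |x|)\<close>, \<open>H\<^sub>0\<close> being the Hankel function. Once this is known, everything can be
  read off from the expansion of \<open>G\<close> at its pole, \<open>G(x) = - ln |x| / 2\<pi> + \<kappa> + o(1)\<close>: the logarithmic
  coefficient of \<open>\<Sum>\<^sub>j G(x - x\<^sub>j) \<xi>\<^sub>j\<close> at \<open>x\<^sub>j\<close> is \<open>- \<xi>\<^sub>j / 2\<pi>\<close>, so \<open>\<Gamma>\<^sub>0\<close> returns \<open>\<xi>\<close>, and the finite part
  is \<open>\<kappa> \<xi>\<^sub>j + \<Sum>\<^sub>k G(x\<^sub>j - x\<^sub>k) \<xi>\<^sub>k\<close> (sum over \<open>k \<noteq> j\<close>), which is the Weyl function.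

  The Green function. Written in the squared radius \<open>s = |x|\<^sup>2\<close>, the function \<open>G\<close> is a logarithmic
  power series (\<open>green_profile\<close>), from which the Helmholtz equation and the behaviour at the pole
  are immediate. Its decay at infinity is not visible in the series. It comes from Macdonald's
  integral \<open>K(u) = \<integral> exp(- u cosh t) dt\<close> over \<open>t \<ge> 0\<close>: \<open>K\<close> decays exponentially, solves the modified Bessel
  equation, and has the expansion \<open>- ln (u/2) - \<gamma> + o(1)\<close> at the origin, with \<open>\<gamma>\<close> Euler's constant. A
  Wronskian argument shows that these properties determine it, so that \<open>G(x) = K(- i \<surd>z |x|) / 2\<pi>\<close>
  (\<open>macdonald_eq_log_series\<close>, \<open>green_profile_decay\<close>).

  All solutions are superpositions. Elements of the domain are continuous off the \<open>x\<^sub>j\<close>, so their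
  values there are limits of averages. Fix \<open>b\<close> outside these points. The weak equation for \<open>f\<close> is
  tested with \<open>\<psi>(x) G(x - b)\<close>, where \<open>\<psi>\<close> is a cutoff to a large disc around \<open>b\<close> minus cutoffs to small
  discs around \<open>b\<close> and around every \<open>x\<^sub>j\<close>. As \<open>G\<close> solves the same equation, only the commutator
  \<open>[\<Delta>, \<psi>] G\<close> survives, and it splits into one contribution per disc. The large disc contributes
  nothing in the limit, by the decay of \<open>G\<close> (\<open>commutator_at_infinity\<close>). The disc around \<open>b\<close> contributes
  \<open>f(b)\<close>, because the commutator kernel is an approximate identity up to a term that the equation
  makes negligible (\<open>commutator_at_centre\<close>). The disc around \<open>x\<^sub>j\<close> contributes \<open>G(x\<^sub>j - b)\<close> times a number
  that depends only on \<open>f\<close> and \<open>x\<^sub>j\<close> (\<open>charge_limit\<close>, \<open>commutator_at_pole\<close>): the error is controlled since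
  a square integrable function has mass \<open>o(\<rho>)\<close> on discs of radius \<open>\<rho>\<close> (\<open>mass_over_radius_tendsto_0\<close>). The
  contributions balance, which is \<open>helmholtz_representation\<close>.

  Conversely, \<open>G\<close> is smooth off its pole, so that integration by parts turns its classical
  derivatives into weak ones, and it is square integrable because a logarithm is square
  integrable near a point of the plane (\<open>green_sum_in_defect_space\<close>).
\<close>

section \<open>Bessel functions of order zero\<close>

text \<open>
  The recursion \<open>1/\<Gamma>(z) = z / \<Gamma>(z + 1)\<close> with \<open>|z| \<ge> 1/2\<close> costs at most a factor 2 per step. The
  resulting geometric growth is harmless against the factor \<open>1/k!\<close> of the Bessel series.
\<close>

lemma norm_rGamma_shift_le:
  fixes M :: real and \<mu> :: complex
  assumes "norm \<mu> < 1/2" "norm (rGamma (\<mu> + 1)) \<le> M"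
  shows "norm (rGamma (\<mu> + of_nat k + 1)) \<le> M * 2 ^ k"
proof (induction k)
  case 0
  then show ?case using assms by simp
next
  case (Suc k)
  let ?z = "\<mu> + of_nat k + 1"
  have "real k + 1 = norm (?z - \<mu>)" using norm_of_nat[of "Suc k", where 'a=complex] by (simp add: add.commute)
  also have "\<dots> \<le> norm ?z + norm \<mu>" by (rule norm_triangle_ineq4)
  finally have z: "norm ?z \<ge> 1/2" using assms by simp
  have "norm ?z * norm (rGamma (?z + 1)) = norm (rGamma ?z)"
    by (metis norm_mult rGamma_plus1)
  moreover have "1/2 * norm (rGamma (?z + 1)) \<le> norm ?z * norm (rGamma (?z + 1))"
    by (rule mult_right_mono[OF z]) simp
  ultimately have "norm (rGamma (?z + 1)) \<le> M * 2 ^ Suc k" using Suc by simp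
  moreover have "?z + 1 = \<mu> + of_nat (Suc k) + 1" by simp
  ultimately show ?case by metis
qed

text \<open>
  Coefficients of \<open>J\<^sub>0(w)\<close> as a power series in \<open>w\<^sup>2/4\<close>. Those of \<open>Y0_coeff\<close> belong to the derivative in
  \<open>\<nu>\<close> at \<open>\<nu> = 0\<close> of \<open>J\<^sub>\<nu>(w)\<close> without its factor \<open>(w/2)\<^sup>\<nu>\<close>; the Digamma values stem from differentiating
  \<open>1/\<Gamma>\<close>.
\<close>

definition J0_coeff :: "nat \<Rightarrow> complex" where
  "J0_coeff k = (-1) ^ k / (fact k)\<^sup>2"

definition Y0_coeff :: "nat \<Rightarrow> complex" where
  "Y0_coeff k = - ((-1) ^ k * Digamma (of_nat k + 1) / (fact k)\<^sup>2)"

text \<open>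
  For orders near 0 the series is dominated by a fixed exponential series, so it may be
  differentiated term by term in the order.
\<close>

lemma bessel_J_order_derivative:
  assumes "w \<noteq> 0"
  defines "F \<equiv> (\<lambda>\<mu>. \<Sum>k. (- 1) ^ k * (w / 2) ^ (2 * k) * rGamma (\<mu> + of_nat k + 1) / fact k)"
  shows "F 0 = (\<Sum>k. J0_coeff k * (w\<^sup>2 / 4) ^ k)"
    and "summable (\<lambda>k. J0_coeff k * (w\<^sup>2 / 4) ^ k)"
    and "summable (\<lambda>k. Y0_coeff k * (w\<^sup>2 / 4) ^ k)"
    and "(F has_field_derivative (\<Sum>k. Y0_coeff k * (w\<^sup>2 / 4) ^ k)) (at 0)"
proof -
  let ?f = "\<lambda>k \<mu>. (- 1) ^ k * (w / 2) ^ (2 * k) * rGamma (\<mu> + of_nat k + 1) / fact k :: complex"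
  let ?f' = "\<lambda>k \<mu>. (- 1) ^ k * (w / 2) ^ (2 * k) * (- (rGamma (\<mu> + of_nat k + 1) * Digamma (\<mu> + of_nat k + 1))) / fact k :: complex"
  let ?S = "ball (0::complex) (1/2)"
  have "compact ((\<lambda>\<mu>::complex. rGamma (\<mu> + 1)) ` cball 0 (1/2))"
    by (intro compact_continuous_image compact_cball continuous_intros holomorphic_on_imp_continuous_on holomorphic_intros)
  then obtain M where M: "\<And>\<mu>::complex. norm \<mu> \<le> 1/2 \<Longrightarrow> norm (rGamma (\<mu> + 1)) \<le> M"
    using compact_imp_bounded[THEN bounded_iff[THEN iffD1]] by (metis imageI mem_cball_0)
  have np: "\<mu> + of_nat k + 1 \<notin> \<int>\<^sub>\<le>\<^sub>0" if "norm \<mu> < 1/2" for \<mu> :: complex and k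
  proof
    assume "\<mu> + of_nat k + 1 \<in> \<int>\<^sub>\<le>\<^sub>0"
    then obtain n where "n \<le> 0" "\<mu> + of_nat k + 1 = of_int n" by (auto elim!: nonpos_Ints_cases)
    then have "Re (\<mu> + of_nat k + 1) \<le> 0" by simp
    then have "Re \<mu> \<le> -1" by simp
    moreover have "\<bar>Re \<mu>\<bar> < 1/2" using that abs_Re_le_cmod[of \<mu>] by linarith
    ultimately show False by linarith
  qed
  let ?h = "\<lambda>k. M * (inverse (fact k) * (2 * (norm (w/2))\<^sup>2) ^ k)"
  have sh: "summable ?h"
    by (intro summable_mult summable_exp)
  have hb: "norm (?f k \<mu>) \<le> ?h k" if "\<mu> \<in> ?S" for k \<mu>
  proof -
    have "norm (rGamma (\<mu> + of_nat k + 1)) \<le> M * 2 ^ k"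
      using that by (intro norm_rGamma_shift_le M) auto
    then have "(norm (w / 2) ^ (2 * k)) * norm (rGamma (\<mu> + of_nat k + 1)) / fact k
        \<le> (norm (w / 2) ^ (2 * k)) * (M * 2 ^ k) / fact k"
      by (intro divide_right_mono mult_left_mono) auto
    moreover have "norm (?f k \<mu>) = norm (w / 2) ^ (2 * k) * norm (rGamma (\<mu> + of_nat k + 1)) / fact k"
      by (simp only: norm_mult norm_divide norm_power norm_minus_cancel norm_one power_one mult_1_left norm_fact)
    moreover have "norm (w / 2) ^ (2 * k) * (M * 2 ^ k) / fact k = ?h k"
      by (subst power_mult, subst power_mult_distrib, simp only: divide_inverse mult_ac)
    ultimately show ?thesis by (simp only:)
  qed
  have deriv: "(?f k has_field_derivative ?f' k \<mu>) (at \<mu>)" if "\<mu> \<in> ?S" for k \<mu>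
    using np[of \<mu> k] that by (auto intro!: derivative_eq_intros)
  have "\<forall>\<^sub>F k in sequentially. \<forall>\<mu>\<in>?S. norm (?f k \<mu>) \<le> ?h k"
    using hb by (intro always_eventually) blast
  from series_and_derivative_comparison[of ?S ?h ?f ?f', OF open_ball sh deriv this]
  obtain g g' where "\<forall>x\<in>?S. ((\<lambda>n. ?f n x) sums g x) \<and> ((\<lambda>n. ?f' n x) sums g' x) \<and> (g has_field_derivative g' x) (at x)"
    by blast
  then have g: "((\<lambda>n. ?f n x) sums g x) \<and> ((\<lambda>n. ?f' n x) sums g' x) \<and> (g has_field_derivative g' x) (at x)" if "x \<in> ?S" for x
    using that by blast
  have Fg: "F x = g x" if "x \<in> ?S" for x
    using g[OF that] unfolding F_def by (simp add: sums_iff)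
  have p: "(- 1) ^ k * (w / 2) ^ (2 * k) = (-1) ^ k * (w\<^sup>2 / 4) ^ k" for k
    by (simp add: power_mult power_divide)
  have f0: "?f k 0 = J0_coeff k * (w\<^sup>2 / 4) ^ k" for k
    unfolding J0_coeff_def p
    by (simp add: rGamma_inverse_Gamma Gamma_fact add.commute[of _ 1] field_simps power2_eq_square)
  have f'0: "?f' k 0 = Y0_coeff k * (w\<^sup>2 / 4) ^ k" for k
    unfolding Y0_coeff_def p
    by (simp add: rGamma_inverse_Gamma Gamma_fact add.commute[of _ 1] field_simps power2_eq_square)
  have z: "0 \<in> ?S" by simp
  show "F 0 = (\<Sum>k. J0_coeff k * (w\<^sup>2 / 4) ^ k)"
    unfolding F_def f0 ..
  show "summable (\<lambda>k. J0_coeff k * (w\<^sup>2 / 4) ^ k)"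
    using g[OF z] unfolding f0 by (simp add: sums_iff)
  show "summable (\<lambda>k. Y0_coeff k * (w\<^sup>2 / 4) ^ k)"
    using g[OF z] unfolding f'0 by (simp add: sums_iff)
  have "(g has_field_derivative (\<Sum>k. Y0_coeff k * (w\<^sup>2 / 4) ^ k)) (at 0)"
    using g[OF z] unfolding f'0 by (simp add: sums_iff)
  then show "(F has_field_derivative (\<Sum>k. Y0_coeff k * (w\<^sup>2 / 4) ^ k)) (at 0)"
    by (rule has_field_derivative_transform_within_open[where S = ?S]) (use Fg in auto)
qed

definition J0_series :: "complex \<Rightarrow> complex" where
  "J0_series \<tau> = (\<Sum>k. J0_coeff k * \<tau> ^ k)"

definition Y0_series :: "complex \<Rightarrow> complex" where
  "Y0_series \<tau> = (\<Sum>k. Y0_coeff k * \<tau> ^ k)"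

lemma summable_J0_coeff: "summable (\<lambda>k. J0_coeff k * \<tau> ^ k)"
  and summable_Y0_coeff: "summable (\<lambda>k. Y0_coeff k * \<tau> ^ k)"
proof -
  have "\<tau> = (2 * csqrt \<tau>)\<^sup>2 / 4" by (simp add: power_mult_distrib)
  moreover have "2 * csqrt \<tau> \<noteq> 0" if "\<tau> \<noteq> 0" using that by simp
  ultimately have "summable (\<lambda>k. J0_coeff k * \<tau> ^ k) \<and> summable (\<lambda>k. Y0_coeff k * \<tau> ^ k)" if "\<tau> \<noteq> 0"
    using bessel_J_order_derivative(2,3)[of "2 * csqrt \<tau>"] that by metis
  then show "summable (\<lambda>k. J0_coeff k * \<tau> ^ k)" "summable (\<lambda>k. Y0_coeff k * \<tau> ^ k)"
    by (metis summable_0_powser)+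
qed

text \<open>
  In order 0 the quotient defining \<open>Y\<close> is a difference quotient: its numerator vanishes at order 0
  with derivative \<open>2 \<partial>J\<^sub>\<nu>/\<partial>\<nu>\<close>, its denominator with derivative \<open>\<pi>\<close>. The factor \<open>(w/2)\<^sup>\<nu>\<close> contributes the
  logarithm.
\<close>

lemma hankel1_0_eq:
  assumes "w \<noteq> 0"
  shows "hankel1 0 w = J0_series (w\<^sup>2 / 4)
     + 2 * \<i> / of_real pi * (Ln (w / 2) * J0_series (w\<^sup>2 / 4) + Y0_series (w\<^sup>2 / 4))"
proof -
  define F where "F = (\<lambda>\<mu>::complex. \<Sum>k. (- 1) ^ k * (w / 2) ^ (2 * k) * rGamma (\<mu> + of_nat k + 1) / fact k :: complex)"
  define Y where "Y = Ln (w / 2) * J0_series (w\<^sup>2 / 4) + Y0_series (w\<^sup>2 / 4)"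
  have J: "bessel_J \<mu> w = exp (\<mu> * Ln (w / 2)) * F \<mu>" for \<mu>
    using assms unfolding bessel_J_def F_def powr_def by simp
  have F0: "F 0 = J0_series (w\<^sup>2 / 4)"
    and F': "(F has_field_derivative Y0_series (w\<^sup>2 / 4)) (at 0)"
    using bessel_J_order_derivative[OF assms] unfolding F_def J0_series_def Y0_series_def by auto
  have J0: "bessel_J 0 w = J0_series (w\<^sup>2 / 4)" by (simp add: J F0)
  have dJ: "((\<lambda>\<mu>. bessel_J \<mu> w) has_field_derivative Y) (at 0)"
    unfolding J Y_def by (rule derivative_eq_intros F' refl)+ (simp add: F0)
  have dJm: "((\<lambda>\<mu>. bessel_J (- \<mu>) w) has_field_derivative - Y) (at 0)"
    using DERIV_chain2[of "\<lambda>\<mu>. bessel_J \<mu> w" Y uminus 0 "-1" UNIV] dJ DERIV_minus[OF DERIV_ident, of 0 UNIV] by simp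
  let ?N = "\<lambda>\<mu>. bessel_J \<mu> w * cos (of_real pi * \<mu>) - bessel_J (- \<mu>) w"
  have dN: "(?N has_field_derivative 2 * Y) (at 0)"
    by (rule derivative_eq_intros dJ dJm refl)+ simp
  have dS: "((\<lambda>\<mu>. sin (of_real pi * \<mu>)) has_field_derivative (of_real pi :: complex)) (at 0)"
    by (auto intro!: derivative_eq_intros)
  have "(\<lambda>\<mu>. (?N \<mu> / \<mu>) / (sin (of_real pi * \<mu>) / \<mu>)) \<midarrow>0\<rightarrow> 2 * Y / of_real pi"
    using dN dS unfolding has_field_derivative_iff by (intro tendsto_divide) auto
  then have "(\<lambda>\<mu>. ?N \<mu> / sin (of_real pi * \<mu>)) \<midarrow>0\<rightarrow> 2 * Y / of_real pi"
    by (rule Lim_transform_eventually) (auto simp: eventually_at_filter)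
  then have "Lim (at 0) (\<lambda>\<mu>. ?N \<mu> / sin (of_real pi * \<mu>)) = 2 * Y / of_real pi"
    by (intro tendsto_Lim) auto
  then have "bessel_Y 0 w = 2 * Y / of_real pi"
    unfolding bessel_Y_def Let_def by simp
  then show ?thesis unfolding hankel1_def J0 by (simp add: Y_def)
qed

text \<open>
  In the variable \<open>\<tau> = w\<^sup>2/4\<close> the Bessel equation of order zero reads \<open>(\<tau> y')' = - y\<close>, and the operator on
  the left acts diagonally on coefficients up to a shift.
\<close>

lemma power_series_euler_operator:
  fixes c :: "nat \<Rightarrow> complex"
  assumes "\<And>y. summable (\<lambda>n. c n * y ^ n)"
  shows "((\<lambda>\<tau>. \<tau> * (\<Sum>n. diffs c n * \<tau> ^ n)) has_field_derivative
           (\<Sum>n. (of_nat n + 1)\<^sup>2 * c (Suc n) * x ^ n)) (at x)"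
proof -
  have s1: "summable (\<lambda>n. diffs c n * y ^ n)" for y
    by (rule termdiff_converges_all[OF assms])
  have s2: "summable (\<lambda>n. diffs (diffs c) n * y ^ n)" for y
    by (rule termdiff_converges_all[OF s1])
  let ?d = "\<lambda>n. of_nat n * diffs c n * x ^ n"
  have "(\<lambda>n. diffs (diffs c) n * x ^ n * x) sums ((\<Sum>n. diffs (diffs c) n * x ^ n) * x)"
    by (intro sums_mult2 summable_sums s2)
  then have "(\<lambda>n. ?d (Suc n)) sums (x * (\<Sum>n. diffs (diffs c) n * x ^ n))"
    by (simp add: diffs_def algebra_simps)
  then have "?d sums (x * (\<Sum>n. diffs (diffs c) n * x ^ n))"
    by (subst (asm) sums_Suc_iff) simp
  then have "(\<lambda>n. diffs c n * x ^ n + ?d n) sums ((\<Sum>n. diffs c n * x ^ n) + x * (\<Sum>n. diffs (diffs c) n * x ^ n))"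
    by (intro sums_add summable_sums s1)
  also have "(\<lambda>n. diffs c n * x ^ n + ?d n) = (\<lambda>n. (of_nat n + 1)\<^sup>2 * c (Suc n) * x ^ n)"
    by (auto simp: diffs_def algebra_simps power2_eq_square)
  finally have eq: "(\<Sum>n. (of_nat n + 1)\<^sup>2 * c (Suc n) * x ^ n) = (\<Sum>n. diffs c n * x ^ n) + x * (\<Sum>n. diffs (diffs c) n * x ^ n)"
    by (simp add: sums_iff)
  show ?thesis unfolding eq
    by (rule derivative_eq_intros termdiffs_strong_converges_everywhere s1 refl)+ simp
qed

definition "J0_series' \<tau> = (\<Sum>k. diffs J0_coeff k * \<tau> ^ k)"
definition "Y0_series' \<tau> = (\<Sum>k. diffs Y0_coeff k * \<tau> ^ k)"

lemma J0_series_deriv: "(J0_series has_field_derivative J0_series' \<tau>) (at \<tau>)"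
  unfolding J0_series_def[abs_def] J0_series'_def
  by (rule termdiffs_strong_converges_everywhere[OF summable_J0_coeff])

lemma Y0_series_deriv: "(Y0_series has_field_derivative Y0_series' \<tau>) (at \<tau>)"
  unfolding Y0_series_def[abs_def] Y0_series'_def
  by (rule termdiffs_strong_converges_everywhere[OF summable_Y0_coeff])

lemma of_nat_plus_1_neq_0: "(of_nat n + 1 :: complex) \<noteq> 0"
proof -
  have "of_nat (Suc n) \<noteq> (0::complex)" by (rule of_nat_neq_0)
  moreover have "of_nat (Suc n) = (of_nat n + 1 :: complex)" by (subst of_nat_Suc) (rule add.commute)
  ultimately show ?thesis by (simp only: not_False_eq_True)
qed

lemma fact_Suc_complex: "(fact (Suc n) :: complex) = (of_nat n + 1) * fact n"
  by (subst fact_Suc, subst of_nat_Suc, subst add.commute) (rule refl)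

lemma cancel_square: "a \<noteq> 0 \<Longrightarrow> a\<^sup>2 * (s / (a * f)\<^sup>2) = s / (f::complex)\<^sup>2"
  by (simp only: power_mult_distrib times_divide_eq_right)
    (simp only: mult_divide_mult_cancel_left power_eq_0_iff not_False_eq_True simp_thms)

lemma cancel_square_once:
  assumes "a \<noteq> 0"
  shows "a * (s / (a * f)\<^sup>2) = s / (a * (f::complex)\<^sup>2)"
  using mult_divide_mult_cancel_left[OF assms, of s "a * f\<^sup>2"]
  by (simp only: power_mult_distrib times_divide_eq_right power2_eq_square[of a] mult.assoc)

lemma J0_series_ode:
  "((\<lambda>\<tau>. \<tau> * J0_series' \<tau>) has_field_derivative - J0_series x) (at x)"
proof -
  have "(of_nat n + 1)\<^sup>2 * J0_coeff (Suc n) * x ^ n = - (J0_coeff n * x ^ n)" for n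
  proof -
    have "a\<^sup>2 * (- s / (a * f)\<^sup>2) * y = - (s / f\<^sup>2 * y)" if "a \<noteq> 0" for a s f y :: complex
      by (subst cancel_square[OF that]) (simp only: minus_divide_left[symmetric] mult_minus_left)
    from this[OF of_nat_plus_1_neq_0, of n "(-1)^n" "fact n" "x ^ n"] show ?thesis
      unfolding J0_coeff_def fact_Suc_complex power_Suc mult_minus1 .
  qed
  then have "(\<Sum>n. (of_nat n + 1)\<^sup>2 * J0_coeff (Suc n) * x ^ n) = - J0_series x"
    by (simp add: J0_series_def suminf_minus summable_J0_coeff)
  then show ?thesis
    using power_series_euler_operator[OF summable_J0_coeff, of x] unfolding J0_series'_def by simp
qed

text \<open>
  The inhomogeneity \<open>- J0_series'\<close> is the one produced by the logarithm in \<open>ln \<tau> J\<^sub>0/2 + Y\<close>, so that this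
  combination solves the homogeneous equation; it arises from \<open>\<psi>(n + 2) = \<psi>(n + 1) + 1/(n + 1)\<close>.
\<close>

lemma Y0_series_ode:
  "((\<lambda>\<tau>. \<tau> * Y0_series' \<tau>) has_field_derivative - Y0_series x - J0_series' x) (at x)"
proof -
  have "(of_nat n + 1)\<^sup>2 * Y0_coeff (Suc n) * x ^ n = - (Y0_coeff n * x ^ n) - diffs J0_coeff n * x ^ n" for n
  proof -
    have ne: "(of_nat n + 1 :: complex) \<noteq> 0" by (rule of_nat_plus_1_neq_0)
    then have dig: "Digamma (of_nat n + 1 + 1 :: complex) = Digamma (of_nat n + 1) + 1 / (of_nat n + 1)"
      by (rule Digamma_plus1)
    have "a\<^sup>2 * - ((- s) * (d + 1 / a) / (a * f)\<^sup>2) * y = - (- (s * d / f\<^sup>2) * y) - a * (- s / (a * f)\<^sup>2) * y"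
      if a: "a \<noteq> 0" for a s f y d :: complex
    proof -
      have "a\<^sup>2 * - ((- s) * (d + 1 / a) / (a * f)\<^sup>2) * y = s * (d + 1/a) / f\<^sup>2 * y"
        by (simp only: cancel_square[OF a] minus_divide_left mult_minus_left minus_minus)
      also have "\<dots> = s * d / f\<^sup>2 * y + s / (a * f\<^sup>2) * y"
        by (simp add: divide_inverse algebra_simps)
      also have "s / (a * f\<^sup>2) * y =  - (a * (- s / (a * f)\<^sup>2) * y)"
        by (subst cancel_square_once[OF a]) (simp only: minus_divide_left[symmetric] mult_minus_left minus_minus)
      finally show ?thesis by simp
    qed
    from this[OF ne, of "(-1)^n" "Digamma (of_nat n + 1)" "fact n" "x ^ n"]
    have "(of_nat n + 1)\<^sup>2 * - ((- ((-1)^n)) * (Digamma (of_nat n + 1) + 1 / (of_nat n + 1)) / ((of_nat n + 1) * fact n)\<^sup>2) * x ^ n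
      = - (- ((-1)^n * Digamma (of_nat n + 1) / (fact n)\<^sup>2) * x ^ n) - (of_nat n + 1) * (- ((-1)^n) / ((of_nat n + 1) * fact n)\<^sup>2) * x ^ n" .
    moreover have "Y0_coeff (Suc n) = - ((- ((-1)^n)) * (Digamma (of_nat n + 1) + 1 / (of_nat n + 1)) / ((of_nat n + 1) * fact n)\<^sup>2)"
      unfolding Y0_coeff_def fact_Suc_complex power_Suc mult_minus1 of_nat_Suc add.commute[of 1 "of_nat n"] dig ..
    moreover have "diffs J0_coeff n = (of_nat n + 1) * (- ((-1) ^ n) / ((of_nat n + 1) * fact n)\<^sup>2)"
      unfolding J0_coeff_def diffs_def fact_Suc_complex power_Suc mult_minus1 of_nat_Suc add.commute[of 1 "of_nat n"] ..
    ultimately show ?thesis by (simp only: Y0_coeff_def[of n])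
  qed
  then have "(\<Sum>n. (of_nat n + 1)\<^sup>2 * Y0_coeff (Suc n) * x ^ n) = - Y0_series x - J0_series' x"
    by (simp add: Y0_series_def J0_series'_def suminf_minus suminf_diff[symmetric] summable_minus summable_Y0_coeff termdiff_converges_all[OF summable_J0_coeff])
  then show ?thesis
    using power_series_euler_operator[OF summable_Y0_coeff, of x] unfolding Y0_series'_def by simp
qed

section \<open>Macdonald's integral\<close>

text \<open>
  The modified Bessel function \<open>K\<^sub>0\<close>, on the right half-plane.
\<close>

definition macdonald :: "complex \<Rightarrow> complex" where
  "macdonald u = (LINT t:{0..}|lborel. exp (- u * of_real (cosh t)))"

lemma cosh_ge_arg: "cosh t \<ge> (t::real)"
proof (cases "t \<ge> 0")
  case True
  have "1 + t + t\<^sup>2 / 2 \<le> exp t" by (rule exp_lower_Taylor_quadratic[OF True])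
  moreover have "exp (-t) \<ge> 1 - t" using exp_ge_add_one_self[of "-t"] by simp
  moreover have "(t - 2)\<^sup>2 \<ge> 0" by simp
  moreover have "exp t + exp (-t) = 2 * cosh t" by (simp add: cosh_def)
  ultimately show ?thesis by (simp add: power2_eq_square algebra_simps)
next
  case False
  then show ?thesis using cosh_real_pos[of t] by linarith
qed

lemma norm_exp_cosh_le:
  assumes "a \<le> Re u" "0 \<le> a"
  shows "norm (exp (- u * of_real (cosh t))) \<le> exp (- a * t)"
proof -
  have "a * t \<le> a * cosh t" using assms cosh_ge_arg by (intro mult_left_mono)
  also have "\<dots> \<le> Re u * cosh t" using assms by (intro mult_right_mono) auto
  finally show ?thesis by (simp add: Re_divide)
qed

lemma set_integrable_exp_minus: "a > 0 \<Longrightarrow> set_integrable lborel {c..} (\<lambda>t::real. exp (- a * t))"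
proof -
  assume a: "a > 0"
  have "(\<lambda>t::real. exp (- a * t)) absolutely_integrable_on {c..}"
    by (intro nonnegative_absolutely_integrable_1 integrable_on_exp_minus_to_infinity a) auto
  then show ?thesis
    unfolding set_integrable_def by (subst (asm) integrable_completion) auto
qed

lemma measurable_exp_cosh [measurable]:
  "(\<lambda>t::real. exp (- u * complex_of_real (cosh t))) \<in> borel_measurable borel"
  by (intro borel_measurable_continuous_onI continuous_intros)

lemma macdonald_set_integrable:
  assumes "Re u > 0"
  shows "set_integrable lborel {0..} (\<lambda>t. exp (- u * of_real (cosh t)))"
  using set_integrable_exp_minus[OF assms, of 0]
  by (rule set_integrable_bound) (use assms norm_exp_cosh_le[of "Re u" u] measurable_exp_cosh[of u] in \<open>auto simp: set_borel_measurable_def\<close>)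

text \<open>
  The integral over a bounded interval, differentiated \<open>k\<close> times in \<open>u\<close> under the integral sign. There
  the differentiation is elementary; Weierstrass' theorem on locally uniform limits of
  holomorphic functions then carries it over to the improper integral.
\<close>

definition macdonald_trunc :: "nat \<Rightarrow> real \<Rightarrow> complex \<Rightarrow> complex" where
  "macdonald_trunc k b u = integral {0..b} (\<lambda>t. (- of_real (cosh t)) ^ k * exp (- u * of_real (cosh t)))"

lemma macdonald_trunc_deriv:
  "(macdonald_trunc k b has_field_derivative macdonald_trunc (Suc k) b u) (at u)"
proof -
  have "((\<lambda>u. integral (cbox 0 b) (\<lambda>t. (- of_real (cosh t)) ^ k * exp (- u * of_real (cosh t))))
     has_field_derivative integral (cbox 0 b) (\<lambda>t. (- of_real (cosh t)) ^ Suc k * exp (- u * of_real (cosh t)))) (at u within UNIV)"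
    by (rule leibniz_rule_field_derivative)
      (auto intro!: derivative_eq_intros integrable_continuous_real continuous_intros simp: case_prod_unfold)
  then show ?thesis by (simp add: macdonald_trunc_def[abs_def])
qed

lemma macdonald_trunc_holomorphic: "macdonald_trunc k b holomorphic_on A"
  unfolding holomorphic_on_def field_differentiable_def
  using has_field_derivative_at_within[OF macdonald_trunc_deriv] by blast

lemma macdonald_trunc_uniform:
  assumes "a > 0"
  shows "uniform_limit {u. Re u \<ge> a} (\<lambda>b u. macdonald_trunc 0 b u) macdonald at_top"
proof -
  have "uniform_limit {u. Re u \<ge> a} (\<lambda>b u. LINT t:{0..b}|lborel. exp (- u * of_real (cosh t)))
           (\<lambda>u. LINT t:{0..}|lborel. exp (- u * of_real (cosh t))) at_top"
    by (rule uniform_limit_set_lebesgue_integral_at_top[OF _ set_integrable_exp_minus[OF assms]])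
      (use norm_exp_cosh_le[of a] assms measurable_exp_cosh in \<open>auto simp: set_borel_measurable_def\<close>)
  also have "(\<lambda>b u. LINT t:{0..b}|lborel. exp (- u * of_real (cosh t))) = (\<lambda>b u. macdonald_trunc 0 b u)"
    unfolding macdonald_trunc_def
    by (intro ext, subst set_borel_integral_eq_integral(2))
      (auto intro!: borel_integrable_atLeastAtMost' continuous_intros)
  finally show ?thesis unfolding macdonald_def[abs_def] .
qed

lemma open_halfplane_Re: "open {u. Re u > a}"
  using open_halfspace_Re_gt[of a] by simp

lemma macdonald_deriv_limits:
  assumes "Re u > 0"
  shows "((\<lambda>b. macdonald_trunc k b u) \<longlongrightarrow> (deriv ^^ k) macdonald u) at_top"
proof -
  have d: "(deriv ^^ k) (macdonald_trunc 0 b) = macdonald_trunc k b" for b k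
    by (induction k) (auto intro!: DERIV_imp_deriv macdonald_trunc_deriv)
  have "((\<lambda>b. (deriv ^^ k) (macdonald_trunc 0 b) u) \<longlongrightarrow> (deriv ^^ k) macdonald u) at_top"
  proof (rule higher_deriv_complex_uniform_limit)
    show "uniform_limit {v. Re v > Re u / 2} (macdonald_trunc 0) macdonald at_top"
      by (rule uniform_limit_on_subset[OF macdonald_trunc_uniform[of "Re u / 2"]]) (use assms in auto)
    show "\<forall>\<^sub>F n in at_top. macdonald_trunc 0 n holomorphic_on {v. Re u / 2 < Re v}"
      by (intro always_eventually allI macdonald_trunc_holomorphic)
    show "open {v. Re u / 2 < Re v}" by (rule open_halfplane_Re)
  qed (use assms in auto)
  then show ?thesis unfolding d .
qed

lemma macdonald_holomorphic: "macdonald holomorphic_on {u. Re u > 0}"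
proof (rule holomorphic_uniform_sequence[where f = "\<lambda>n. macdonald_trunc 0 (real n)"])
  show "open {u. 0 < Re u}" by (rule open_halfplane_Re)
  show "macdonald_trunc 0 (real n) holomorphic_on {u. 0 < Re u}" for n
    by (rule macdonald_trunc_holomorphic)
  fix u :: complex assume u: "u \<in> {u. 0 < Re u}"
  have sub: "cball u (Re u / 2) \<subseteq> {v. Re v \<ge> Re u / 2}"
  proof
    fix v assume "v \<in> cball u (Re u / 2)"
    then have "\<bar>Re (u - v)\<bar> \<le> Re u / 2" using abs_Re_le_cmod[of "u - v"] by (auto simp: dist_norm)
    from abs_le_D1[OF this] have "Re v \<ge> Re u / 2" by (simp add: field_simps)
    then show "v \<in> {v. Re v \<ge> Re u / 2}" by simp
  qed
  have "uniform_limit (cball u (Re u / 2)) (\<lambda>b u. macdonald_trunc 0 b u) macdonald at_top"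
    by (rule uniform_limit_on_subset[OF macdonald_trunc_uniform[of "Re u / 2"] sub]) (use u in auto)
  then have "uniform_limit (cball u (Re u / 2)) (\<lambda>n u. macdonald_trunc 0 (real n) u) macdonald sequentially"
    by (rule filterlim_compose) (rule filterlim_real_sequentially)
  then show "\<exists>d>0. cball u d \<subseteq> {u. 0 < Re u} \<and> uniform_limit (cball u d) (\<lambda>n. macdonald_trunc 0 (real n)) macdonald sequentially"
    using sub u by (intro exI[of _ "Re u / 2"]) auto
qed

text \<open>
  The integrand of the left-hand side is the \<open>t\<close>-derivative of \<open>- sinh t exp(- u cosh t) / u\<close>.
\<close>

lemma macdonald_trunc_ode:
  assumes "u \<noteq> 0" "b \<ge> 0"
  shows "macdonald_trunc 2 b u + macdonald_trunc 1 b u / u - macdonald_trunc 0 b u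
           = - of_real (sinh b) * exp (- u * of_real (cosh b)) / u"
proof -
  let ?e = "\<lambda>t. exp (- u * of_real (cosh t)) :: complex"
  let ?F = "\<lambda>t. - of_real (sinh t) * ?e t / u"
  let ?F' = "\<lambda>t. (- of_real (cosh t))\<^sup>2 * ?e t + (- of_real (cosh t)) ^ 1 * ?e t / u - (- of_real (cosh t)) ^ 0 * ?e t"
  have ch: "((\<lambda>t. of_real (cosh t) :: complex) has_vector_derivative of_real (sinh t)) (at t)" for t
    by (auto intro!: derivative_eq_intros has_vector_derivative_of_real simp flip: has_real_derivative_iff_has_vector_derivative)
  have sh: "((\<lambda>t. of_real (sinh t) :: complex) has_vector_derivative of_real (cosh t)) (at t)" for t
    by (auto intro!: derivative_eq_intros has_vector_derivative_of_real simp flip: has_real_derivative_iff_has_vector_derivative)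
  have e: "(?e has_vector_derivative (- u * of_real (sinh t)) * ?e t) (at t)" for t
  proof -
    have "((\<lambda>x. exp (- u * x)) has_field_derivative (- u) * exp (- u * of_real (cosh t))) (at (of_real (cosh t)))"
      by (auto intro!: derivative_eq_intros)
    from field_vector_diff_chain_at[OF ch this] show ?thesis by (simp add: o_def mult_ac)
  qed
  have F: "(?F has_vector_derivative ?F' t) (at t)" for t
  proof -
    have 1: "of_real (cosh t) ^ 2 = (1 + of_real (sinh t) ^ 2 :: complex)"
      by (metis cosh_square_eq of_real_1 of_real_add of_real_power add.commute)
    have "(?F has_vector_derivative (- of_real (sinh t) * ((- u * of_real (sinh t)) * ?e t) + (- of_real (cosh t)) * ?e t) / u) (at t)"
      by (intro has_vector_derivative_divide has_vector_derivative_mult has_vector_derivative_minus e sh)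
    moreover have "(- of_real (sinh t) * ((- u * of_real (sinh t)) * ?e t) + (- of_real (cosh t)) * ?e t) / u = ?F' t"
      using assms 1 by (simp add: field_simps power2_eq_square)
    ultimately show ?thesis by simp
  qed
  have "(?F' has_integral (?F b - ?F 0)) {0..b}"
    by (rule fundamental_theorem_of_calculus[OF \<open>b \<ge> 0\<close>]) (rule has_vector_derivative_at_within[OF F])
  note FTC = this
  have int: "(\<lambda>t. (- of_real (cosh t)) ^ k * ?e t) integrable_on {0..b}" for k
    by (auto intro!: integrable_continuous_real continuous_intros)
  have "(?F' has_integral (macdonald_trunc 2 b u + macdonald_trunc 1 b u / u - macdonald_trunc 0 b u)) {0..b}"
    unfolding macdonald_trunc_def
    by (intro has_integral_add has_integral_diff has_integral_divide integrable_integral int)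
  from has_integral_unique[OF this FTC] show ?thesis by simp
qed

lemma macdonald_ode:
  assumes u: "Re u > 0"
  shows "(deriv ^^ 2) macdonald u + deriv macdonald u / u - macdonald u = 0"
proof -
  have u0: "u \<noteq> 0" using u by auto
  have lim: "((\<lambda>b. macdonald_trunc 2 b u + macdonald_trunc 1 b u / u - macdonald_trunc 0 b u) \<longlongrightarrow>
     (deriv ^^ 2) macdonald u + (deriv ^^ 1) macdonald u / u - (deriv ^^ 0) macdonald u) at_top"
    by (intro tendsto_intros macdonald_deriv_limits u u0)
  have "((\<lambda>b::real. cosh b * exp (- Re u * cosh b)) \<longlongrightarrow> 0) at_top"
  proof -
    have "((\<lambda>y. y * exp (- Re u * y)) \<longlongrightarrow> 0) at_top"
      using u by real_asymp
    then show ?thesis by (rule filterlim_compose) (rule cosh_real_at_top)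
  qed
  then have "((\<lambda>b::real. cosh b * exp (- Re u * cosh b) / norm u) \<longlongrightarrow> 0) at_top"
    by (rule tendsto_divide_zero)
  then have "((\<lambda>b. - of_real (sinh b) * exp (- u * of_real (cosh b)) / u) \<longlongrightarrow> 0) at_top"
  proof (rule Lim_null_comparison[rotated])
    show "\<forall>\<^sub>F b in at_top. norm (- complex_of_real (sinh b) * exp (- u * of_real (cosh b)) / u) \<le> cosh b * exp (- Re u * cosh b) / norm u"
    proof (intro always_eventually allI)
      fix b :: real
      have "(sinh b)\<^sup>2 \<le> (cosh b)\<^sup>2" using cosh_square_eq[of b] by simp
      then have "\<bar>sinh b\<bar> \<le> cosh b" using abs_le_square_iff[of "sinh b" "cosh b"] cosh_real_pos[of b] by simp
      moreover have "norm (- complex_of_real (sinh b) * exp (- u * of_real (cosh b)) / u) = \<bar>sinh b\<bar> * exp (- Re u * cosh b) / norm u"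
        by (simp add: norm_mult norm_divide)
      ultimately show "norm (- complex_of_real (sinh b) * exp (- u * of_real (cosh b)) / u) \<le> cosh b * exp (- Re u * cosh b) / norm u"
        by (simp only:) (intro divide_right_mono mult_right_mono; simp)
    qed
  qed
  moreover have "\<forall>\<^sub>F b in at_top. - of_real (sinh b) * exp (- u * of_real (cosh b)) / u = macdonald_trunc 2 b u + macdonald_trunc 1 b u / u - macdonald_trunc 0 b u"
    using eventually_ge_at_top[of 0] by eventually_elim (rule macdonald_trunc_ode[OF u0, symmetric])
  ultimately have "((\<lambda>b. macdonald_trunc 2 b u + macdonald_trunc 1 b u / u - macdonald_trunc 0 b u) \<longlongrightarrow> 0) at_top"
    by (rule Lim_transform_eventually)
  from tendsto_unique[OF _ lim this] show ?thesis by simp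
qed

lemma Re_mult_real_cosh: "Re (- u * of_real (cosh t)) = - Re u * cosh t"
  by simp

lemma measurable_exp_minus_cosh:
  "(\<lambda>x::real. indicator {0..} x * exp (- cosh x)) \<in> borel_measurable borel"
proof -
  have [measurable]: "(\<lambda>x::real. exp (- cosh x)) \<in> borel_measurable borel"
    by (intro borel_measurable_continuous_onI continuous_intros)
  show ?thesis by measurable
qed

text \<open>
  From \<open>(Re u - 1) (cosh t - 1) \<ge> 0\<close> one gets \<open>Re u cosh t \<ge> (Re u - 1) + cosh t\<close>, which splits off the
  exponential in \<open>u\<close>.
\<close>

lemma macdonald_bound:
  assumes "Re u \<ge> 1"
  shows "norm (macdonald u) \<le> exp (1 - Re u) * (LINT t:{0..}|lborel. exp (- cosh t))"
proof -
  have i1: "set_integrable lborel {0..} (\<lambda>t. exp (- cosh t :: real))"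
    using set_integrable_exp_minus[of 1 0]
    by (rule set_integrable_bound)
      (use cosh_ge_arg in \<open>auto simp: set_borel_measurable_def intro!: measurable_exp_minus_cosh\<close>)
  have "norm (macdonald u) \<le> (LINT t:{0..}|lborel. norm (exp (- u * of_real (cosh t))))"
    unfolding macdonald_def
    by (intro set_integral_norm_bound macdonald_set_integrable) (use assms in linarith)
  also have "\<dots> \<le> (LINT t:{0..}|lborel. exp (1 - Re u) * exp (- cosh t))"
  proof (rule set_integral_mono)
    show "set_integrable lborel {0..} (\<lambda>t. norm (exp (- u * of_real (cosh t))))"
      by (intro set_integrable_norm macdonald_set_integrable) (use assms in auto)
    show "set_integrable lborel {0..} (\<lambda>t. exp (1 - Re u) * exp (- cosh t))"
      by (intro set_integrable_mult_right i1)
    fix t :: real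
    have "0 \<le> (Re u - 1) * (cosh t - 1)" using assms cosh_real_ge_1[of t] by (intro mult_nonneg_nonneg) auto
    then have "- Re u * cosh t \<le> (1 - Re u) + (- cosh t)" by (simp add: algebra_simps)
    then have "exp (- Re u * cosh t) \<le> exp (1 - Re u) * exp (- cosh t)"
      unfolding exp_add[symmetric] exp_le_cancel_iff .
    then show "norm (exp (- u * of_real (cosh t))) \<le> exp (1 - Re u) * exp (- cosh t)"
      by (simp only: norm_exp_eq_Re Re_mult_real_cosh)
  qed
  also have "\<dots> = exp (1 - Re u) * (LINT t:{0..}|lborel. exp (- cosh t))"
    by (rule set_integral_mult_right)
  finally show ?thesis .
qed

lemma macdonald_decay:
  obtains C where "C > 0" "\<And>u. Re u \<ge> 2 \<Longrightarrow> norm (macdonald u) \<le> C * exp (- Re u)"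
    "\<And>u. Re u \<ge> 2 \<Longrightarrow> norm (deriv macdonald u) \<le> C * exp (- Re u)"
proof -
  define L where "L = (LINT t:{0..}|lborel. exp (- cosh t) :: real)"
  have L0: "L \<ge> 0" unfolding L_def set_lebesgue_integral_def by (intro Bochner_Integration.integral_nonneg) auto
  have B: "norm (macdonald u) \<le> exp (1 - Re u) * L" if "Re u \<ge> 1" for u
    unfolding L_def by (rule macdonald_bound[OF that])
  let ?C = "exp 2 * L + 1"
  show ?thesis
  proof (rule that[of ?C])
    show "?C > 0" using L0 by (auto intro: add_nonneg_pos)
    fix u :: complex assume u: "Re u \<ge> 2"
    have le: "exp (2 - Re u) * L \<le> ?C * exp (- Re u)"
    proof -
      have "exp (2 - Re u) = exp 2 * exp (- Re u)" by (simp add: exp_diff exp_minus divide_inverse)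
      then show ?thesis by (simp add: distrib_right mult_ac)
    qed
    have "exp (1 - Re u) * L \<le> exp (2 - Re u) * L" using L0 by (intro mult_right_mono) auto
    then show "norm (macdonald u) \<le> ?C * exp (- Re u)" using B[of u] u le by simp
    have hp: "Re v > 0 \<and> 1 - Re v \<le> 2 - Re u" if "norm (u - v) \<le> 1" for v
      using that u abs_Re_le_cmod[of "u - v"] by auto
    have sub: "cball u 1 \<subseteq> {v. Re v > 0}" using hp by (auto simp: dist_norm)
    \<comment> \<open>On the unit disc around \<open>u\<close> the bound on \<open>K\<close> deteriorates by a factor \<open>e\<close> only,
      so Cauchy's inequality bounds the derivative.\<close>
    have "norm ((deriv ^^ 1) macdonald u) \<le> fact 1 * (exp (2 - Re u) * L) / 1 ^ 1"
    proof (rule Cauchy_inequality)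
      show "macdonald holomorphic_on ball u 1"
        by (rule holomorphic_on_subset[OF macdonald_holomorphic]) (use sub ball_subset_cball in blast)
      show "continuous_on (cball u 1) macdonald"
        by (rule holomorphic_on_imp_continuous_on[OF holomorphic_on_subset[OF macdonald_holomorphic sub]])
      fix v assume v: "norm (u - v) = 1"
      then have "1 - Re v \<le> 2 - Re u" "Re v \<ge> 1" using hp[of v] u by auto
      have "norm (macdonald v) \<le> exp (1 - Re v) * L" by (rule B) fact
      also have "\<dots> \<le> exp (2 - Re u) * L" using \<open>1 - Re v \<le> 2 - Re u\<close> L0 by (intro mult_right_mono) auto
      finally show "norm (macdonald v) \<le> exp (2 - Re u) * L" .
    qed simp
    then show "norm (deriv macdonald u) \<le> ?C * exp (- Re u)" using le by simp
  qed
qed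

section \<open>The logarithmic singularity of Macdonald's integral\<close>

text \<open>
  An integrable majorant of \<open>exp(- |t|)\<close>, assembled from two half-lines.
\<close>

definition two_sided_exp :: "real \<Rightarrow> real" where
  "two_sided_exp t = indicator {0..} t * exp (- t) + indicator {0..} (- t) * exp t"

lemma two_sided_exp_integrable: "integrable lborel two_sided_exp"
proof -
  have i: "integrable lborel (\<lambda>t::real. indicator {0..} t * exp (- t))"
    using set_integrable_exp_minus[of 1 0] by (simp add: set_integrable_def)
  moreover have "integrable lborel (\<lambda>t::real. indicator {0..} (- t) * exp t)"
    using lborel_integrable_real_affine[OF i, of "-1" 0] by simp
  ultimately show ?thesis unfolding two_sided_exp_def[abs_def] by (rule Bochner_Integration.integrable_add)
qed

lemma two_sided_exp_ge: "exp (- \<bar>t\<bar>) \<le> two_sided_exp t"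
  by (auto simp: two_sided_exp_def indicator_def)

lemma abs_exp_minus_one_le: "y \<ge> 0 \<Longrightarrow> \<bar>exp (- y) - 1\<bar> \<le> (y::real)"
  using exp_ge_add_one_self[of "-y"] by (auto simp: abs_if)

lemma exp_minus_exp_le: "t \<ge> 0 \<Longrightarrow> exp (- exp t) \<le> 2 * exp (- 2 * (t::real))"
proof -
  have "exp t ^ 2 / 2 \<le> exp (exp t)"
    using exp_lower_Taylor_quadratic[of "exp t"] by (smt (verit) exp_gt_zero)
  moreover have "exp t ^ 2 = exp (2 * t)" by (simp add: exp_double)
  ultimately show ?thesis by (simp add: exp_minus field_simps)
qed

text \<open>
  The integrand of \<open>\<Gamma>(a) - 1/a\<close> after the substitution \<open>v = e\<^sup>t\<close> in the Gamma integral. The subtracted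
  \<open>1/a\<close> is the integral of \<open>e\<^sup>a\<^sup>t\<close> over \<open>t < 0\<close>; without it the limit \<open>a \<longlongrightarrow> 0\<close> would diverge.
\<close>

definition gamma_kernel :: "real \<Rightarrow> real \<Rightarrow> real" where
  "gamma_kernel a t = exp (a * t) * (exp (- exp t) - indicator {..<0} t)"

lemma gamma_kernel_measurable [measurable]: "gamma_kernel a \<in> borel_measurable borel"
  unfolding gamma_kernel_def[abs_def] by measurable

lemma gamma_kernel_bound:
  assumes "0 \<le> a" "a \<le> 1"
  shows "\<bar>gamma_kernel a t\<bar> \<le> 2 * two_sided_exp t"
proof -
  have "\<bar>gamma_kernel a t\<bar> \<le> 2 * exp (- \<bar>t\<bar>)"
  proof (cases "t < 0")
    case True
    have "exp (a * t) \<le> 1" using True assms by (simp add: mult_nonneg_nonpos)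
    moreover have "\<bar>exp (- exp t) - 1\<bar> \<le> exp t" by (rule abs_exp_minus_one_le) simp
    ultimately have "exp (a * t) * \<bar>exp (- exp t) - 1\<bar> \<le> 1 * exp t" by (intro mult_mono) auto
    then have "exp (a * t) * \<bar>exp (- exp t) - 1\<bar> \<le> 2 * exp t" using exp_gt_zero[of t] by linarith
    then show ?thesis using True by (simp add: gamma_kernel_def abs_mult)
  next
    case False
    then have "exp (a * t) \<le> exp (1 * t)" using assms by (intro iffD2[OF exp_le_cancel_iff] mult_right_mono) auto
    then have "exp (a * t) * exp (- exp t) \<le> exp t * (2 * exp (- 2 * t))"
      using False exp_minus_exp_le[of t] by (intro mult_mono) auto
    also have "\<dots> = 2 * exp (- t)" by (simp flip: exp_add)
    finally show ?thesis using False by (simp add: gamma_kernel_def abs_mult)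
  qed
  then show ?thesis using two_sided_exp_ge[of t] by linarith
qed

lemma gamma_kernel_integrable:
  assumes "0 \<le> a" "a \<le> 1"
  shows "integrable lborel (gamma_kernel a)"
  by (rule Bochner_Integration.integrable_bound[OF integrable_mult_right[OF two_sided_exp_integrable, of 2]])
    (use gamma_kernel_bound[OF assms] in \<open>auto intro: order.trans[OF _ abs_ge_self]\<close>)

lemma gamma_kernel_integral:
  assumes "0 < a" "a \<le> 1"
  shows "(LINT t|lborel. gamma_kernel a t) = Gamma a - 1 / a"
proof -
  let ?F1 = "\<lambda>v::real. v powr (a - 1) / exp v"
  let ?F2 = "\<lambda>v::real. if v \<in> {0..1} then v powr (a - 1) else 0"
  let ?F = "\<lambda>v. ?F1 v - ?F2 v"
  have h1: "(?F1 has_integral Gamma a) {0..}" by (rule Gamma_integral_real[OF assms(1)])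
  have "((\<lambda>v::real. v powr (a - 1)) has_integral (1 powr (a - 1 + 1) / (a - 1 + 1))) {0..1}"
    by (rule has_integral_powr_from_0) (use assms in auto)
  then have h2: "(?F2 has_integral 1 / a) {0..}"
    by (subst has_integral_restrict) auto
  have h: "(?F has_integral (Gamma a - 1 / a)) {0..}" by (rule has_integral_diff[OF h1 h2])
  have "?F1 absolutely_integrable_on {0..}" "?F2 absolutely_integrable_on {0..}"
    using h1 h2 by (auto intro!: nonnegative_absolutely_integrable_1)
  then have "?F absolutely_integrable_on {0..}" by (rule set_integral_diff)
  then have ai: "?F absolutely_integrable_on {0<..}"
    by (rule set_integrable_subset) auto
  have "(?F has_integral (Gamma a - 1 / a)) {0<..}"
    by (rule iffD1[OF has_integral_spike_set_eq h]) (auto intro!: negligible_subset[OF negligible_sing[of 0]])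
  then have in0: "integral {0<..} ?F = Gamma a - 1 / a" by (rule integral_unique)
  have rng: "exp ` (UNIV :: real set) = {0<..}" by (auto simp: image_def) (metis exp_ln)
  have "integral UNIV (\<lambda>t. \<bar>exp t\<bar> * ?F (exp t)) = Gamma a - 1 / a"
    using has_absolute_integral_change_of_variables_1'[of UNIV exp exp ?F "Gamma a - 1 / a"] ai in0
    unfolding rng by (auto intro!: derivative_eq_intros simp: inj_on_def)
  moreover have "integral UNIV (\<lambda>t. \<bar>exp t\<bar> * ?F (exp t)) = integral UNIV (gamma_kernel a)"
  proof (rule integral_spike[of "{0}"])
    fix t :: real assume "t \<in> UNIV - {0}"
    have "exp t * exp t powr (a - 1) = exp (a * t)"
      by (simp add: powr_def algebra_simps flip: exp_add)
    moreover have "exp t \<le> 1 \<longleftrightarrow> t < 0" using \<open>t \<in> UNIV - {0}\<close> by auto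
    ultimately show "gamma_kernel a t = \<bar>exp t\<bar> * ?F (exp t)"
      by (auto simp: gamma_kernel_def exp_minus divide_inverse right_diff_distrib mult.assoc[symmetric] indicator_def)
  qed auto
  ultimately show ?thesis
    using integral_lborel[OF gamma_kernel_integrable[of a]] assms by simp
qed

text \<open>
  As \<open>\<Gamma>(a) - 1/a = (\<Gamma>(1 + a) - \<Gamma>(1)) / a\<close>, the limit \<open>a \<longlongrightarrow> 0\<close> is \<open>\<Gamma>'(1)\<close>.
\<close>

lemma gamma_kernel_0_integral: "(LINT t|lborel. gamma_kernel 0 t) = - euler_mascheroni"
proof -
  let ?a = "\<lambda>n. inverse (real (Suc n))"
  have a: "0 < ?a n" "?a n \<le> 1" for n by (auto simp: field_simps)
  have "(\<lambda>n. LINT t|lborel. gamma_kernel (?a n) t) \<longlonglongrightarrow> (LINT t|lborel. gamma_kernel 0 t)"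
  proof (rule integral_dominated_convergence)
    show "integrable lborel (\<lambda>t. 2 * two_sided_exp t)" by (intro integrable_mult_right two_sided_exp_integrable)
    show "AE t in lborel. (\<lambda>n. gamma_kernel (?a n) t) \<longlonglongrightarrow> gamma_kernel 0 t"
      unfolding gamma_kernel_def by (intro always_eventually allI tendsto_intros LIMSEQ_inverse_real_of_nat)
    show "AE t in lborel. norm (gamma_kernel (?a n) t) \<le> 2 * two_sided_exp t" for n
      unfolding real_norm_def
      by (intro always_eventually allI gamma_kernel_bound less_imp_le a)
  qed auto
  moreover have "(LINT t|lborel. gamma_kernel (?a n) t) = (Gamma (1 + ?a n) - Gamma 1) / ?a n" for n
  proof -
    have "Gamma (?a n + 1) = ?a n * Gamma (?a n)"
      using a(1)[of n] by (intro Gamma_plus1) (metis linorder_not_less nonpos_Ints_nonpos)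
    then show ?thesis using gamma_kernel_integral[OF a, of n] a(1)[of n]
      by (simp only: add.commute[of 1] Gamma_1) (simp add: field_simps)
  qed
  ultimately have "(\<lambda>n. (Gamma (1 + ?a n) - Gamma 1) / ?a n) \<longlonglongrightarrow> (LINT t|lborel. gamma_kernel 0 t)" by simp
  moreover have "(\<lambda>n. (Gamma (1 + ?a n) - Gamma 1) / ?a n) \<longlonglongrightarrow> - euler_mascheroni"
  proof -
    have "(Gamma has_field_derivative Gamma 1 * Digamma 1) (at (1::real))"
      by (rule has_field_derivative_Gamma) auto
    then have "((\<lambda>h. (Gamma (1 + h) - Gamma 1) / h) \<longlongrightarrow> (- euler_mascheroni :: real)) (at 0)"
      by (simp add: DERIV_def)
    moreover have "filterlim ?a (at 0) sequentially"
      using LIMSEQ_inverse_real_of_nat by (auto simp: filterlim_at)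
    ultimately show ?thesis by (rule filterlim_compose)
  qed
  ultimately show ?thesis by (rule LIMSEQ_unique)
qed

text \<open>
  Translation by \<open>ln (x/2)\<close> turns \<open>x cosh t\<close> into \<open>e\<^sup>t + x\<^sup>2/4 e\<^sup>-\<^sup>t\<close> and the half-line \<open>t \<ge> 0\<close> into
  \<open>t \<ge> ln (x/2)\<close>. Subtracting 1 for \<open>t < 0\<close> removes exactly the logarithmic singularity of \<open>K(x)\<close>.
\<close>

definition shifted_kernel :: "real \<Rightarrow> real \<Rightarrow> real" where
  "shifted_kernel x t = indicator {ln (x / 2)..} t * (exp (- (exp t + x\<^sup>2 / 4 * exp (- t))) - indicator {..<0} t)"

lemma shifted_kernel_bound:
  assumes "x > 0"
  shows "\<bar>shifted_kernel x t\<bar> \<le> 2 * two_sided_exp t"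
proof (cases "t \<ge> ln (x / 2)")
  case False
  then show ?thesis using two_sided_exp_ge[of t] by (simp add: shifted_kernel_def) (smt (verit) exp_gt_zero)
next
  case True
  have "\<bar>shifted_kernel x t\<bar> \<le> 2 * exp (- \<bar>t\<bar>)"
  proof (cases "t < 0")
    case neg: True
    let ?y = "exp t + x\<^sup>2 / 4 * exp (- t)"
    have "x / 2 \<le> exp t" using True assms by (metis exp_le_cancel_iff exp_ln half_gt_zero)
    then have "(x / 2)\<^sup>2 \<le> (exp t)\<^sup>2" using assms by (intro power_mono) auto
    then have "x\<^sup>2 / 4 * exp (- t) \<le> (exp t)\<^sup>2 * exp (- t)" by (intro mult_right_mono) (auto simp: power_divide)
    also have "\<dots> = exp t" by (simp add: power2_eq_square exp_minus)
    finally have "?y \<le> 2 * exp t" by simp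
    moreover have "\<bar>exp (- ?y) - 1\<bar> \<le> ?y" by (rule abs_exp_minus_one_le) simp
    ultimately show ?thesis using True neg by (simp add: shifted_kernel_def)
  next
    case False
    have "exp (- (exp t + x\<^sup>2 / 4 * exp (- t))) \<le> exp (- exp t)" by simp
    also have "\<dots> \<le> exp (- t)"
      using exp_ge_add_one_self[of t] by (intro iffD2[OF exp_le_cancel_iff]) linarith
    also have "\<dots> \<le> 2 * exp (- t)" by simp
    finally show ?thesis using True False by (simp add: shifted_kernel_def)
  qed
  then show ?thesis using two_sided_exp_ge[of t] by linarith
qed

lemma shifted_kernel_measurable [measurable]: "shifted_kernel x \<in> borel_measurable borel"
  unfolding shifted_kernel_def[abs_def] by measurable

lemma shifted_kernel_integral:
  assumes x: "0 < x" "x < 2"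
  shows "macdonald (of_real x) + of_real (ln (x / 2)) = of_real (LINT t|lborel. shifted_kernel x t)"
proof -
  let ?L = "ln (x / 2)"
  have L: "?L < 0" using x by simp
  let ?k = "\<lambda>t. indicator {0..} t * exp (- x * cosh t)"
  let ?m = "\<lambda>t. indicator {?L..} t * exp (- (exp t + x\<^sup>2 / 4 * exp (- t)))"
  have "macdonald (of_real x) = (LINT t|lborel. of_real (?k t))"
    unfolding macdonald_def set_lebesgue_integral_def
    by (intro Bochner_Integration.integral_cong) (auto simp: indicator_def exp_of_real[symmetric] simp del: exp_of_real)
  also have "\<dots> = of_real (LINT t|lborel. ?k t)" by (rule integral_complex_of_real)
  also have "(LINT t|lborel. ?k t) = (LINT t|lborel. ?k (- ?L + 1 * t))"
    using lborel_integral_real_affine[of 1 ?k "- ?L"] by simp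
  also have "(\<lambda>t. ?k (- ?L + 1 * t)) = ?m"
  proof
    fix t
    have "x * cosh (t - ?L) = exp t + x\<^sup>2 / 4 * exp (- t)"
      using x by (simp add: cosh_def exp_diff exp_minus exp_ln field_simps power2_eq_square)
    then show "?k (- ?L + 1 * t) = ?m t"
      by (auto simp: indicator_def)
  qed
  finally have 1: "macdonald (of_real x) = of_real (LINT t|lborel. ?m t)" .
  have imi: "integrable lborel (shifted_kernel x)"
    by (rule Bochner_Integration.integrable_bound[OF integrable_mult_right[OF two_sided_exp_integrable, of 2]])
      (use shifted_kernel_bound[OF x(1)] in \<open>auto intro: order.trans[OF _ abs_ge_self]\<close>)
  have fin: "emeasure lborel {?L..<0} < \<infinity>" using L by simp
  have "(LINT t|lborel. ?m t) = (LINT t|lborel. shifted_kernel x t + indicator {?L..<0} t)"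
    by (intro Bochner_Integration.integral_cong) (auto simp: shifted_kernel_def indicator_def)
  also have "\<dots> = (LINT t|lborel. shifted_kernel x t) + (LINT t|lborel. indicator {?L..<0} t)"
    by (intro Bochner_Integration.integral_add imi integrable_real_indicator fin) auto
  also have "(LINT t|lborel. indicator {?L..<0} t) = - ?L" using L by simp
  finally have "(LINT t|lborel. ?m t) = (LINT t|lborel. shifted_kernel x t) - ?L" by simp
  then show ?thesis unfolding 1 by simp
qed

text \<open>
  As \<open>x\<close> tends to 0 the kernel \<open>shifted_kernel x\<close> tends to \<open>gamma_kernel 0\<close>, dominated by \<open>two_sided_exp\<close>.
\<close>

lemma macdonald_asymptotics:
  "((\<lambda>x. macdonald (of_real x) + of_real (ln (x / 2))) \<longlongrightarrow> - euler_mascheroni) (at_right 0)"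
proof (rule tendsto_at_right_sequentially[of 0 2])
  fix X :: "nat \<Rightarrow> real"
  assume X: "\<And>n. 0 < X n" "\<And>n. X n < 2" and lim: "X \<longlonglongrightarrow> 0"
  have "(\<lambda>n. LINT t|lborel. shifted_kernel (X n) t) \<longlonglongrightarrow> (LINT t|lborel. gamma_kernel 0 t)"
  proof (rule integral_dominated_convergence)
    show "integrable lborel (\<lambda>t. 2 * two_sided_exp t)" by (intro integrable_mult_right two_sided_exp_integrable)
    show "AE t in lborel. norm (shifted_kernel (X n) t) \<le> 2 * two_sided_exp t" for n
      unfolding real_norm_def by (intro always_eventually allI shifted_kernel_bound X)
    show "AE t in lborel. (\<lambda>n. shifted_kernel (X n) t) \<longlonglongrightarrow> gamma_kernel 0 t"
    proof (intro always_eventually allI)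
      fix t :: real
      have "\<forall>\<^sub>F n in sequentially. X n < 2 * exp t"
        by (rule order_tendstoD(2)[OF lim]) simp
      then have ev: "\<forall>\<^sub>F n in sequentially. exp (- (exp t + (X n)\<^sup>2 / 4 * exp (- t))) - indicator {..<0} t = shifted_kernel (X n) t"
      proof eventually_elim
        case (elim n)
        then have "ln (X n / 2) \<le> t" using X(1)[of n] ln_le_cancel_iff[of "X n / 2" "exp t"] by simp
        then show ?case by (simp add: shifted_kernel_def)
      qed
      have "(\<lambda>n. exp (- (exp t + (X n)\<^sup>2 / 4 * exp (- t))) - indicator {..<0} t) \<longlonglongrightarrow> exp (- (exp t + 0\<^sup>2 / 4 * exp (- t))) - indicator {..<0} t"
        by (intro tendsto_intros lim) auto
      then show "(\<lambda>n. shifted_kernel (X n) t) \<longlonglongrightarrow> gamma_kernel 0 t"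
        using Lim_transform_eventually[OF _ ev] by (simp add: gamma_kernel_def)
    qed
  qed auto
  then have "(\<lambda>n. complex_of_real (LINT t|lborel. shifted_kernel (X n) t)) \<longlonglongrightarrow> of_real (- euler_mascheroni)"
    unfolding gamma_kernel_0_integral by (rule tendsto_of_real)
  then show "(\<lambda>n. macdonald (of_real (X n)) + of_real (ln (X n / 2))) \<longlonglongrightarrow> - euler_mascheroni"
    by (simp add: shifted_kernel_integral X)
qed simp

section \<open>Logarithmic solutions of the Bessel equation\<close>

text \<open>
  In \<open>s = r\<^sup>2\<close> these are the solutions of the Bessel equation with logarithmic coefficient 1: note
  that \<open>ln s / 2 = ln r\<close>. The constant \<open>\<kappa>\<close> selects the multiple of the regular solution.
\<close>

definition log_series :: "complex \<Rightarrow> complex \<Rightarrow> complex \<Rightarrow> complex" where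
  "log_series \<kappa> c s = (Ln s / 2 + \<kappa>) * J0_series (c * s) + Y0_series (c * s)"

text \<open>
  This is \<open>s\<close> times the derivative, not the derivative itself: it stays bounded at \<open>s = 0\<close>, and the
  equation \<open>(s f')' = - c f\<close> becomes a first order system.
\<close>

definition log_series' :: "complex \<Rightarrow> complex \<Rightarrow> complex \<Rightarrow> complex" where
  "log_series' \<kappa> c s = J0_series (c * s) / 2 + (Ln s / 2 + \<kappa>) * (c * s * J0_series' (c * s)) + c * s * Y0_series' (c * s)"

lemma log_series_deriv:
  assumes "s \<notin> \<real>\<^sub>\<le>\<^sub>0"
  shows "(log_series \<kappa> c has_field_derivative log_series' \<kappa> c s / s) (at s)"
proof -
  have s: "s \<noteq> 0" using assms by auto
  have A: "((\<lambda>s. J0_series (c * s)) has_field_derivative J0_series' (c * s) * c) (at s)"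
    by (rule DERIV_chain2[OF J0_series_deriv]) (auto intro!: derivative_eq_intros)
  have B: "((\<lambda>s. Y0_series (c * s)) has_field_derivative Y0_series' (c * s) * c) (at s)"
    by (rule DERIV_chain2[OF Y0_series_deriv]) (auto intro!: derivative_eq_intros)
  have L: "(Ln has_field_derivative inverse s) (at s)" by (rule has_field_derivative_Ln[OF assms])
  have "(log_series \<kappa> c has_field_derivative
      ((inverse s / 2 + 0) * J0_series (c * s) + (J0_series' (c * s) * c) * (Ln s / 2 + \<kappa>)) + Y0_series' (c * s) * c) (at s)"
    unfolding log_series_def[abs_def]
    by (intro DERIV_add DERIV_mult A B DERIV_cdivide L DERIV_const)
  then show ?thesis using s by (simp add: log_series'_def field_simps)
qed

lemma log_series_ode:
  assumes "s \<notin> \<real>\<^sub>\<le>\<^sub>0"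
  shows "(log_series' \<kappa> c has_field_derivative - c * log_series \<kappa> c s) (at s)"
proof -
  have s: "s \<noteq> 0" using assms by auto
  have A: "((\<lambda>s. J0_series (c * s)) has_field_derivative J0_series' (c * s) * c) (at s)"
    by (rule DERIV_chain2[OF J0_series_deriv]) (auto intro!: derivative_eq_intros)
  have A': "((\<lambda>s. c * s * J0_series' (c * s)) has_field_derivative (- J0_series (c * s)) * c) (at s)"
    by (rule DERIV_chain2[where f = "\<lambda>\<tau>. \<tau> * J0_series' \<tau>" and g = "\<lambda>s. c * s", OF J0_series_ode])
      (auto intro!: derivative_eq_intros)
  have B': "((\<lambda>s. c * s * Y0_series' (c * s)) has_field_derivative (- Y0_series (c * s) - J0_series' (c * s)) * c) (at s)"
    by (rule DERIV_chain2[where f = "\<lambda>\<tau>. \<tau> * Y0_series' \<tau>" and g = "\<lambda>s. c * s", OF Y0_series_ode])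
      (auto intro!: derivative_eq_intros)
  have L: "(Ln has_field_derivative inverse s) (at s)" by (rule has_field_derivative_Ln[OF assms])
  have "(log_series' \<kappa> c has_field_derivative
      J0_series' (c * s) * c / 2 + ((inverse s / 2 + 0) * (c * s * J0_series' (c * s)) + (- J0_series (c * s) * c) * (Ln s / 2 + \<kappa>))
        + (- Y0_series (c * s) - J0_series' (c * s)) * c) (at s)"
    unfolding log_series'_def[abs_def]
    by (intro DERIV_add DERIV_mult A A' B' DERIV_cdivide L DERIV_const)
  then show ?thesis using s by (simp add: log_series_def field_simps)
qed

lemma square_not_nonpos:
  assumes "Re u > 0"
  shows "u\<^sup>2 \<notin> \<real>\<^sub>\<le>\<^sub>0"
proof -
  have "0 < Re u * Re u" using assms by simp
  moreover have "Re u * Re u \<le> 0" if "u\<^sup>2 \<in> \<real>\<^sub>\<le>\<^sub>0"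
    using that assms by (auto simp: complex_nonpos_Reals_iff power2_eq_square)
  ultimately show ?thesis by linarith
qed

text \<open>
  At negative arguments all terms of the series are nonnegative, so the regular solution of the
  modified equation has no zeros on the positive axis.
\<close>

lemma J0_series_neg_real:
  assumes "y \<ge> 0"
  shows "1 \<le> Re (J0_series (- of_real y))"
proof -
  have eq: "Re (J0_coeff k * (- of_real y) ^ k) = y ^ k / (fact k)\<^sup>2" for k
  proof -
    have "J0_coeff k * (- of_real y) ^ k = ((-1) ^ k * (-1) ^ k) * (of_real y ^ k / (fact k)\<^sup>2)"
      unfolding J0_coeff_def power_minus[of "of_real y"] by simp
    also have "\<dots> = of_real (y ^ k / (fact k)\<^sup>2)"
      by (simp flip: power_mult_distrib)
    finally show ?thesis by (simp only: Re_complex_of_real)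
  qed
  have s: "summable (\<lambda>k. y ^ k / (fact k)\<^sup>2)"
    using summable_Re[OF summable_J0_coeff[of "- of_real y"]] unfolding eq .
  have "(\<Sum>k\<in>{0}. y ^ k / (fact k)\<^sup>2) \<le> (\<Sum>k. y ^ k / (fact k)\<^sup>2)"
    by (rule sum_le_suminf[OF s]) (use assms in auto)
  then show ?thesis unfolding J0_series_def Re_suminf[OF summable_J0_coeff] eq by simp
qed

lemma J0_series_0: "J0_series 0 = 1"
  unfolding J0_series_def powser_zero by (simp add: J0_coeff_def)

lemma Y0_series_0: "Y0_series 0 = euler_mascheroni"
  unfolding Y0_series_def powser_zero by (simp add: Y0_coeff_def)

lemma tendsto_0_imp_series_limits:
  fixes f :: "real \<Rightarrow> complex"
  assumes "(f \<longlongrightarrow> 0) F"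
  shows "((\<lambda>x. J0_series (f x)) \<longlongrightarrow> 1) F" "((\<lambda>x. Y0_series (f x)) \<longlongrightarrow> euler_mascheroni) F"
    "((\<lambda>x. f x * J0_series' (f x)) \<longlongrightarrow> 0) F" "((\<lambda>x. f x * Y0_series' (f x)) \<longlongrightarrow> 0) F"
  using isCont_tendsto_compose[OF DERIV_isCont[OF J0_series_deriv[of 0]] assms]
    isCont_tendsto_compose[OF DERIV_isCont[OF Y0_series_deriv[of 0]] assms]
    isCont_tendsto_compose[OF DERIV_isCont[OF J0_series_ode[of 0]] assms]
    isCont_tendsto_compose[OF DERIV_isCont[OF Y0_series_ode[of 0]] assms]
  by (simp_all add: J0_series_0 Y0_series_0)

lemma tendsto_ln_mult_vanishing:
  assumes "f 0 = 0" "(f has_field_derivative D) (at 0)"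
  shows "((\<lambda>s::real. complex_of_real (ln s) * f (c * of_real s)) \<longlongrightarrow> 0) (at_right 0)"
proof -
  have "((\<lambda>s. f (c * s)) has_field_derivative D * c) (at 0)"
    by (rule DERIV_chain2[of f D "\<lambda>s. c * s" 0 c UNIV]) (use assms in \<open>auto intro!: derivative_eq_intros\<close>)
  then have "((\<lambda>s. f (c * s) / s) \<longlongrightarrow> D * c) (at 0)"
    using assms(1) by (simp add: DERIV_def)
  moreover have "filterlim complex_of_real (at 0) (at_right 0)"
    by (auto simp: filterlim_at eventually_at_filter intro!: tendsto_eq_intros)
  ultimately have 1: "((\<lambda>s::real. f (c * of_real s) / of_real s) \<longlongrightarrow> D * c) (at_right 0)"
    by (rule filterlim_compose)
  have "((\<lambda>s::real. s * ln s) \<longlongrightarrow> 0) (at_right 0)" by real_asymp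
  then have "((\<lambda>s::real. complex_of_real (s * ln s)) \<longlongrightarrow> of_real 0) (at_right 0)" by (rule tendsto_of_real)
  from tendsto_mult[OF this 1] have "((\<lambda>s::real. complex_of_real (s * ln s) * (f (c * of_real s) / of_real s)) \<longlongrightarrow> 0) (at_right 0)"
    by simp
  then show ?thesis
  proof (rule Lim_transform_eventually)
    show "\<forall>\<^sub>F s in at_right 0. complex_of_real (s * ln s) * (f (c * of_real s) / of_real s) = complex_of_real (ln s) * f (c * of_real s)"
      by (auto simp: eventually_at_filter)
  qed
qed

lemma log_series_at_0:
  "((\<lambda>s::real. log_series \<kappa> c (of_real s) - of_real (ln s) / 2) \<longlongrightarrow> \<kappa> + euler_mascheroni) (at_right 0)"
  "((\<lambda>s::real. log_series' \<kappa> c (of_real s)) \<longlongrightarrow> 1 / 2) (at_right 0)"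
proof -
  have c: "((\<lambda>s::real. c * of_real s) \<longlongrightarrow> 0) (at_right 0)" by (auto intro!: tendsto_eq_intros)
  note lims = tendsto_0_imp_series_limits[OF c]
  have 1: "((\<lambda>s::real. of_real (ln s) * (J0_series (c * of_real s) - 1)) \<longlongrightarrow> 0) (at_right 0)"
    by (rule tendsto_ln_mult_vanishing[of "\<lambda>s. J0_series s - 1"]) (auto simp: J0_series_0 intro!: derivative_eq_intros J0_series_deriv)
  have "((\<lambda>s::real. of_real (ln s) * (J0_series (c * of_real s) - 1) / 2 + \<kappa> * J0_series (c * of_real s) + Y0_series (c * of_real s)) \<longlongrightarrow> 0 / 2 + \<kappa> * 1 + euler_mascheroni) (at_right 0)"
    by (intro tendsto_intros lims 1) auto
  then have "((\<lambda>s::real. of_real (ln s) * (J0_series (c * of_real s) - 1) / 2 + \<kappa> * J0_series (c * of_real s) + Y0_series (c * of_real s)) \<longlongrightarrow> \<kappa> + euler_mascheroni) (at_right 0)"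
    by simp
  then show "((\<lambda>s::real. log_series \<kappa> c (of_real s) - of_real (ln s) / 2) \<longlongrightarrow> \<kappa> + euler_mascheroni) (at_right 0)"
  proof (rule Lim_transform_eventually)
    show "\<forall>\<^sub>F s in at_right 0. of_real (ln s) * (J0_series (c * of_real s) - 1) / 2 + \<kappa> * J0_series (c * of_real s) + Y0_series (c * of_real s)
        = log_series \<kappa> c (of_real s) - of_real (ln s) / 2"
      by (auto simp: eventually_at_filter log_series_def Ln_of_real algebra_simps diff_divide_distrib)
  qed
  have 2: "((\<lambda>s::real. of_real (ln s) * (c * of_real s * J0_series' (c * of_real s))) \<longlongrightarrow> 0) (at_right 0)"
    by (rule tendsto_ln_mult_vanishing[of "\<lambda>s. s * J0_series' s"]) (use J0_series_ode in auto)
  have "((\<lambda>s::real. J0_series (c * of_real s) / 2 + (of_real (ln s) * (c * of_real s * J0_series' (c * of_real s)) / 2 + \<kappa> * (c * of_real s * J0_series' (c * of_real s)))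
      + c * of_real s * Y0_series' (c * of_real s)) \<longlongrightarrow> 1 / 2 + (0 / 2 + \<kappa> * 0) + 0) (at_right 0)"
    by (intro tendsto_intros lims 2) auto
  then have "((\<lambda>s::real. J0_series (c * of_real s) / 2 + (of_real (ln s) * (c * of_real s * J0_series' (c * of_real s)) / 2 + \<kappa> * (c * of_real s * J0_series' (c * of_real s)))
      + c * of_real s * Y0_series' (c * of_real s)) \<longlongrightarrow> 1 / 2) (at_right 0)"
    by simp
  then show "((\<lambda>s::real. log_series' \<kappa> c (of_real s)) \<longlongrightarrow> 1 / 2) (at_right 0)"
  proof (rule Lim_transform_eventually)
    show "\<forall>\<^sub>F s in at_right 0. J0_series (c * of_real s) / 2 + (of_real (ln s) * (c * of_real s * J0_series' (c * of_real s)) / 2 + \<kappa> * (c * of_real s * J0_series' (c * of_real s)))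
      + c * of_real s * Y0_series' (c * of_real s) = log_series' \<kappa> c (of_real s)"
      by (auto simp: eventually_at_filter log_series'_def Ln_of_real algebra_simps)
  qed
qed

lemma has_field_derivative_along_reals:
  assumes "(f has_field_derivative D) (at (complex_of_real x))"
  shows "((\<lambda>x. Re (f (of_real x))) has_real_derivative Re D) (at x)"
    and "((\<lambda>x. Im (f (of_real x))) has_real_derivative Im D) (at x)"
    and "((\<lambda>x. f (of_real x)) has_vector_derivative D) (at x)"
proof -
  show v: "((\<lambda>x. f (of_real x)) has_vector_derivative D) (at x)"
    using has_vector_derivative_real_field[OF assms] .
  show "((\<lambda>x. Re (f (of_real x))) has_real_derivative Re D) (at x)"
    unfolding has_real_derivative_iff_has_vector_derivative
    by (rule bounded_linear.has_vector_derivative[OF bounded_linear_Re v])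
  show "((\<lambda>x. Im (f (of_real x))) has_real_derivative Im D) (at x)"
    unfolding has_real_derivative_iff_has_vector_derivative
    by (rule bounded_linear.has_vector_derivative[OF bounded_linear_Im v])
qed

text \<open>
  If \<open>x h'(x)\<close> tends to \<open>c\<close>, then \<open>h\<close> grows like \<open>c ln x\<close>.
\<close>

lemma no_log_growth:
  fixes h h' :: "real \<Rightarrow> real"
  assumes d: "\<And>x. x > 0 \<Longrightarrow> (h has_real_derivative h' x / x) (at x)"
    and h: "(h \<longlongrightarrow> 0) (at_right 0)" and h': "(h' \<longlongrightarrow> c) (at_right 0)"
  shows "c = 0"
proof -
  have g: "LIM x at_right 0. - ln x :> (at_top :: real filter)" by real_asymp
  have "((\<lambda>x. h x / - ln x) \<longlongrightarrow> - c) (at_right 0)"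
  proof (rule lhopital_right_0_at_top[OF g])
    show "\<forall>\<^sub>F x in at_right 0. - inverse x \<noteq> (0::real)" by (auto simp: eventually_at_filter)
    show "\<forall>\<^sub>F x in at_right 0. (h has_real_derivative h' x / x) (at x)"
      using d by (auto simp: eventually_at_filter)
    show "\<forall>\<^sub>F x in at_right 0. ((\<lambda>x. - ln x) has_real_derivative - inverse x) (at x)"
      using eventually_at_right_less by eventually_elim (auto intro!: derivative_eq_intros simp: divide_inverse)
    have "((\<lambda>x. - h' x) \<longlongrightarrow> - c) (at_right 0)" by (intro tendsto_intros h')
    then show "((\<lambda>x. h' x / x / - inverse x) \<longlongrightarrow> - c) (at_right 0)"
      by (rule Lim_transform_eventually) (auto simp: eventually_at_filter)
  qed
  moreover have "((\<lambda>x. h x / - ln x) \<longlongrightarrow> 0) (at_right 0)"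
    by (rule tendsto_divide_0[OF h filterlim_at_top_imp_at_infinity[OF g]])
  ultimately show ?thesis using tendsto_unique[of "at_right (0::real)"] by force
qed

text \<open>
  Both sides solve \<open>u (u y')' = u\<^sup>2 y\<close>, and the constant in the logarithmic series is such that their
  difference \<open>D\<close> tends to 0 at the origin. The Wronskian \<open>W\<close> of \<open>D\<close> with the regular solution \<open>P\<close> is
  constant. Since \<open>P\<close> tends to 1, this constant is the limit of \<open>u D'(u)\<close>, hence 0 as otherwise \<open>D\<close> would
  grow logarithmically. So \<open>D\<close> is a multiple of \<open>P\<close> on the positive axis, namely 0, and the identity
  theorem extends this to the half-plane.
\<close>

theorem macdonald_eq_log_series:
  assumes u: "Re u > 0"
  shows "macdonald u = - log_series (- of_real (ln 2)) (- 1 / 4) (u\<^sup>2)"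
proof -
  let ?H = "{u. Re u > (0::real)}"
  define L where "L = log_series (- of_real (ln 2)) (- 1 / 4)"
  define L' where "L' = log_series' (- of_real (ln 2)) (- 1 / 4)"
  define D where "D u = macdonald u + L (u\<^sup>2)" for u
  define D1 where "D1 u = u * deriv macdonald u + 2 * L' (u\<^sup>2)" for u
  define P where "P u = J0_series (- 1 / 4 * u\<^sup>2)" for u
  define P1 where "P1 u = 2 * ((- 1 / 4 * u\<^sup>2) * J0_series' (- 1 / 4 * u\<^sup>2))" for u
  have oH: "open ?H" by (rule open_halfplane_Re)
  have Kd: "(macdonald has_field_derivative deriv macdonald u) (at u)" if "u \<in> ?H" for u
    by (rule holomorphic_derivI[OF macdonald_holomorphic oH that])
  have Kdd: "(deriv macdonald has_field_derivative deriv (deriv macdonald) u) (at u)" if "u \<in> ?H" for u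
    by (rule holomorphic_derivI[OF holomorphic_deriv[OF macdonald_holomorphic oH] oH that])
  have sq: "((\<lambda>u::complex. u\<^sup>2) has_field_derivative 2 * u) (at u)" for u
    by (auto intro!: derivative_eq_intros)
  have Dd: "(D has_field_derivative D1 u / u) (at u)" if "u \<in> ?H" for u
  proof -
    have "u \<noteq> 0" "u\<^sup>2 \<notin> \<real>\<^sub>\<le>\<^sub>0" using that square_not_nonpos[of u] by auto
    then have "(D has_field_derivative deriv macdonald u + L' (u\<^sup>2) / u\<^sup>2 * (2 * u)) (at u)"
      unfolding D_def[abs_def] L_def L'_def
      by (intro DERIV_add Kd that DERIV_chain2[OF log_series_deriv sq])
    then show ?thesis using \<open>u \<noteq> 0\<close> by (simp add: D1_def field_simps power2_eq_square)
  qed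
  have D1d: "(D1 has_field_derivative u * D u) (at u)" if "u \<in> ?H" for u
  proof -
    have ns: "u \<noteq> 0" "u\<^sup>2 \<notin> \<real>\<^sub>\<le>\<^sub>0" using that square_not_nonpos[of u] by auto
    have "(D1 has_field_derivative (1 * deriv macdonald u + deriv (deriv macdonald) u * u)
        + 2 * ((- (- 1 / 4) * L (u\<^sup>2)) * (2 * u))) (at u)"
      unfolding D1_def[abs_def] L_def L'_def
      by (intro DERIV_add DERIV_mult DERIV_ident DERIV_cmult Kdd that DERIV_chain2[OF log_series_ode sq] ns)
    moreover have "deriv (deriv macdonald) u = macdonald u - deriv macdonald u / u"
      using macdonald_ode[of u] that by (simp add: numeral_2_eq_2 algebra_simps)
    ultimately show ?thesis using ns by (simp add: D_def field_simps)
  qed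
  have sq4: "((\<lambda>u::complex. - 1 / 4 * u\<^sup>2) has_field_derivative - u / 2) (at u)" for u
    by (auto intro!: derivative_eq_intros)
  have Pd: "(P has_field_derivative P1 u / u) (at u)" if "u \<in> ?H" for u
  proof -
    have "u \<noteq> 0" using that by auto
    moreover have "(P has_field_derivative J0_series' (- 1 / 4 * u\<^sup>2) * (- u / 2)) (at u)"
      unfolding P_def[abs_def] by (rule DERIV_chain2[OF J0_series_deriv sq4])
    moreover have "J0_series' (- 1 / 4 * u\<^sup>2) * (- u / 2) = P1 u / u"
      using \<open>u \<noteq> 0\<close> by (simp add: P1_def power2_eq_square)
    ultimately show ?thesis by simp
  qed
  have P1d: "(P1 has_field_derivative u * P u) (at u)" for u
  proof -
    have "(P1 has_field_derivative 2 * (- J0_series (- 1 / 4 * u\<^sup>2) * (- u / 2))) (at u)"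
      unfolding P1_def[abs_def] by (intro DERIV_cmult DERIV_chain2[OF J0_series_ode sq4])
    then show ?thesis by (simp add: P_def mult.commute)
  qed
  define W where "W u = P u * D1 u - P1 u * D u" for u
  have Wd: "(W has_field_derivative 0) (at u within ?H)" if "u \<in> ?H" for u
  proof -
    have "u \<noteq> 0" using that by auto
    have "(W has_field_derivative (P1 u / u * D1 u + u * D u * P u) - (u * P u * D u + D1 u / u * P1 u)) (at u)"
      unfolding W_def[abs_def] by (intro DERIV_diff DERIV_mult Pd P1d Dd D1d that)
    moreover have "(P1 u / u * D1 u + u * D u * P u) - (u * P u * D u + D1 u / u * P1 u) = 0"
      by (simp add: field_simps)
    ultimately show ?thesis by (simp add: has_field_derivative_at_within)
  qed
  have "convex ?H" by (rule convex_halfspace_Re_gt)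
  from has_field_derivative_zero_constant[OF this Wd] obtain C where C: "\<And>u. u \<in> ?H \<Longrightarrow> W u = C" by blast
  have x2: "((\<lambda>x::real. - 1 / 4 * (complex_of_real x)\<^sup>2) \<longlongrightarrow> 0) (at_right 0)" by (auto intro!: tendsto_eq_intros)
  have Plim: "((\<lambda>x::real. P (of_real x)) \<longlongrightarrow> 1) (at_right 0)"
    unfolding P_def by (rule tendsto_0_imp_series_limits(1)[OF x2])
  have P1lim: "((\<lambda>x::real. P1 (of_real x)) \<longlongrightarrow> 0) (at_right 0)"
    unfolding P1_def by (rule tendsto_mult_right_zero[OF tendsto_0_imp_series_limits(3)[OF x2]])
  have Dlim: "((\<lambda>x::real. D (of_real x)) \<longlongrightarrow> 0) (at_right 0)"
  proof -
    have "filterlim (\<lambda>x::real. x\<^sup>2) (at_right 0) (at_right 0)" by real_asymp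
    from filterlim_compose[OF log_series_at_0(1) this]
    have "((\<lambda>x::real. L (of_real (x\<^sup>2)) - of_real (ln (x\<^sup>2)) / 2) \<longlongrightarrow> - of_real (ln 2) + euler_mascheroni) (at_right 0)"
      unfolding L_def .
    from tendsto_add[OF tendsto_add[OF macdonald_asymptotics this] tendsto_const]
    have "((\<lambda>x::real. macdonald (of_real x) + of_real (ln (x / 2)) + (L (of_real (x\<^sup>2)) - of_real (ln (x\<^sup>2)) / 2) + of_real (ln 2)) \<longlongrightarrow>
        - euler_mascheroni + (- of_real (ln 2) + euler_mascheroni) + of_real (ln 2)) (at_right 0)" .
    then have "((\<lambda>x::real. macdonald (of_real x) + of_real (ln (x / 2)) + (L (of_real (x\<^sup>2)) - of_real (ln (x\<^sup>2)) / 2) + of_real (ln 2)) \<longlongrightarrow> 0) (at_right 0)"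
      by simp
    then show ?thesis
      by (rule Lim_transform_eventually)
        (auto simp: eventually_at_filter D_def ln_div ln_realpow)
  qed
  have pos: "complex_of_real x \<in> ?H" if "x > 0" for x using that by simp
  have Pne: "P (of_real x) \<noteq> 0" for x :: real
  proof -
    have "1 \<le> Re (P (of_real x))"
      using J0_series_neg_real[of "x\<^sup>2 / 4"] unfolding P_def by simp
    then show ?thesis by auto
  qed
  have D1lim: "((\<lambda>x::real. D1 (of_real x)) \<longlongrightarrow> C) (at_right 0)"
  proof -
    have "((\<lambda>x::real. (C + P1 (of_real x) * D (of_real x)) / P (of_real x)) \<longlongrightarrow> (C + 0 * 0) / 1) (at_right 0)"
      by (intro tendsto_intros Plim P1lim Dlim) auto
    then have "((\<lambda>x::real. (C + P1 (of_real x) * D (of_real x)) / P (of_real x)) \<longlongrightarrow> C) (at_right 0)" by simp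
    then show ?thesis
    proof (rule Lim_transform_eventually)
      show "\<forall>\<^sub>F x in at_right 0. (C + P1 (of_real x) * D (of_real x)) / P (of_real x) = D1 (of_real x)"
        using C[OF pos] Pne by (auto simp: eventually_at_filter W_def field_simps)
    qed
  qed
  have Re_div: "Re (a / of_real x) = Re a / x" "Im (a / of_real x) = Im a / x" for a x by auto
  have "Re C = 0"
    by (rule no_log_growth[of "\<lambda>x. Re (D (of_real x))" "\<lambda>x. Re (D1 (of_real x))"])
      (use has_field_derivative_along_reals(1)[OF Dd[OF pos]] tendsto_Re[OF Dlim] tendsto_Re[OF D1lim] in \<open>auto simp: Re_div\<close>)
  moreover have "Im C = 0"
    by (rule no_log_growth[of "\<lambda>x. Im (D (of_real x))" "\<lambda>x. Im (D1 (of_real x))"])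
      (use has_field_derivative_along_reals(2)[OF Dd[OF pos]] tendsto_Im[OF Dlim] tendsto_Im[OF D1lim] in \<open>auto simp: Re_div\<close>)
  ultimately have C0: "C = 0" by (simp add: complex_eq_iff)
  have "((\<lambda>x. D (of_real x) / P (of_real x)) has_vector_derivative 0) (at x within {0<..})" if "x \<in> {0<..}" for x :: real
  proof -
    have x: "of_real x \<in> ?H" using that by auto
    have "((\<lambda>u. D u / P u) has_field_derivative (D1 (of_real x) / of_real x * P (of_real x) - D (of_real x) * (P1 (of_real x) / of_real x)) / (P (of_real x) * P (of_real x))) (at (of_real x))"
      by (intro DERIV_divide Dd Pd x Pne)
    moreover have "(D1 (of_real x) / of_real x * P (of_real x) - D (of_real x) * (P1 (of_real x) / of_real x)) = 0"
      using C[OF x] C0 that by (simp add: W_def field_simps)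
    ultimately have "((\<lambda>u. D u / P u) has_field_derivative 0) (at (of_real x))"
      by (simp only: div_0)
    from has_field_derivative_along_reals(3)[OF this] show ?thesis by (rule has_vector_derivative_at_within)
  qed
  from has_vector_derivative_zero_constant[OF convex_real_interval(3) this]
  obtain k where k: "\<And>x. x \<in> {0<..} \<Longrightarrow> D (of_real x) / P (of_real x) = k" by blast
  have "((\<lambda>x::real. D (of_real x) / P (of_real x)) \<longlongrightarrow> 0 / 1) (at_right 0)"
    by (intro tendsto_intros Dlim Plim) auto
  then have "((\<lambda>x::real. k) \<longlongrightarrow> 0 / 1) (at_right 0)"
    by (rule Lim_transform_eventually) (use k in \<open>auto simp: eventually_at_filter\<close>)
  then have "k = 0" by (simp add: tendsto_const_iff)
  then have D0: "D (of_real x) = 0" if "x > 0" for x :: real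
    using k[of x] that Pne[of x] by simp
  have "D u = 0"
  proof (rule analytic_continuation[of D ?H "complex_of_real ` {0<..}" 1])
    show "D holomorphic_on ?H"
      using Dd by (auto simp: holomorphic_on_open[OF oH])
    show "connected ?H" by (rule convex_connected) fact
    have "(1::complex) islimpt (complex_of_real ` {0<..})"
      unfolding islimpt_sequential
    proof (intro exI[of _ "\<lambda>n. of_real (1 + inverse (real (Suc n)))"] conjI allI)
      fix n
      have "1 + inverse (real (Suc n)) > 0" "inverse (real (Suc n)) \<noteq> 0" by (auto intro: add_pos_pos)
      then show "complex_of_real (1 + inverse (real (Suc n))) \<in> complex_of_real ` {0<..} - {1}"
        by (auto simp del: of_nat_Suc of_real_add of_real_inverse intro: imageI)
    next
      have "(\<lambda>n. complex_of_real (1 + inverse (real (Suc n)))) \<longlonglongrightarrow> of_real (1 + 0)"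
        by (intro tendsto_of_real tendsto_add tendsto_const LIMSEQ_inverse_real_of_nat)
      then show "(\<lambda>n. complex_of_real (1 + inverse (real (Suc n)))) \<longlonglongrightarrow> 1" by simp
    qed
    then show "1 islimpt (complex_of_real ` {0<..})" .
  qed (use oH u D0 in auto)
  then show ?thesis by (simp add: D_def L_def eq_neg_iff_add_eq_0)
qed

section \<open>The radial profile of the free Green function\<close>

text \<open>
  The function \<open>i/4 H\<^sub>0(w r)\<close> of the squared radius \<open>s = r\<^sup>2\<close>; see \<open>green_profile_eq_hankel\<close>.
\<close>

definition green_profile :: "complex \<Rightarrow> complex \<Rightarrow> complex" where
  "green_profile w s = - (log_series (Ln (- \<i> * w / 2)) (w\<^sup>2 / 4) s / (2 * of_real pi))"

definition green_profile' :: "complex \<Rightarrow> complex \<Rightarrow> complex" where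
  "green_profile' w s = - (log_series' (Ln (- \<i> * w / 2)) (w\<^sup>2 / 4) s / (2 * of_real pi))"

lemma green_profile_deriv:
  assumes "s \<notin> \<real>\<^sub>\<le>\<^sub>0"
  shows "(green_profile w has_field_derivative green_profile' w s / s) (at s)"
  using DERIV_cdivide[OF DERIV_minus[OF log_series_deriv[OF assms, of "Ln (- \<i> * w / 2)" "w\<^sup>2 / 4"]], of "2 * of_real pi"]
  by (simp add: green_profile_def[abs_def] green_profile'_def mult.commute)

lemma green_profile_ode:
  assumes "s \<notin> \<real>\<^sub>\<le>\<^sub>0"
  shows "(green_profile' w has_field_derivative - (w\<^sup>2 / 4) * green_profile w s) (at s)"
  using DERIV_cdivide[OF DERIV_minus[OF log_series_ode[OF assms, of "Ln (- \<i> * w / 2)" "w\<^sup>2 / 4"]], of "2 * of_real pi"]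
  by (simp add: green_profile'_def[abs_def] green_profile_def)

lemma green_profile_at_0:
  "((\<lambda>s::real. green_profile w (of_real s) + of_real (ln s / (4 * pi))) \<longlongrightarrow>
      (- euler_mascheroni - Ln (- \<i> * w / 2)) / (2 * of_real pi)) (at_right 0)"
  "((\<lambda>s::real. green_profile' w (of_real s)) \<longlongrightarrow> - 1 / (4 * of_real pi)) (at_right 0)"
proof -
  let ?\<kappa> = "Ln (- \<i> * w / 2)"
  have "((\<lambda>s::real. - ((log_series ?\<kappa> (w\<^sup>2 / 4) (of_real s) - of_real (ln s) / 2) / (2 * of_real pi))) \<longlongrightarrow>
      - ((?\<kappa> + euler_mascheroni) / (2 * of_real pi))) (at_right 0)"
    by (intro tendsto_intros log_series_at_0) auto
  then show "((\<lambda>s::real. green_profile w (of_real s) + of_real (ln s / (4 * pi))) \<longlongrightarrow>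
      (- euler_mascheroni - ?\<kappa>) / (2 * of_real pi)) (at_right 0)"
    by (simp add: green_profile_def diff_divide_distrib add_divide_distrib algebra_simps)
  have "((\<lambda>s::real. - (log_series' ?\<kappa> (w\<^sup>2 / 4) (of_real s) / (2 * of_real pi))) \<longlongrightarrow> - (1 / 2 / (2 * of_real pi))) (at_right 0)"
    by (intro tendsto_intros log_series_at_0) auto
  then show "((\<lambda>s::real. green_profile' w (of_real s)) \<longlongrightarrow> - 1 / (4 * of_real pi)) (at_right 0)"
    by (simp add: green_profile'_def)
qed

lemma Ln_mult_real: "r > 0 \<Longrightarrow> v \<noteq> 0 \<Longrightarrow> Ln (v * of_real r) = Ln v + of_real (ln r)"
  using Ln_times_of_real[of r v] Ln_of_real[of r] by (simp add: mult.commute add.commute)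

text \<open>
  Rotation by \<open>i\<close> adds \<open>i\<pi>/2\<close> to the logarithm. Inside \<open>H\<^sub>0 = J\<^sub>0 + i Y\<^sub>0\<close> this extra term cancels the summand
  \<open>J\<^sub>0\<close> and leaves a multiple of the logarithmic series alone.
\<close>

lemma green_profile_eq_hankel:
  assumes w: "Im w > 0" "Re w > 0" and r: "r > 0"
  shows "\<i> / 4 * hankel1 0 (w * of_real r) = green_profile w (of_real (r\<^sup>2))"
proof -
  let ?\<kappa> = "Ln (- \<i> * w / 2)"
  let ?A = "J0_series (w\<^sup>2 / 4 * of_real (r\<^sup>2))" and ?B = "Y0_series (w\<^sup>2 / 4 * of_real (r\<^sup>2))"
  have w0: "w \<noteq> 0" using w by auto
  have 1: "Ln (w * of_real r / 2) = Ln (w / 2) + of_real (ln r)"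
    using Ln_mult_real[OF r, of "w / 2"] w0 by simp
  have "Ln (\<i> * (- \<i> * w / 2)) = ?\<kappa> + \<i> * of_real pi / 2"
    by (subst Ln_times_ii) (use w w0 in auto)
  then have 2: "Ln (w / 2) = ?\<kappa> + \<i> * of_real pi / 2" by simp
  have 3: "Ln (of_real (r\<^sup>2)) / 2 = of_real (ln r)"
    using r by (subst Ln_of_real) (auto simp: ln_realpow)
  have 4: "(w * of_real r)\<^sup>2 / 4 = w\<^sup>2 / 4 * of_real (r\<^sup>2)" by (simp add: power_mult_distrib)
  have h: "hankel1 0 (w * of_real r) = ?A + 2 * \<i> / of_real pi * ((?\<kappa> + \<i> * of_real pi / 2 + of_real (ln r)) * ?A + ?B)"
    using r w0 unfolding 4[symmetric] by (subst hankel1_0_eq) (simp_all only: 1 2, simp_all)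
  have pi0: "(of_real pi :: complex) \<noteq> 0" by simp
  have alg: "\<i> / 4 * (a + 2 * \<i> / p * ((k + \<i> * p / 2 + l) * a + b)) = - (((l + k) * a + b) / (2 * p))"
    if "p \<noteq> 0" for a b k l p :: complex
  proof -
    have q: "p * inverse p = 1" using that by simp
    have "\<i> / 4 * (a + 2 * \<i> * q * ((k + \<i> * p / 2 + l) * a + b)) = - (((l + k) * a + b) * q / 2)" if "p * q = 1" for q
    proof -
      have "\<i> / 4 * (a + 2 * \<i> * q * ((k + \<i> * p / 2 + l) * a + b))
          = \<i> / 4 * a + (\<i> * \<i>) * ((k + l) * a + b) * q / 2 + (\<i> * \<i>) * (\<i> / 4) * a * (p * q)"
        by (simp only: distrib_left distrib_right mult_ac add_ac times_divide_eq_right times_divide_eq_left) simp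
      then show ?thesis using that by (simp add: algebra_simps)
    qed
    moreover have "x / (2 * p) = x * inverse p / 2" for x
      by (simp only: divide_inverse inverse_mult_distrib mult_ac)
    ultimately show ?thesis using q by (simp only: divide_inverse[of "2 * \<i>" p])
  qed
  show ?thesis unfolding h alg[OF pi0] green_profile_def log_series_def 3 ..
qed

text \<open>
  With \<open>u = - i w r\<close> one has \<open>- u\<^sup>2/4 = w\<^sup>2 r\<^sup>2/4\<close>. The two sides agree up to branches of the logarithm, and
  these match because \<open>u\<close> lies in the right half-plane.
\<close>

lemma green_profile_eq_macdonald:
  assumes w: "Im w > 0" and r: "r > 0"
  shows "green_profile w (of_real (r\<^sup>2)) = macdonald (- \<i> * w * of_real r) / (2 * of_real pi)"
proof -
  let ?u = "- \<i> * w * of_real r"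
  have Re: "Re ?u > 0" using w r by simp
  have u0: "?u \<noteq> 0" using Re by auto
  have sq: "- 1 / 4 * ?u\<^sup>2 = w\<^sup>2 / 4 * of_real (r\<^sup>2)" by (simp add: power_mult_distrib)
  have arg: "- pi < Im (Ln ?u + Ln ?u)" "Im (Ln ?u + Ln ?u) \<le> pi"
    using Re_Ln_pos_lt_imp[OF Re] by (auto simp: abs_less_iff)
  have "Ln (?u\<^sup>2) = Ln ?u + Ln ?u"
    unfolding power2_eq_square by (rule Ln_times_simple[OF u0 u0]) (use arg in auto)
  then have L2: "Ln (?u\<^sup>2) / 2 = Ln ?u" by simp
  have "Ln ?u = Ln (- \<i> * w / 2 * of_real (2 * r))" by (simp add: mult.assoc)
  also have "\<dots> = Ln (- \<i> * w / 2) + of_real (ln (2 * r))"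
    by (rule Ln_mult_real) (use r w in auto)
  finally have Lu: "Ln ?u + - of_real (ln 2) = Ln (- \<i> * w / 2) + of_real (ln r)"
    using r by (simp add: ln_mult)
  have Lr: "Ln (of_real (r\<^sup>2)) / 2 = of_real (ln r)"
    using r by (subst Ln_of_real) (auto simp: ln_realpow)
  show ?thesis
    unfolding macdonald_eq_log_series[OF Re] green_profile_def log_series_def L2 Lu sq Lr
      add.commute[of "of_real (ln r)"] minus_divide_left ..
qed

text \<open>
  Here \<open>Re (- i w r) = r Im w\<close>, so the decay of Macdonald's integral applies. The bound on the
  derivative carries a factor \<open>r\<close> because \<open>green_profile'\<close> is \<open>s d/ds = (r/2) d/dr\<close>.
\<close>

lemma green_profile_decay:
  assumes w: "Im w > 0"
  obtains C R where "C > 0" "R > 0"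
    "\<And>r. r \<ge> R \<Longrightarrow> norm (green_profile w (of_real (r\<^sup>2))) \<le> C * exp (- Im w * r)"
    "\<And>r. r \<ge> R \<Longrightarrow> norm (green_profile' w (of_real (r\<^sup>2))) \<le> C * r * exp (- Im w * r)"
proof -
  from macdonald_decay obtain C where C: "C > 0"
    "\<And>u. Re u \<ge> 2 \<Longrightarrow> norm (macdonald u) \<le> C * exp (- Re u)"
    "\<And>u. Re u \<ge> 2 \<Longrightarrow> norm (deriv macdonald u) \<le> C * exp (- Re u)" by metis
  let ?C = "C * (1 + norm w)" and ?R = "2 / Im w"
  have pi2: "1 \<le> 2 * pi" using pi_gt3 by simp
  show ?thesis
  proof (rule that[of ?C ?R])
    show "?C > 0" using C(1) by (intro mult_pos_pos add_pos_nonneg) auto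
    show R0: "?R > 0" using w by simp
    fix r assume r: "r \<ge> ?R"
    then have r0: "r > 0" using R0 by linarith
    let ?u = "- \<i> * w * of_real r"
    have Reu: "Re ?u = Im w * r" by simp
    have u2: "Re ?u \<ge> 2" using r w unfolding Reu by (simp add: field_simps)
    have "norm (green_profile w (of_real (r\<^sup>2))) = norm (macdonald ?u) / (2 * pi)"
      unfolding green_profile_eq_macdonald[OF w r0] by (simp add: norm_divide)
    also have "\<dots> \<le> norm (macdonald ?u) / 1" using pi2 by (intro divide_left_mono) auto
    also have "\<dots> \<le> C * exp (- Im w * r)" using C(2)[OF u2] Reu by simp
    also have "\<dots> \<le> ?C * exp (- Im w * r)" using C(1) by (intro mult_right_mono) (auto simp: algebra_simps)
    finally show "norm (green_profile w (of_real (r\<^sup>2))) \<le> ?C * exp (- Im w * r)" .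
    have s: "complex_of_real (r\<^sup>2) \<notin> \<real>\<^sub>\<le>\<^sub>0" using r0 by (auto simp: complex_nonpos_Reals_iff)
    have d1: "((\<lambda>x::real. green_profile w (of_real (x\<^sup>2))) has_vector_derivative (2 * r) *\<^sub>R (green_profile' w (of_real (r\<^sup>2)) / of_real (r\<^sup>2))) (at r)"
    proof -
      have "((\<lambda>x. x\<^sup>2) has_vector_derivative 2 * r) (at r)"
        by (auto intro!: derivative_eq_intros simp flip: has_real_derivative_iff_has_vector_derivative)
      from vector_diff_chain_at[OF this has_field_derivative_along_reals(3)[OF green_profile_deriv[OF s]]]
      show ?thesis by (simp add: o_def)
    qed
    have K: "(macdonald has_field_derivative deriv macdonald ?u) (at ?u)"
      by (rule holomorphic_derivI[OF macdonald_holomorphic open_halfplane_Re]) (use u2 in simp)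
    have "((\<lambda>v. macdonald (- \<i> * w * v) / (2 * of_real pi)) has_field_derivative
        deriv macdonald ?u * (- \<i> * w) / (2 * of_real pi)) (at (of_real r))"
      by (intro DERIV_cdivide DERIV_chain2[where f = macdonald and g = "\<lambda>v. - \<i> * w * v", OF K]) (auto intro!: derivative_eq_intros)
    from has_field_derivative_along_reals(3)[OF this]
    have d2: "((\<lambda>x::real. macdonald (- \<i> * w * of_real x) / (2 * of_real pi)) has_vector_derivative
        deriv macdonald ?u * (- \<i> * w) / (2 * of_real pi)) (at r)" .
    have "((\<lambda>x::real. green_profile w (of_real (x\<^sup>2))) has_vector_derivative
        deriv macdonald ?u * (- \<i> * w) / (2 * of_real pi)) (at r)"
      by (rule has_vector_derivative_transform_within_open[OF d2 open_greaterThan[of 0]])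
        (use r0 green_profile_eq_macdonald[OF w] in auto)
    from vector_derivative_unique_at[OF d1 this]
    have "deriv macdonald ?u * (- \<i> * w) / (2 * of_real pi) * of_real (r / 2) = green_profile' w (of_real (r\<^sup>2))"
      using r0 by (simp add: scaleR_conv_of_real power2_eq_square field_simps)
    then have "norm (green_profile' w (of_real (r\<^sup>2)))
        = norm (deriv macdonald ?u * (- \<i> * w) / (2 * of_real pi) * of_real (r / 2))" by simp
    also have "\<dots> = norm (deriv macdonald ?u) * norm w * (r / 2) / (2 * pi)"
      using r0 by (simp add: norm_mult norm_divide)
    also have "\<dots> \<le> norm (deriv macdonald ?u) * norm w * (r / 2) / 1" using pi2 r0 by (intro divide_left_mono) auto
    also have "\<dots> \<le> (C * exp (- Im w * r)) * norm w * r"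
      using C(3)[OF u2] r0 C(1) unfolding Reu div_by_1 by (intro mult_mono) auto
    also have "\<dots> \<le> ?C * r * exp (- Im w * r)"
      using C(1) r0 by (simp add: algebra_simps)
    finally show "norm (green_profile' w (of_real (r\<^sup>2))) \<le> ?C * r * exp (- Im w * r)" .
  qed
qed

lemma green_profile_holomorphic: "green_profile w holomorphic_on (- \<real>\<^sub>\<le>\<^sub>0)"
  using green_profile_deriv by (auto simp: holomorphic_on_open[OF open_Compl[OF closed_nonpos_Reals_complex]])

lemma upper_sqrt_pos:
  assumes "Im z > 0"
  shows "Im (upper_sqrt z) > 0" "Re (upper_sqrt z) > 0" "(upper_sqrt z)\<^sup>2 = z"
proof -
  have sq: "(csqrt z)\<^sup>2 = z" by simp
  then have im: "2 * (Re (csqrt z) * Im (csqrt z)) = Im z" by (metis Im_power2 mult.assoc)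
  have re: "Re (csqrt z) \<ge> 0" using csqrt_principal[of z] by auto
  have "Im (csqrt z) > 0" using im re assms by (metis less_eq_real_def linorder_not_less mult_nonneg_nonpos zero_less_mult_pos mult_pos_pos zero_less_numeral)
  then show "Im (upper_sqrt z) > 0" "(upper_sqrt z)\<^sup>2 = z" by (auto simp: upper_sqrt_def)
  have "Re (csqrt z) \<noteq> 0" using im assms by auto
  then show "Re (upper_sqrt z) > 0" using re \<open>Im (csqrt z) > 0\<close> by (auto simp: upper_sqrt_def)
qed

section \<open>Smooth functions on open subsets of the plane\<close>

definition vpartial :: "2 \<Rightarrow> (real^2 \<Rightarrow> 'b::real_normed_vector) \<Rightarrow> real^2 \<Rightarrow> 'b" where
  "vpartial i f x = frechet_derivative f (at x) (axis i 1)"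

text \<open>
  Differentiability and continuity are those of functions on the plane at the points of \<open>U\<close>, so
  the notion is meant for open \<open>U\<close>.
\<close>

primrec Ck_on :: "nat \<Rightarrow> (real^2) set \<Rightarrow> (real^2 \<Rightarrow> 'b::real_normed_vector) \<Rightarrow> bool" where
  "Ck_on 0 U f \<longleftrightarrow> (\<forall>x\<in>U. isCont f x)"
| "Ck_on (Suc k) U f \<longleftrightarrow> (\<forall>x\<in>U. f differentiable (at x)) \<and> (\<forall>i. Ck_on k U (vpartial i f))"

definition smooth_on :: "(real^2) set \<Rightarrow> (real^2 \<Rightarrow> 'b::real_normed_vector) \<Rightarrow> bool" where
  "smooth_on U f \<longleftrightarrow> (\<forall>k. Ck_on k U f)"

lemma partial_eq_vpartial: "partial i = vpartial i"
  by (intro ext) (simp add: partial_def vpartial_def)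

lemma cont_diff_eq_Ck_on: "cont_diff k f \<longleftrightarrow> Ck_on k UNIV f"
  by (induction k arbitrary: f) (auto simp: continuous_on_eq_continuous_at partial_eq_vpartial)

lemma vpartial_eqI: "(f has_derivative f') (at x) \<Longrightarrow> vpartial i f x = f' (axis i 1)"
  unfolding vpartial_def using frechet_derivative_at by metis

lemma has_derivative_frechet: "f differentiable (at x) \<Longrightarrow> (f has_derivative frechet_derivative f (at x)) (at x)"
  using frechet_derivative_works by blast

text \<open>
  Partial derivatives are local; with this lemma formulas that hold on an open set only can be
  differentiated further.
\<close>

lemma vpartial_cong_open:
  assumes "open U" "x \<in> U" "\<And>y. y \<in> U \<Longrightarrow> f y = g y" "f differentiable (at x)"
  shows "vpartial i f x = vpartial i g x"
  using has_derivative_transform_within_open[OF has_derivative_frechet[OF assms(4)] assms(1-3)]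
  by (simp add: vpartial_eqI) (simp add: vpartial_def)

lemma Ck_on_cong:
  assumes "open U" "\<And>x. x \<in> U \<Longrightarrow> f x = g x" "Ck_on k U f"
  shows "Ck_on k U g"
  using assms(2,3)
proof (induction k arbitrary: f g)
  case 0
  have "isCont g x" if "x \<in> U" for x
  proof -
    have "eventually (\<lambda>y. f y = g y) (nhds x)"
      using eventually_nhds_in_open[OF \<open>open U\<close> that] by eventually_elim (rule 0)
    from isCont_cong[OF this] show ?thesis using 0 that by simp
  qed
  then show ?case by simp
next
  case (Suc k)
  have d: "g differentiable (at x)" if "x \<in> U" for x
  proof -
    have "f differentiable (at x)" using Suc.prems(2) that by simp
    from has_derivative_transform_within_open[OF has_derivative_frechet[OF this] assms(1) that Suc.prems(1)]
    show ?thesis unfolding differentiable_def by blast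
  qed
  moreover have "Ck_on k U (vpartial i g)" for i
  proof (rule Suc.IH)
    show "Ck_on k U (vpartial i f)" using Suc.prems by simp
    show "vpartial i f x = vpartial i g x" if "x \<in> U" for x
      by (rule vpartial_cong_open[OF assms(1) that Suc.prems(1)]) (use Suc.prems that in auto)
  qed
  ultimately show ?case by simp
qed

lemma Ck_on_subset: "Ck_on k U f \<Longrightarrow> V \<subseteq> U \<Longrightarrow> Ck_on k V f"
  by (induction k arbitrary: f) auto

lemma Ck_on_Un: "Ck_on k U f \<Longrightarrow> Ck_on k V f \<Longrightarrow> Ck_on k (U \<union> V) f"
  by (induction k arbitrary: f) auto

lemma Ck_on_Suc_imp: "Ck_on (Suc k) U f \<Longrightarrow> Ck_on k U f"
proof (induction k arbitrary: f)
  case 0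
  then show ?case by (auto intro: differentiable_imp_continuous_within)
next
  case (Suc k)
  have "Ck_on (Suc k) U (vpartial i f)" for i using Suc.prems by simp
  then have "Ck_on k U (vpartial i f)" for i using Suc.IH by blast
  then show ?case using Suc.prems by simp
qed

lemma Ck_on_const: "Ck_on k U (\<lambda>x. c)"
proof (induction k arbitrary: c)
  case (Suc k)
  have "vpartial i (\<lambda>x. c) = (\<lambda>x. 0)" for i
    by (intro ext vpartial_eqI[THEN trans]) (auto intro!: derivative_eq_intros)
  then show ?case using Suc by simp
qed simp

lemma Ck_on_add:
  assumes "open U" "Ck_on k U f" "Ck_on k U g"
  shows "Ck_on k U (\<lambda>x. f x + g x)"
  using assms(2,3)
proof (induction k arbitrary: f g)
  case (Suc k)
  have "Ck_on k U (vpartial i (\<lambda>x. f x + g x))" for i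
  proof (rule Ck_on_cong[OF assms(1)])
    show "Ck_on k U (\<lambda>x. vpartial i f x + vpartial i g x)" by (intro Suc.IH) (use Suc.prems in auto)
    fix x assume "x \<in> U"
    then have "((\<lambda>x. f x + g x) has_derivative (\<lambda>h. frechet_derivative f (at x) h + frechet_derivative g (at x) h)) (at x)"
      using Suc.prems by (intro has_derivative_add has_derivative_frechet) auto
    then show "vpartial i f x + vpartial i g x = vpartial i (\<lambda>x. f x + g x) x"
      by (simp add: vpartial_eqI) (simp add: vpartial_def)
  qed
  then show ?case using Suc.prems by auto
qed auto

lemma vpartial_bilinear:
  assumes "bounded_bilinear pr" "f differentiable (at x)" "g differentiable (at x)"
  shows "vpartial i (\<lambda>x. pr (f x) (g x)) x = pr (f x) (vpartial i g x) + pr (vpartial i f x) (g x)"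
proof -
  have "((\<lambda>x. pr (f x) (g x)) has_derivative
      (\<lambda>h. pr (f x) (frechet_derivative g (at x) h) + pr (frechet_derivative f (at x) h) (g x))) (at x)"
    by (intro bounded_bilinear.FDERIV[OF assms(1)] has_derivative_frechet assms)
  then show ?thesis by (simp add: vpartial_eqI) (simp add: vpartial_def)
qed

lemma Ck_on_bilinear:
  assumes "open U" "bounded_bilinear pr" "Ck_on k U f" "Ck_on k U g"
  shows "Ck_on k U (\<lambda>x. pr (f x) (g x))"
  using assms(3,4)
proof (induction k arbitrary: f g)
  case 0
  then show ?case by (auto intro!: bounded_bilinear.isCont[OF assms(2)])
next
  case (Suc k)
  have "Ck_on k U (vpartial i (\<lambda>x. pr (f x) (g x)))" for i
  proof (rule Ck_on_cong[OF assms(1)])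
    show "Ck_on k U (\<lambda>x. pr (f x) (vpartial i g x) + pr (vpartial i f x) (g x))"
      by (intro Ck_on_add assms Suc.IH) (use Suc.prems Ck_on_Suc_imp in auto)
  qed (use Suc.prems in \<open>auto simp: vpartial_bilinear[OF assms(2)]\<close>)
  moreover have "(\<lambda>x. pr (f x) (g x)) differentiable (at x)" if "x \<in> U" for x
  proof -
    have "f differentiable (at x)" "g differentiable (at x)" using Suc.prems that by auto
    from bounded_bilinear.FDERIV[OF assms(2) this[THEN has_derivative_frechet]]
    show ?thesis unfolding differentiable_def by blast
  qed
  ultimately show ?case by simp
qed

lemma vpartial_linear:
  assumes "bounded_linear L" "f differentiable (at x)"
  shows "vpartial i (\<lambda>x. L (f x)) x = L (vpartial i f x)"
  using bounded_linear.has_derivative[OF assms(1) has_derivative_frechet[OF assms(2)]]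
  by (simp add: vpartial_eqI) (simp add: vpartial_def)

lemma Ck_on_linear:
  assumes "open U" "bounded_linear L" "Ck_on k U f"
  shows "Ck_on k U (\<lambda>x. L (f x))"
  using assms(3)
proof (induction k arbitrary: f)
  case 0
  then show ?case by (auto intro!: bounded_linear.isCont[OF assms(2)])
next
  case (Suc k)
  have "Ck_on k U (vpartial i (\<lambda>x. L (f x)))" for i
    by (rule Ck_on_cong[OF assms(1), of "\<lambda>x. L (vpartial i f x)"])
      (use Suc in \<open>auto simp: vpartial_linear[OF assms(2)]\<close>)
  moreover have "(\<lambda>x. L (f x)) differentiable (at x)" if "x \<in> U" for x
  proof -
    have "f differentiable (at x)" using Suc.prems that by auto
    from bounded_linear.has_derivative[OF assms(2) this[THEN has_derivative_frechet]]
    show ?thesis unfolding differentiable_def by blast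
  qed
  ultimately show ?case by simp
qed

lemma smooth_on_const: "smooth_on U (\<lambda>x. c)"
  by (simp add: smooth_on_def Ck_on_const)

lemma smooth_on_add: "open U \<Longrightarrow> smooth_on U f \<Longrightarrow> smooth_on U g \<Longrightarrow> smooth_on U (\<lambda>x. f x + g x)"
  by (simp add: smooth_on_def Ck_on_add)

lemma smooth_on_bilinear:
  "open U \<Longrightarrow> bounded_bilinear pr \<Longrightarrow> smooth_on U f \<Longrightarrow> smooth_on U g \<Longrightarrow> smooth_on U (\<lambda>x. pr (f x) (g x))"
  by (simp add: smooth_on_def Ck_on_bilinear)

lemma smooth_on_linear: "open U \<Longrightarrow> bounded_linear L \<Longrightarrow> smooth_on U f \<Longrightarrow> smooth_on U (\<lambda>x. L (f x))"
  by (simp add: smooth_on_def Ck_on_linear)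

lemma smooth_on_diff:
  assumes "open U" "smooth_on U f" "smooth_on U g"
  shows "smooth_on U (\<lambda>x. f x - g x)"
  using smooth_on_add[OF assms(1,2) smooth_on_linear[OF assms(1) bounded_linear_minus[OF bounded_linear_ident] assms(3)]] by simp

lemma smooth_on_sum:
  assumes "open U" "\<And>j. j \<in> A \<Longrightarrow> smooth_on U (f j)"
  shows "smooth_on U (\<lambda>x. \<Sum>j\<in>A. f j x)"
  using assms(2) by (induction A rule: infinite_finite_induct) (auto intro!: smooth_on_const smooth_on_add assms(1))

lemma smooth_on_cong: "open U \<Longrightarrow> (\<And>x. x \<in> U \<Longrightarrow> f x = g x) \<Longrightarrow> smooth_on U f \<Longrightarrow> smooth_on U g"
  unfolding smooth_on_def using Ck_on_cong by blast

lemma smooth_on_subset: "smooth_on U f \<Longrightarrow> V \<subseteq> U \<Longrightarrow> smooth_on V f"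
  unfolding smooth_on_def using Ck_on_subset by blast

lemma smooth_on_Un: "smooth_on U f \<Longrightarrow> smooth_on V f \<Longrightarrow> smooth_on (U \<union> V) f"
  unfolding smooth_on_def using Ck_on_Un by blast

lemma smooth_on_vpartial: "smooth_on U f \<Longrightarrow> smooth_on U (vpartial i f)"
  using smooth_on_def by (metis Ck_on.simps(2))

lemma smooth_on_differentiable: "smooth_on U f \<Longrightarrow> x \<in> U \<Longrightarrow> f differentiable (at x)"
  using Ck_on.simps(2)[of 0 U f] unfolding smooth_on_def by blast

lemma smooth_on_isCont: "smooth_on U f \<Longrightarrow> x \<in> U \<Longrightarrow> isCont f x"
  using Ck_on.simps(1)[of U f] unfolding smooth_on_def by blast

text \<open>
  Radial functions are expressed through the squared distance, which is smooth also at the centre.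
\<close>

definition sq_dist :: "real^2 \<Rightarrow> real^2 \<Rightarrow> real" where
  "sq_dist a x = (norm (x - a))\<^sup>2"

lemma smooth_on_translation: "smooth_on U (\<lambda>x. x - a)"
proof -
  have d: "((\<lambda>x. x - a) has_derivative (\<lambda>h. h)) (at x)" for x :: "real^2" by (auto intro!: derivative_eq_intros)
  then have "vpartial i (\<lambda>x. x - a) = (\<lambda>x. axis i 1)" for i
    by (intro ext) (rule vpartial_eqI)
  then have "Ck_on k U (\<lambda>x. x - a)" for k
    using d by (cases k) (auto simp: Ck_on_const differentiable_def)
  then show ?thesis by (simp add: smooth_on_def)
qed

lemma smooth_on_sq_dist: "open U \<Longrightarrow> smooth_on U (sq_dist a)"
  unfolding sq_dist_def[abs_def] dot_square_norm[symmetric]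
  by (intro smooth_on_bilinear[OF _ bounded_bilinear_inner] smooth_on_translation)

lemma vpartial_sq_dist: "vpartial i (sq_dist a) x = 2 * (x - a) $ i"
proof -
  have "(sq_dist a has_derivative (\<lambda>h. 2 * ((x - a) \<bullet> h))) (at x)"
    unfolding sq_dist_def[abs_def] dot_square_norm[symmetric]
    by (auto intro!: derivative_eq_intros simp: inner_commute)
  from vpartial_eqI[OF this, of i] show ?thesis by (simp add: inner_axis)
qed

lemma sum_sq_dist: "(\<Sum>i\<in>UNIV. ((x - a) $ i)\<^sup>2) = sq_dist a x"
  unfolding sq_dist_def norm_vec_def L2_set_def by (simp add: real_sqrt_pow2 sum_nonneg)

lemma has_derivative_compose_real:
  assumes "(h has_vector_derivative h') (at (q x))" "q differentiable (at x)"
  shows "((\<lambda>x. h (q x)) has_derivative (\<lambda>v. frechet_derivative q (at x) v *\<^sub>R h')) (at x)"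
  using has_derivative_compose[OF has_derivative_frechet[OF assms(2)] assms(1)[unfolded has_vector_derivative_def]] .

lemma vpartial_compose_real:
  assumes "(h has_vector_derivative h') (at (q x))" "q differentiable (at x)"
  shows "vpartial i (\<lambda>x. h (q x)) x = vpartial i q x *\<^sub>R h'"
  using has_derivative_compose_real[OF assms] by (simp add: vpartial_eqI) (simp add: vpartial_def)

lemma Ck_on_compose_Suc:
  assumes U: "open U" and q: "smooth_on U q"
    and h: "\<And>x. x \<in> U \<Longrightarrow> (h has_vector_derivative h' (q x)) (at (q x))"
    and h': "Ck_on k U (\<lambda>x. h' (q x))"
  shows "Ck_on (Suc k) U (\<lambda>x. h (q x))"
proof -
  have "Ck_on k U (vpartial i (\<lambda>x. h (q x)))" for i
  proof (rule Ck_on_cong[OF U])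
    show "Ck_on k U (\<lambda>x. vpartial i q x *\<^sub>R h' (q x))"
      by (intro Ck_on_bilinear[OF U bounded_bilinear_scaleR] h')
        (use smooth_on_vpartial[OF q] in \<open>simp add: smooth_on_def\<close>)
  qed (use vpartial_compose_real[OF h smooth_on_differentiable[OF q]] in auto)
  moreover have "(\<lambda>x. h (q x)) differentiable (at x)" if "x \<in> U" for x
    using has_derivative_compose_real[OF h smooth_on_differentiable[OF q]] that
    unfolding differentiable_def by blast
  ultimately show ?thesis by simp
qed

text \<open>
  The sequence \<open>D\<close> lists the successive derivatives of the outer function.
\<close>

lemma smooth_on_compose_real:
  assumes U: "open U" and q: "smooth_on U q"
    and D: "\<And>n x. x \<in> U \<Longrightarrow> (D n has_vector_derivative D (Suc n) (q x)) (at (q x))"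
  shows "smooth_on U (\<lambda>x. D n (q x))"
proof -
  have "Ck_on k U (\<lambda>x. D n (q x))" for k
  proof (induction k arbitrary: n)
    case 0
    have "isCont (\<lambda>x. D n (q x)) x" if "x \<in> U" for x
      by (rule isCont_o2[OF smooth_on_isCont[OF q that]])
        (use has_vector_derivative_continuous[OF D[OF that]] in simp)
    then show ?case by simp
  next
    case (Suc k)
    then show ?case by (intro Ck_on_compose_Suc[OF U q D])
  qed
  then show ?thesis by (simp add: smooth_on_def)
qed

lemma smooth_on_holomorphic_sq_dist:
  assumes "F holomorphic_on (- \<real>\<^sub>\<le>\<^sub>0)"
  shows "smooth_on (- {a}) (\<lambda>x. F (of_real (sq_dist a x)))"
proof -
  have op: "open (- \<real>\<^sub>\<le>\<^sub>0 :: complex set)" by (simp add: open_Compl)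
  have "smooth_on (- {a}) (\<lambda>x. (\<lambda>n s. (deriv ^^ n) F (of_real s)) 0 (sq_dist a x))"
  proof (rule smooth_on_compose_real)
    show "open (- {a})" by (simp add: open_Compl)
    then show "smooth_on (- {a}) (sq_dist a)" by (rule smooth_on_sq_dist)
    fix n and x assume "x \<in> - {a}"
    then have "complex_of_real (sq_dist a x) \<in> - \<real>\<^sub>\<le>\<^sub>0"
      by (auto simp: sq_dist_def complex_nonpos_Reals_iff)
    from holomorphic_derivI[OF holomorphic_higher_deriv[OF assms op, of n] op this]
    show "((\<lambda>s. (deriv ^^ n) F (of_real s)) has_vector_derivative (deriv ^^ Suc n) F (of_real (sq_dist a x))) (at (sq_dist a x))"
      using has_field_derivative_along_reals(3) by simp
  qed
  then show ?thesis by simp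
qed

definition laplacian :: "(real^2 \<Rightarrow> 'b::real_normed_vector) \<Rightarrow> real^2 \<Rightarrow> 'b" where
  "laplacian f x = (\<Sum>i\<in>UNIV. vpartial i (vpartial i f) x)"

text \<open>
  In the squared distance \<open>s\<close> the planar Laplacian of a radial function is \<open>4 (s h')'\<close>.
\<close>

lemma laplacian_radial:
  fixes h :: "real \<Rightarrow> 'b::real_normed_vector"
  assumes U: "open U" "x \<in> U"
    and h: "\<And>y. y \<in> U \<Longrightarrow> (h has_vector_derivative h1 (sq_dist a y)) (at (sq_dist a y))"
    and h1: "(h1 has_vector_derivative h2) (at (sq_dist a x))"
  shows "laplacian (\<lambda>x. h (sq_dist a x)) x = 4 *\<^sub>R (h1 (sq_dist a x) + sq_dist a x *\<^sub>R h2)"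
proof -
  have qd: "sq_dist a differentiable (at y)" for y
    by (rule smooth_on_differentiable[OF smooth_on_sq_dist[of UNIV]]) auto
  have "vpartial i (vpartial i (\<lambda>x. h (sq_dist a x))) x = 2 *\<^sub>R h1 (sq_dist a x) + (4 * ((x - a) $ i)\<^sup>2) *\<^sub>R h2" for i
  proof -
    have eq: "vpartial i (\<lambda>x. h (sq_dist a x)) y = vpartial i (sq_dist a) y *\<^sub>R h1 (sq_dist a y)" if "y \<in> U" for y
      by (rule vpartial_compose_real[OF h[OF that] qd])
    have d1: "vpartial i (sq_dist a) differentiable (at x)"
      by (rule smooth_on_differentiable[OF smooth_on_vpartial[OF smooth_on_sq_dist[of UNIV]]]) auto
    have d2: "(\<lambda>x. h1 (sq_dist a x)) differentiable (at x)"
      using has_derivative_compose_real[OF h1 qd] unfolding differentiable_def by blast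
    have d3: "(\<lambda>y. vpartial i (sq_dist a) y *\<^sub>R h1 (sq_dist a y)) differentiable (at x)"
      using d1 d2 by simp
    have "vpartial i (vpartial i (\<lambda>x. h (sq_dist a x))) x = vpartial i (\<lambda>y. vpartial i (sq_dist a) y *\<^sub>R h1 (sq_dist a y)) x"
      by (rule vpartial_cong_open[OF U, symmetric]) (use eq d3 in auto)
    also have "\<dots> = vpartial i (sq_dist a) x *\<^sub>R vpartial i (\<lambda>x. h1 (sq_dist a x)) x + vpartial i (vpartial i (sq_dist a)) x *\<^sub>R h1 (sq_dist a x)"
      by (rule vpartial_bilinear[OF bounded_bilinear_scaleR d1 d2])
    also have "vpartial i (\<lambda>x. h1 (sq_dist a x)) x = vpartial i (sq_dist a) x *\<^sub>R h2"
      by (rule vpartial_compose_real[OF h1 qd])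
    also have "vpartial i (vpartial i (sq_dist a)) x = 2"
    proof -
      have "((\<lambda>x. 2 * (x - a) $ i) has_derivative (\<lambda>h. 2 * h $ i)) (at x)"
        by (auto intro!: derivative_eq_intros bounded_linear.has_derivative[OF bounded_linear_vec_nth])
      from vpartial_eqI[OF this, of i] show ?thesis unfolding vpartial_sq_dist[abs_def] by simp
    qed
    moreover have "vpartial i (sq_dist a) x *\<^sub>R vpartial i (sq_dist a) x *\<^sub>R h2 = (4 * ((x - a) $ i)\<^sup>2) *\<^sub>R h2"
    proof -
      have "2 * t * (2 * t) = 4 * t\<^sup>2" for t :: real by (simp add: power2_eq_square)
      then show ?thesis unfolding vpartial_sq_dist scaleR_scaleR by (simp only:)
    qed
    ultimately show ?thesis by (simp only: add.commute)
  qed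
  then have "laplacian (\<lambda>x. h (sq_dist a x)) x = (\<Sum>i\<in>(UNIV::2 set). 2 *\<^sub>R h1 (sq_dist a x)) + (\<Sum>i\<in>UNIV. 4 * ((x - a) $ i)\<^sup>2) *\<^sub>R h2"
    by (simp add: laplacian_def sum.distrib scaleR_left.sum)
  also have "(\<Sum>i\<in>UNIV. 4 * ((x - a) $ i)\<^sup>2) = 4 * sq_dist a x"
    by (simp only: sum_distrib_left[symmetric] sum_sq_dist)
  finally show ?thesis by (simp add: scaleR_add_right) (simp add: sum_constant_scaleR)
qed

lemma laplacian_bilinear:
  assumes "bounded_bilinear pr" "open U" "x \<in> U" "smooth_on U f" "smooth_on U g"
  shows "laplacian (\<lambda>x. pr (f x) (g x)) x
    = pr (f x) (laplacian g x) + 2 *\<^sub>R (\<Sum>i\<in>UNIV. pr (vpartial i f x) (vpartial i g x)) + pr (laplacian f x) (g x)"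
proof -
  note sm = smooth_on_vpartial[OF assms(4)] smooth_on_vpartial[OF assms(5)]
  note df = smooth_on_differentiable[OF assms(4)] smooth_on_differentiable[OF assms(5)]
    smooth_on_differentiable[OF sm(1)] smooth_on_differentiable[OF sm(2)]
  note sp = smooth_on_bilinear[OF assms(2,1)]
  have "vpartial i (vpartial i (\<lambda>x. pr (f x) (g x))) x
     = pr (f x) (vpartial i (vpartial i g) x) + 2 *\<^sub>R pr (vpartial i f x) (vpartial i g x) + pr (vpartial i (vpartial i f) x) (g x)" for i
  proof -
    have s1: "smooth_on U (\<lambda>x. pr (f x) (vpartial i g x))" "smooth_on U (\<lambda>x. pr (vpartial i f x) (g x))"
      by (intro sp assms sm)+
    have "vpartial i (vpartial i (\<lambda>x. pr (f x) (g x))) x = vpartial i (\<lambda>x. pr (f x) (vpartial i g x) + pr (vpartial i f x) (g x)) x"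
    proof (rule vpartial_cong_open[OF assms(2,3), symmetric])
      show "(\<lambda>x. pr (f x) (vpartial i g x) + pr (vpartial i f x) (g x)) differentiable at x"
        using smooth_on_differentiable[OF smooth_on_add[OF assms(2) s1] assms(3)] .
    qed (simp add: vpartial_bilinear[OF assms(1)] df)
    also have "\<dots> = vpartial i (\<lambda>x. pr (f x) (vpartial i g x)) x + vpartial i (\<lambda>x. pr (vpartial i f x) (g x)) x"
      using vpartial_eqI[OF has_derivative_add[OF has_derivative_frechet has_derivative_frechet]]
        smooth_on_differentiable[OF s1(1) assms(3)] smooth_on_differentiable[OF s1(2) assms(3)]
      by (simp add: vpartial_def)
    finally show ?thesis using assms(3) by (simp add: vpartial_bilinear[OF assms(1)] df scaleR_2)
  qed
  then show ?thesis
    by (simp add: laplacian_def sum.distrib scaleR_sum_right bounded_bilinear.sum_left[OF assms(1)] bounded_bilinear.sum_right[OF assms(1)])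
qed

section \<open>Smooth cutoff functions\<close>

text \<open>
  Differentiation leads from one of these functions to combinations of others, so the smoothness
  of \<open>exp(- 1/s)\<close> at \<open>s = 0\<close> is an induction over the whole family.
\<close>

definition flat_exp :: "nat \<Rightarrow> real \<Rightarrow> real" where
  "flat_exp n s = (if s > 0 then inverse s ^ n * exp (- inverse s) else 0)"

lemma flat_exp_tendsto_0: "(flat_exp n \<longlongrightarrow> 0) (at_right 0)"
proof -
  have "((\<lambda>y::real. y ^ n / exp y) \<longlongrightarrow> 0) at_top" by (rule tendsto_power_div_exp_0)
  from filterlim_compose[OF this filterlim_inverse_at_top_right]
  have "((\<lambda>s::real. inverse s ^ n / exp (inverse s)) \<longlongrightarrow> 0) (at_right 0)" .
  then show ?thesis
    by (rule Lim_transform_eventually) (auto simp: eventually_at_filter flat_exp_def exp_minus divide_inverse)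
qed

lemma flat_exp_deriv:
  "(flat_exp n has_real_derivative flat_exp (n + 2) s - n * flat_exp (n + 1) s) (at s)"
proof (cases s "0::real" rule: linorder_cases)
  case greater
  have "((\<lambda>s. inverse s ^ n * exp (- inverse s)) has_real_derivative flat_exp (n + 2) s - n * flat_exp (n + 1) s) (at s)"
  proof -
    have inv: "(inverse has_real_derivative - (inverse s ^ 2)) (at s)"
      by (rule DERIV_cong[OF DERIV_inverse]) (use greater in \<open>simp_all add: power2_eq_square\<close>)
    have p: "((\<lambda>s. inverse s ^ n) has_real_derivative - (n * inverse s ^ (n + 1))) (at s)"
      by (rule DERIV_cong[OF DERIV_power[OF inv]]) (cases n; simp add: power2_eq_square)
    have e: "((\<lambda>s. exp (- inverse s)) has_real_derivative exp (- inverse s) * inverse s ^ 2) (at s)"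
      by (rule DERIV_cong[OF DERIV_fun_exp[OF DERIV_minus[OF inv]]]) simp
    show ?thesis
      by (rule DERIV_cong[OF DERIV_mult[OF p e]]) (use greater in \<open>simp add: flat_exp_def power_add power2_eq_square\<close>)
  qed
  then show ?thesis
    by (rule has_field_derivative_transform_within_open[OF _ open_greaterThan[of 0]])
      (use greater in \<open>auto simp: flat_exp_def\<close>)
next
  case less
  have "((\<lambda>s. 0) has_real_derivative flat_exp (n + 2) s - n * flat_exp (n + 1) s) (at s)"
    using less by (simp add: flat_exp_def)
  then show ?thesis
    by (rule has_field_derivative_transform_within_open[OF _ open_lessThan[of 0]])
      (use less in \<open>auto simp: flat_exp_def\<close>)
next
  case equal
  have "((\<lambda>h. (flat_exp n (0 + h) - flat_exp n 0) / h) \<longlongrightarrow> 0) (at_right 0)"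
    by (rule Lim_transform_eventually[OF flat_exp_tendsto_0[of "Suc n"]])
      (auto simp: eventually_at_filter flat_exp_def divide_inverse)
  moreover have "((\<lambda>h. (flat_exp n (0 + h) - flat_exp n 0) / h) \<longlongrightarrow> 0) (at_left 0)"
    by (rule Lim_transform_eventually[OF tendsto_const]) (auto simp: eventually_at_filter flat_exp_def)
  ultimately have "((\<lambda>h. (flat_exp n (0 + h) - flat_exp n 0) / h) \<longlongrightarrow> 0) (at 0)"
    by (simp add: filterlim_split_at)
  then show ?thesis using equal by (simp add: DERIV_def flat_exp_def)
qed

lemma smooth_on_flat_exp:
  assumes U: "open U" and q: "smooth_on U q"
  shows "smooth_on U (\<lambda>x. flat_exp n (q x))"
proof -
  have "Ck_on k U (\<lambda>x. flat_exp n (q x))" for k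
  proof (induction k arbitrary: n)
    case 0
    have "isCont (\<lambda>x. flat_exp n (q x)) x" if "x \<in> U" for x
      by (rule isCont_o2[OF smooth_on_isCont[OF q that] DERIV_isCont[OF flat_exp_deriv]])
    then show ?case by simp
  next
    case (Suc k)
    have "Ck_on k U (\<lambda>x. flat_exp (n + 2) (q x) + (- n) *\<^sub>R flat_exp (n + 1) (q x))"
      by (intro Ck_on_add[OF U] Ck_on_linear[OF U bounded_linear_scaleR_right] Suc)
    then have "Ck_on k U (\<lambda>x. flat_exp (n + 2) (q x) - n * flat_exp (n + 1) (q x))" by simp
    then show ?case
      by (intro Ck_on_compose_Suc[OF U q, where h' = "\<lambda>s. flat_exp (n + 2) s - n * flat_exp (n + 1) s"])
        (use flat_exp_deriv has_real_derivative_iff_has_vector_derivative in auto)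
  qed
  then show ?thesis by (simp add: smooth_on_def)
qed

definition bump :: "real \<Rightarrow> real" where
  "bump s = flat_exp 0 (s - 1) * flat_exp 0 (2 - s)"

definition bump' :: "real \<Rightarrow> real" where
  "bump' s = flat_exp 2 (s - 1) * flat_exp 0 (2 - s) - flat_exp 0 (s - 1) * flat_exp 2 (2 - s)"

lemma bump_deriv: "(bump has_real_derivative bump' s) (at s)"
proof -
  have d: "(flat_exp 0 has_real_derivative flat_exp 2 s) (at s)" for s
    using flat_exp_deriv[of 0 s] by (simp add: numeral_2_eq_2)
  have 1: "((\<lambda>s. flat_exp 0 (s - 1)) has_real_derivative flat_exp 2 (s - 1) * 1) (at s)"
    by (rule DERIV_chain2[OF d]) (auto intro!: derivative_eq_intros)
  have 2: "((\<lambda>s. flat_exp 0 (2 - s)) has_real_derivative flat_exp 2 (2 - s) * (-1)) (at s)"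
    by (rule DERIV_chain2[OF d]) (auto intro!: derivative_eq_intros)
  show ?thesis unfolding bump_def[abs_def] bump'_def
    by (rule DERIV_cong[OF DERIV_mult[OF 1 2]]) simp
qed

lemma bump_props: "bump s \<ge> 0" "s \<notin> {1<..<2} \<Longrightarrow> bump s = 0" "s \<in> {1<..<2} \<Longrightarrow> bump s > 0"
  "s \<notin> {1<..<2} \<Longrightarrow> bump' s = 0"
  by (auto simp: bump_def bump'_def flat_exp_def)

lemma bump_cont: "continuous_on A bump"
  by (rule continuous_at_imp_continuous_on) (use DERIV_isCont[OF bump_deriv] in auto)

lemma bump'_cont: "continuous_on A bump'"
proof -
  have c: "continuous_on UNIV (flat_exp n)" for n
    by (rule continuous_at_imp_continuous_on) (use DERIV_isCont[OF flat_exp_deriv] in auto)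
  have "continuous_on UNIV bump'" unfolding bump'_def[abs_def]
    by (intro continuous_intros continuous_on_compose2[OF c]) auto
  then show ?thesis using continuous_on_subset by blast
qed

definition bump_mass :: real where "bump_mass = integral {1..2} bump"

lemma bump_mass_pos: "bump_mass > 0"
proof -
  have "integral {1..2} bump \<ge> 0" using bump_props(1) by (intro integral_nonneg integrable_continuous_real bump_cont) auto
  moreover have "integral {1..2} bump \<noteq> 0"
    using integral_eq_0_iff[OF bump_cont[of "{1..2}"] ] bump_props(1) bump_props(3)[of "3/2"] by fastforce
  ultimately show ?thesis by (simp add: bump_mass_def)
qed

definition cutoff1 :: "real \<Rightarrow> real" where "cutoff1 s = - bump s / bump_mass"
definition cutoff2 :: "real \<Rightarrow> real" where "cutoff2 s = - bump' s / bump_mass"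
text \<open>
  Equal to 1 up to 1 and to 0 from 2 on; \<open>cutoff1\<close> and \<open>cutoff2\<close> are its first two derivatives.
\<close>

definition cutoff :: "real \<Rightarrow> real" where
  "cutoff s = (if s \<le> 0 then 1 else 1 - integral {0..s} bump / bump_mass)"

lemma integral_bump_0: "s \<le> 1 \<Longrightarrow> integral {0..s} bump = 0"
  by (rule integral_unique, rule has_integral_is_0) (auto simp: bump_props)

lemma cutoff_eq_1: "s \<le> 1 \<Longrightarrow> cutoff s = 1"
  by (simp add: cutoff_def integral_bump_0)

lemma integral_bump_split: "1 \<le> s \<Longrightarrow> integral {0..s} bump = integral {1..s} bump"
  using Henstock_Kurzweil_Integration.integral_combine[of 0 1 s bump] integral_bump_0[of 1]
  by (simp add: integrable_continuous_real bump_cont)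

lemma cutoff_eq_0:
  assumes "s \<ge> 2"
  shows "cutoff s = 0"
proof -
  have "integral {2..s} bump = 0" by (rule integral_unique, rule has_integral_is_0) (auto simp: bump_props)
  then have "integral {1..s} bump = bump_mass"
    using Henstock_Kurzweil_Integration.integral_combine[of 1 2 s bump] assms by (simp add: integrable_continuous_real bump_cont bump_mass_def)
  then show ?thesis using assms bump_mass_pos by (simp add: cutoff_def integral_bump_split)
qed

lemma cutoff_deriv: "(cutoff has_real_derivative cutoff1 s) (at s)"
proof (cases "s < 1")
  case True
  have "((\<lambda>s. 1) has_real_derivative cutoff1 s) (at s)" using True by (simp add: cutoff1_def bump_props)
  then show ?thesis
    by (rule has_field_derivative_transform_within_open[OF _ open_lessThan[of 1]]) (use True cutoff_eq_1 in auto)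
next
  case False
  have "((\<lambda>u. integral {0..u} bump) has_real_derivative bump s) (at s within {0..s+1})"
    by (rule integral_has_real_derivative) (use False bump_cont in auto)
  then have "((\<lambda>u. integral {0..u} bump) has_real_derivative bump s) (at s)"
    using False by (subst (asm) at_within_interior) auto
  then have "((\<lambda>u. 1 - integral {0..u} bump / bump_mass) has_real_derivative cutoff1 s) (at s)"
    unfolding cutoff1_def using bump_mass_pos by (auto intro!: derivative_eq_intros)
  then show ?thesis
    by (rule has_field_derivative_transform_within_open[OF _ open_greaterThan[of 0]]) (use False in \<open>auto simp: cutoff_def\<close>)
qed

lemma cutoff1_deriv: "(cutoff1 has_real_derivative cutoff2 s) (at s)"
  unfolding cutoff1_def[abs_def] cutoff2_def
  using DERIV_cdivide[OF DERIV_minus[OF bump_deriv]] by blast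

lemma cutoff_props: "s \<notin> {1<..<2} \<Longrightarrow> cutoff1 s = 0" "s \<notin> {1<..<2} \<Longrightarrow> cutoff2 s = 0" "cutoff1 s \<le> 0"
  using bump_mass_pos by (auto simp: cutoff1_def cutoff2_def bump_props intro!: divide_nonneg_pos)

lemma smooth_on_cutoff:
  assumes U: "open U" and q: "smooth_on U q"
  shows "smooth_on U (\<lambda>x. cutoff (q x))"
proof -
  have qs: "smooth_on U (\<lambda>x. q x - 1)" "smooth_on U (\<lambda>x. 2 - q x)"
    by (intro smooth_on_diff[OF U] q smooth_on_const)+
  have "smooth_on U (\<lambda>x. (- inverse bump_mass) *\<^sub>R (flat_exp 0 (q x - 1) * flat_exp 0 (2 - q x)))"
    by (intro smooth_on_linear[OF U bounded_linear_scaleR_right] smooth_on_bilinear[OF U bounded_bilinear_mult] smooth_on_flat_exp[OF U] qs)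
  then have s1: "smooth_on U (\<lambda>x. cutoff1 (q x))"
    by (simp add: cutoff1_def bump_def divide_inverse mult.commute)
  have "Ck_on (Suc k) U (\<lambda>x. cutoff (q x))" for k
    by (rule Ck_on_compose_Suc[OF U q, where h' = cutoff1])
      (use cutoff_deriv has_real_derivative_iff_has_vector_derivative s1 in \<open>auto simp: smooth_on_def\<close>)
  then show ?thesis unfolding smooth_on_def using Ck_on_Suc_imp by blast
qed

lemma cutoff_bounds:
  obtains M where "M \<ge> 1" "\<And>s. \<bar>cutoff s\<bar> \<le> M" "\<And>s. \<bar>cutoff1 s\<bar> \<le> M" "\<And>s. \<bar>cutoff2 s\<bar> \<le> M"
proof -
  have b: "\<exists>M. \<forall>s. \<bar>f s\<bar> \<le> M" if f: "continuous_on {1..2} f" "\<And>s. s \<notin> {1..2} \<Longrightarrow> \<bar>f s\<bar> \<le> 1" for f :: "real \<Rightarrow> real"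
  proof -
    have "bounded (f ` {1..2})" by (intro compact_imp_bounded compact_continuous_image f) auto
    then obtain M where "\<forall>s\<in>{1..2}. \<bar>f s\<bar> \<le> M" by (auto simp: bounded_iff)
    then have "\<bar>f s\<bar> \<le> max 1 M" for s using f(2)[of s] by (cases "s \<in> {1..2}") (auto simp: le_max_iff_disj)
    then show ?thesis by blast
  qed
  have "continuous_on {1..2} cutoff" "continuous_on {1..2} cutoff1"
    using DERIV_isCont[OF cutoff_deriv] DERIV_isCont[OF cutoff1_deriv] by (auto intro: continuous_at_imp_continuous_on)
  moreover have "continuous_on {1..2} cutoff2" unfolding cutoff2_def[abs_def]
    using bump_mass_pos by (intro continuous_intros bump'_cont) auto
  moreover have "\<bar>cutoff s\<bar> \<le> 1" if "s \<notin> {1..2}" for s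
    using that cutoff_eq_1[of s] cutoff_eq_0[of s] by (cases "s \<le> 1") auto
  ultimately obtain M0 M1 M2 where M: "\<And>s. \<bar>cutoff s\<bar> \<le> M0" "\<And>s. \<bar>cutoff1 s\<bar> \<le> M1" "\<And>s. \<bar>cutoff2 s\<bar> \<le> M2"
    using b[of cutoff] b[of cutoff1] b[of cutoff2] cutoff_props by (metis abs_zero atLeastAtMost_iff greaterThanLessThan_iff less_imp_le zero_le_one)
  show ?thesis
    by (rule that[of "max 1 (max M0 (max M1 M2))"]) (use M in \<open>auto simp: le_max_iff_disj\<close>)
qed

section \<open>Integration of compactly supported derivatives\<close>

lemma has_derivative_zero_outside:
  assumes "open V" "x \<in> V" "\<And>y. y \<in> V \<Longrightarrow> f y = 0"
  shows "(f has_derivative (\<lambda>h. 0)) (at x)"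
  by (rule has_derivative_transform_within_open[OF has_derivative_const assms(1,2), of "0"]) (simp add: assms(3))

lemma vpartial_zero_outside:
  assumes "open V" "x \<in> V" "\<And>y. y \<in> V \<Longrightarrow> f y = 0"
  shows "vpartial i f x = 0"
  using vpartial_eqI[OF has_derivative_zero_outside[OF assms]] .

lemma smooth_on_zero_outside:
  assumes "open V" "\<And>y. y \<in> V \<Longrightarrow> f y = 0"
  shows "smooth_on V f"
  by (rule smooth_on_cong[OF assms(1) _ smooth_on_const[of V 0]]) (simp add: assms(2))

lemma integrable_compact_support:
  fixes f :: "real^2 \<Rightarrow> 'b::{banach,second_countable_topology}"
  assumes "compact K" "continuous_on UNIV f" "\<And>x. x \<notin> K \<Longrightarrow> f x = 0"
  shows "integrable lborel f"
proof -
  have "integrable lborel (\<lambda>x. indicator K x *\<^sub>R f x)"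
    by (rule borel_integrable_compact[OF assms(1) continuous_on_subset[OF assms(2)]]) simp
  also have "(\<lambda>x. indicator K x *\<^sub>R f x) = f" using assms(3) by (auto simp: indicator_def)
  finally show ?thesis .
qed

lemma lborel_integral_translate:
  fixes f :: "real^2 \<Rightarrow> 'b::{banach,second_countable_topology}"
  assumes "f \<in> borel_measurable borel"
  shows "(LINT x|lborel. f (x + c)) = (LINT x|lborel. f x)"
proof -
  have "(LINT x|lborel. f x) = (LINT x|distr lborel borel ((+) c). f x)"
    by (simp add: lborel_distr_plus)
  also have "\<dots> = (LINT x|lborel. f (c + x))"
    by (rule integral_distr) (use assms in auto)
  finally show ?thesis by (simp add: add.commute)
qed

text \<open>
  Difference quotients have integral 0 by translation invariance. They vanish off a fixed disc and
  are bounded by the supremum of the derivative, so dominated convergence applies.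
\<close>

lemma integral_vpartial_zero:
  fixes f :: "real^2 \<Rightarrow> 'b::euclidean_space"
  assumes C1: "Ck_on 1 UNIV f" and K: "compact K" "\<And>x. x \<notin> K \<Longrightarrow> f x = 0"
  shows "(LINT x|lborel. vpartial i f x) = 0"
proof -
  let ?e = "axis i 1 :: real^2" and ?g = "vpartial i f"
  have d: "f differentiable (at x)" for x using C1 by simp
  have cg: "continuous_on UNIV ?g" using C1 by (simp add: continuous_on_eq_continuous_at)
  have cf: "continuous_on UNIV f"
    using d by (intro continuous_at_imp_continuous_on) (auto intro: differentiable_imp_continuous_within)
  have gK: "?g x = 0" if "x \<notin> K" for x
    by (rule vpartial_zero_outside[of "- K"]) (use K that compact_imp_closed in \<open>auto simp: open_Compl\<close>)
  have "bounded (?g ` K)" by (intro compact_imp_bounded compact_continuous_image continuous_on_subset[OF cg] K) auto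
  then obtain B where "\<And>x. x \<in> K \<Longrightarrow> norm (?g x) \<le> B" by (auto simp: bounded_iff)
  then have B: "norm (?g x) \<le> max 0 B" for x using gK[of x] by (cases "x \<in> K") (auto simp: le_max_iff_disj)
  have line: "((\<lambda>t. f (x + t *\<^sub>R ?e)) has_vector_derivative ?g (x + t *\<^sub>R ?e)) (at t)" for x t
  proof -
    have "((\<lambda>t. x + t *\<^sub>R ?e) has_derivative (\<lambda>h. h *\<^sub>R ?e)) (at t)" by (auto intro!: derivative_eq_intros)
    from has_derivative_compose[OF this has_derivative_frechet[OF d]]
    have "((\<lambda>t. f (x + t *\<^sub>R ?e)) has_derivative (\<lambda>h. frechet_derivative f (at (x + t *\<^sub>R ?e)) (h *\<^sub>R ?e))) (at t)" .
    moreover have "frechet_derivative f (at (x + t *\<^sub>R ?e)) (h *\<^sub>R ?e) = h *\<^sub>R ?g (x + t *\<^sub>R ?e)" for h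
      using linear_frechet_derivative[OF d] by (simp add: linear_scale vpartial_def)
    ultimately show ?thesis by (simp add: has_vector_derivative_def)
  qed
  have lip: "norm (f (x + t *\<^sub>R ?e) - f x) \<le> max 0 B * \<bar>t\<bar>" for x t
  proof -
    have "norm (f (x + t *\<^sub>R ?e) - f (x + 0 *\<^sub>R ?e)) \<le> max 0 B * norm (t - 0)"
    proof (rule differentiable_bound[of UNIV "\<lambda>t. f (x + t *\<^sub>R ?e)"])
      show "((\<lambda>t. f (x + t *\<^sub>R ?e)) has_derivative (\<lambda>h. h *\<^sub>R ?g (x + t *\<^sub>R ?e))) (at t within UNIV)" for t
        using line[of x t] by (simp add: has_vector_derivative_def)
      show "onorm (\<lambda>h. h *\<^sub>R ?g (x + t *\<^sub>R ?e)) \<le> max 0 B" for t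
        by (rule onorm_le) (simp add: B mult.commute[of "max 0 B"] mult_left_mono)
    qed auto
    then show ?thesis by simp
  qed
  define t where "t n = inverse (real (Suc n))" for n
  have t: "0 < t n" "t n \<le> 1" for n by (auto simp: t_def field_simps)
  have tl: "filterlim t (at 0) sequentially"
    unfolding t_def using LIMSEQ_inverse_real_of_nat by (auto simp: filterlim_at simp del: of_nat_Suc)
  obtain R where R: "\<And>x. x \<in> K \<Longrightarrow> norm x \<le> R" using compact_imp_bounded[OF K(1)] by (auto simp: bounded_iff)
  let ?C = "cball (0::real^2) (R + 1)"
  have sup: "f (x + t n *\<^sub>R ?e) - f x = 0" if "x \<notin> ?C" for x n
  proof -
    have "norm (t n *\<^sub>R ?e) \<le> 1" using t[of n] by simp
    then have "norm x \<le> norm (x + t n *\<^sub>R ?e) + 1" using norm_triangle_ineq4[of "x + t n *\<^sub>R ?e" "t n *\<^sub>R ?e"] by simp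
    then have "x + t n *\<^sub>R ?e \<notin> K" "x \<notin> K" using that R by force+
    then show ?thesis using K(2) by simp
  qed
  have fi: "integrable lborel f" by (rule integrable_compact_support[OF K(1) cf K(2)])
  have fm: "f \<in> borel_measurable borel" by (rule borel_measurable_continuous_onI[OF cf])
  have fti: "integrable lborel (\<lambda>x. f (x + t n *\<^sub>R ?e) - f x)" for n
    by (rule integrable_compact_support[of ?C]) (use sup in \<open>auto intro!: continuous_intros continuous_on_compose2[OF cf]\<close>)
  have zero: "(LINT x|lborel. (f (x + t n *\<^sub>R ?e) - f x) /\<^sub>R t n) = 0" for n
  proof -
    have "integrable lborel (\<lambda>x. f (x + t n *\<^sub>R ?e))"
      using Bochner_Integration.integrable_add[OF fti fi] by simp
    then show ?thesis using fi lborel_integral_translate[OF fm, of "t n *\<^sub>R ?e"] by simp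
  qed
  have "(\<lambda>n. LINT x|lborel. (f (x + t n *\<^sub>R ?e) - f x) /\<^sub>R t n) \<longlonglongrightarrow> (LINT x|lborel. ?g x)"
  proof (rule integral_dominated_convergence)
    show "?g \<in> borel_measurable lborel" using borel_measurable_continuous_onI[OF cg] by simp
    show "(\<lambda>x. (f (x + t n *\<^sub>R ?e) - f x) /\<^sub>R t n) \<in> borel_measurable lborel" for n
      using fti[of n] by (intro borel_measurable_scaleR) auto
    show "integrable lborel (\<lambda>x. indicator ?C x * max 0 B)"
      by (intro integrable_mult_left integrable_real_indicator emeasure_lborel_cball_finite) auto
    show "AE x in lborel. norm ((f (x + t n *\<^sub>R ?e) - f x) /\<^sub>R t n) \<le> indicator ?C x * max 0 B" for n
    proof (intro always_eventually allI)
      fix x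
      show "norm ((f (x + t n *\<^sub>R ?e) - f x) /\<^sub>R t n) \<le> indicator ?C x * max 0 B"
      proof (cases "x \<in> ?C")
        case True
        have "norm ((f (x + t n *\<^sub>R ?e) - f x) /\<^sub>R t n) = norm (f (x + t n *\<^sub>R ?e) - f x) / t n"
          using t[of n] by (simp add: divide_inverse mult.commute)
        also have "\<dots> \<le> max 0 B" using lip[of x "t n"] t[of n] by (subst pos_divide_le_eq) auto
        finally show ?thesis using True by simp
      next
        case False
        then show ?thesis using sup[of x n] by simp
      qed
    qed
    show "AE x in lborel. (\<lambda>n. (f (x + t n *\<^sub>R ?e) - f x) /\<^sub>R t n) \<longlonglongrightarrow> ?g x"
    proof (intro always_eventually allI)
      fix x
      have "((\<lambda>h. norm (f (x + h *\<^sub>R ?e) - f x - h *\<^sub>R ?g x) / norm h) \<longlongrightarrow> 0) (at 0)"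
        using line[of x 0] by (simp add: has_vector_derivative_def has_derivative_at)
      then have "((\<lambda>h. norm ((f (x + h *\<^sub>R ?e) - f x) /\<^sub>R h - ?g x)) \<longlongrightarrow> 0) (at 0)"
      proof (rule Lim_transform_eventually)
        have "norm (v - h *\<^sub>R w) / norm h = norm (v /\<^sub>R h - w)" if "h \<noteq> 0" for h :: real and v w :: 'b
        proof -
          have "v /\<^sub>R h - w = (v - h *\<^sub>R w) /\<^sub>R h" using that by (simp add: scaleR_diff_right)
          then show ?thesis by (simp add: divide_inverse mult.commute)
        qed
        then show "\<forall>\<^sub>F h in at 0. norm (f (x + h *\<^sub>R ?e) - f x - h *\<^sub>R ?g x) / norm h = norm ((f (x + h *\<^sub>R ?e) - f x) /\<^sub>R h - ?g x)"
          by (auto simp: eventually_at_filter)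
      qed
      then have "((\<lambda>h. (f (x + h *\<^sub>R ?e) - f x) /\<^sub>R h) \<longlongrightarrow> ?g x) (at 0)"
        by (subst Lim_null) (rule tendsto_norm_zero_cancel)
      from filterlim_compose[OF this tl] show "(\<lambda>n. (f (x + t n *\<^sub>R ?e) - f x) /\<^sub>R t n) \<longlonglongrightarrow> ?g x" .
    qed
  qed
  then show ?thesis unfolding zero by (simp add: LIMSEQ_const_iff)
qed

section \<open>Classical derivatives as weak derivatives\<close>

lemma test_functionE:
  assumes "\<phi> \<in> test_functions \<Omega>"
  obtains K where "smooth_on UNIV \<phi>" "compact K" "K \<subseteq> \<Omega>" "\<And>x. x \<notin> K \<Longrightarrow> \<phi> x = 0"
  using assms by (auto simp: test_functions_def cont_diff_eq_Ck_on smooth_on_def)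

lemma test_functionI:
  "smooth_on UNIV \<phi> \<Longrightarrow> compact K \<Longrightarrow> K \<subseteq> \<Omega> \<Longrightarrow> (\<And>x. x \<notin> K \<Longrightarrow> \<phi> x = 0) \<Longrightarrow> \<phi> \<in> test_functions \<Omega>"
  by (auto simp: test_functions_def cont_diff_eq_Ck_on smooth_on_def)

lemma vpartial_zero_off_compact:
  assumes "compact K" "\<And>x. x \<notin> K \<Longrightarrow> f x = 0" "x \<notin> K"
  shows "vpartial i f x = 0"
  by (rule vpartial_zero_outside[of "- K"]) (use assms compact_imp_closed in \<open>auto simp: open_Compl\<close>)

lemma test_function_vpartial:
  assumes "\<phi> \<in> test_functions \<Omega>"
  shows "vpartial i \<phi> \<in> test_functions \<Omega>"
proof -
  obtain K where K: "smooth_on UNIV \<phi>" "compact K" "K \<subseteq> \<Omega>" "\<And>x. x \<notin> K \<Longrightarrow> \<phi> x = 0"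
    using test_functionE[OF assms] by metis
  show ?thesis
    by (rule test_functionI[OF smooth_on_vpartial[OF K(1)] K(2,3)]) (rule vpartial_zero_off_compact[OF K(2,4)])
qed

text \<open>
  Off \<open>\<Omega>\<close> the function vanishes in a neighbourhood, since its support is closed and contained in \<open>\<Omega>\<close>.
\<close>

lemma compactly_supported_isCont:
  assumes "compact K" "K \<subseteq> \<Omega>" "\<And>x. x \<notin> K \<Longrightarrow> f x = 0" "\<And>x. x \<in> \<Omega> \<Longrightarrow> isCont f x"
  shows "continuous_on UNIV (f :: real^2 \<Rightarrow> 'b::real_normed_vector)"
proof (intro continuous_at_imp_continuous_on ballI)
  fix x :: "real^2"
  show "isCont f x"
  proof (cases "x \<in> \<Omega>")
    case False
    have "open (- K)" using compact_imp_closed[OF assms(1)] by (simp add: open_Compl)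
    then have "(f has_derivative (\<lambda>h. 0)) (at x)"
      by (rule has_derivative_zero_outside) (use assms(2,3) False in auto)
    then show ?thesis by (rule has_derivative_continuous)
  qed (rule assms)
qed

lemma integrable_test_times:
  fixes g :: "real^2 \<Rightarrow> 'b::{banach,second_countable_topology}"
  assumes "\<phi> \<in> test_functions \<Omega>" "\<And>x. x \<in> \<Omega> \<Longrightarrow> isCont g x"
  shows "integrable lborel (\<lambda>x. \<phi> x *\<^sub>R g x)"
proof -
  obtain K where K: "smooth_on UNIV \<phi>" "compact K" "K \<subseteq> \<Omega>" "\<And>x. x \<notin> K \<Longrightarrow> \<phi> x = 0"
    using test_functionE[OF assms(1)] by metis
  have "continuous_on UNIV (\<lambda>x. \<phi> x *\<^sub>R g x)"
    by (rule compactly_supported_isCont[OF K(2,3)])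
      (use K(4) assms(2) smooth_on_isCont[OF K(1)] in \<open>auto intro!: continuous_intros\<close>)
  then show ?thesis by (rule integrable_compact_support[OF K(2)]) (simp add: K(4))
qed

text \<open>
  The product with a test function, extended by 0, is continuously differentiable on the whole
  plane, and the integral of its derivative vanishes.
\<close>

lemma weak_partial_Ck_on:
  fixes f :: "real^2 \<Rightarrow> complex^'n::finite"
  assumes "open \<Omega>" "Ck_on 1 \<Omega> f"
  shows "weak_partial \<Omega> i f (vpartial i f)"
  unfolding weak_partial_def partial_eq_vpartial
proof
  fix \<phi> assume \<phi>: "\<phi> \<in> test_functions \<Omega>"
  obtain K where K: "smooth_on UNIV \<phi>" "compact K" "K \<subseteq> \<Omega>" "\<And>x. x \<notin> K \<Longrightarrow> \<phi> x = 0"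
    using test_functionE[OF \<phi>] by metis
  let ?\<psi> = "\<lambda>x. \<phi> x *\<^sub>R f x"
  have opK: "open (- K)" using compact_imp_closed[OF K(2)] by (simp add: open_Compl)
  have "Ck_on 1 \<Omega> ?\<psi>"
    by (rule Ck_on_bilinear[OF assms(1) bounded_bilinear_scaleR _ assms(2)])
      (use smooth_on_subset[OF K(1), of \<Omega>] in \<open>simp add: smooth_on_def\<close>)
  moreover have "Ck_on 1 (- K) ?\<psi>"
    using smooth_on_zero_outside[OF opK, of ?\<psi>] K(4) by (auto simp: smooth_on_def)
  ultimately have "Ck_on 1 (\<Omega> \<union> - K) ?\<psi>" by (rule Ck_on_Un)
  moreover have "\<Omega> \<union> - K = UNIV" using K(3) by auto
  ultimately have C1: "Ck_on 1 UNIV ?\<psi>" by simp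
  have df: "f differentiable (at x)" if "x \<in> \<Omega>" for x using assms(2) that by simp
  have cf: "isCont f x" if "x \<in> \<Omega>" for x using df[OF that] by (rule differentiable_imp_continuous_within)
  have cg: "isCont (vpartial i f) x" if "x \<in> \<Omega>" for x using assms(2) that by simp
  have eq: "vpartial i ?\<psi> x = \<phi> x *\<^sub>R vpartial i f x + vpartial i \<phi> x *\<^sub>R f x" for x
  proof (cases "x \<in> \<Omega>")
    case True
    show ?thesis
      by (rule vpartial_bilinear[OF bounded_bilinear_scaleR smooth_on_differentiable[OF K(1)] df[OF True]]) simp
  next
    case False
    then have "x \<notin> K" using K(3) by auto
    then show ?thesis
      using vpartial_zero_off_compact[OF K(2), of ?\<psi> x i] vpartial_zero_off_compact[OF K(2), of \<phi> x i] K(4) by simp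
  qed
  have "0 = (LINT x|lborel. vpartial i ?\<psi> x)"
    by (rule integral_vpartial_zero[OF C1 K(2), symmetric]) (simp add: K(4))
  also have "\<dots> = (LINT x|lborel. \<phi> x *\<^sub>R vpartial i f x) + (LINT x|lborel. vpartial i \<phi> x *\<^sub>R f x)"
    unfolding eq
    by (intro Bochner_Integration.integral_add integrable_test_times[OF \<phi>] integrable_test_times[OF test_function_vpartial[OF \<phi>]] cf cg)
  finally show "(LINT x|lborel. vpartial i \<phi> x *\<^sub>R f x) = - (LINT x|lborel. \<phi> x *\<^sub>R vpartial i f x)"
    by (simp add: eq_neg_iff_add_eq_0 add.commute)
qed

lemma L2_loc_continuous:
  fixes f :: "real^2 \<Rightarrow> complex^'n::finite"
  assumes "\<And>x. x \<in> \<Omega> \<Longrightarrow> isCont f x"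
  shows "f \<in> L2_loc \<Omega>"
  unfolding L2_loc_def
proof (intro CollectI allI impI)
  fix K assume K: "compact K \<and> K \<subseteq> \<Omega>"
  have c: "continuous_on K f" using assms K by (auto intro: continuous_at_imp_continuous_on)
  have "set_borel_measurable lborel K f"
    unfolding set_borel_measurable_def
    using borel_measurable_continuous_on_indicator[OF _ c] K by (auto intro: borel_compact)
  moreover have "set_integrable lborel K (\<lambda>x. (norm (f x))\<^sup>2)"
    unfolding set_integrable_def
    by (rule borel_integrable_compact) (use K c in \<open>auto intro!: continuous_intros\<close>)
  ultimately show "set_borel_measurable lborel K f \<and> set_integrable lborel K (\<lambda>x. (norm (f x))\<^sup>2)" ..
qed

lemma smooth_on_W2_loc:
  fixes f :: "real^2 \<Rightarrow> complex^'n::finite"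
  assumes "open \<Omega>" "smooth_on \<Omega> f"
  shows "f \<in> W2_loc k \<Omega>"
  using assms(2)
proof (induction k arbitrary: f)
  case 0
  then show ?case by (auto intro!: L2_loc_continuous smooth_on_isCont)
next
  case (Suc k)
  have "weak_partial \<Omega> i f (vpartial i f)" for i
    by (rule weak_partial_Ck_on[OF assms(1)]) (use Suc.prems in \<open>simp add: smooth_on_def\<close>)
  then show ?case using Suc by (auto intro!: L2_loc_continuous smooth_on_isCont bexI[OF _ Suc.IH] smooth_on_vpartial)
qed

lemma smooth_on_weak_laplacian:
  fixes f :: "real^2 \<Rightarrow> complex^'n::finite"
  assumes "open \<Omega>" "smooth_on \<Omega> f"
  shows "weak_laplacian \<Omega> f (laplacian f)"
  unfolding weak_laplacian_def partial_eq_vpartial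
proof
  fix \<phi> assume \<phi>: "\<phi> \<in> test_functions \<Omega>"
  note \<phi>1 = test_function_vpartial[OF \<phi>] and \<phi>2 = test_function_vpartial[OF test_function_vpartial[OF \<phi>]]
  note f1 = smooth_on_vpartial[OF assms(2)] and f2 = smooth_on_vpartial[OF smooth_on_vpartial[OF assms(2)]]
  have wp: "(LINT x|lborel. vpartial i \<psi> x *\<^sub>R h x) = - (LINT x|lborel. \<psi> x *\<^sub>R vpartial i h x)"
    if "\<psi> \<in> test_functions \<Omega>" "smooth_on \<Omega> h" for \<psi> i and h :: "real^2 \<Rightarrow> complex^'n"
    using weak_partial_Ck_on[OF assms(1), of h i] that unfolding weak_partial_def partial_eq_vpartial smooth_on_def by blast
  have "(LINT x|lborel. (\<Sum>i\<in>UNIV. vpartial i (vpartial i \<phi>) x) *\<^sub>R f x)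
      = (\<Sum>i\<in>UNIV. LINT x|lborel. vpartial i (vpartial i \<phi>) x *\<^sub>R f x)"
    unfolding scaleR_left.sum
    by (rule Bochner_Integration.integral_sum) (rule integrable_test_times[OF \<phi>2 smooth_on_isCont[OF assms(2)]])
  also have "\<dots> = (\<Sum>i\<in>UNIV. LINT x|lborel. \<phi> x *\<^sub>R vpartial i (vpartial i f) x)"
    by (intro sum.cong refl) (simp add: wp[OF \<phi>1 assms(2)] wp[OF \<phi> f1])
  also have "\<dots> = (LINT x|lborel. \<phi> x *\<^sub>R laplacian f x)"
    unfolding laplacian_def scaleR_sum_right
    by (rule Bochner_Integration.integral_sum[symmetric]) (rule integrable_test_times[OF \<phi> smooth_on_isCont[OF f2]])
  finally show "(LINT x|lborel. (\<Sum>i\<in>UNIV. vpartial i (vpartial i \<phi>) x) *\<^sub>R f x) = (LINT x|lborel. \<phi> x *\<^sub>R laplacian f x)" .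
qed

section \<open>Integrals of radial functions\<close>

text \<open>
  The disc \<open>|x|\<^sup>2 \<le> a\<close> has area \<open>\<pi> a\<close>, so in the plane the squared norm has constant density \<open>\<pi>\<close>. This is
  integration in polar coordinates.
\<close>

lemma distr_sq_norm_lborel:
  "distr lborel borel (\<lambda>x::real^2. (norm x)\<^sup>2) = density lborel (\<lambda>s. ennreal pi * indicator {0..} s)"
proof (rule measure_eqI_generator_eq[where E = "range (\<lambda>a::real. {..a})" and \<Omega> = UNIV and A = "\<lambda>i. {..real i}"])
  show "Int_stable (range (\<lambda>a::real. {..a}))" by (auto simp: Int_stable_def)
  show "sets (distr lborel borel (\<lambda>x::real^2. (norm x)\<^sup>2)) = sigma_sets UNIV (range (\<lambda>a::real. {..a}))"
    by (simp add: borel_eq_atMost sets_measure_of)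
  show "sets (density lborel (\<lambda>s. ennreal pi * indicator {0..} s)) = sigma_sets UNIV (range (\<lambda>a::real. {..a}))"
    by (simp add: borel_eq_atMost sets_measure_of)
  show "(\<Union>i. {..real i}) = UNIV" by (auto intro: real_arch_simple)
  have main: "emeasure (distr lborel borel (\<lambda>x::real^2. (norm x)\<^sup>2)) {..a} = ennreal (pi * max 0 a)" for a :: real
  proof (cases "a \<ge> 0")
    case True
    have "{x::real^2. (norm x)\<^sup>2 \<le> a} = cball 0 (sqrt a)"
      using True by (auto simp: real_le_rsqrt) (metis abs_norm_cancel real_sqrt_abs real_sqrt_le_iff)+
    then show ?thesis
      using True by (simp add: emeasure_distr vimage_def emeasure_cball unit_ball_vol_2)
  next
    case False
    then have "{x::real^2. (norm x)\<^sup>2 \<le> a} = {}" using zero_le_power2 order_trans by (metis (no_types, lifting) Collect_empty_eq)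
    then show ?thesis using False by (simp add: emeasure_distr vimage_def)
  qed
  then show "emeasure (distr lborel borel (\<lambda>x::real^2. (norm x)\<^sup>2)) {..real i} \<noteq> \<infinity>" for i by simp
  fix X assume "X \<in> range (\<lambda>a::real. {..a})"
  then obtain a where a: "X = {..a}" by auto
  have "emeasure (density lborel (\<lambda>s. ennreal pi * indicator {0..} s)) {..a} = (\<integral>\<^sup>+ s. ennreal pi * indicator {0..a} s \<partial>lborel)"
    by (subst emeasure_density) (auto intro!: nn_integral_cong simp: indicator_def)
  also have "\<dots> = ennreal pi * emeasure lborel {0..a}"
    by (rule nn_integral_cmult_indicator) simp
  also have "\<dots> = ennreal (pi * max 0 a)"
    by (cases "a \<ge> 0") (auto simp: ennreal_mult')
  finally show "emeasure (distr lborel borel (\<lambda>x::real^2. (norm x)\<^sup>2)) X = emeasure (density lborel (\<lambda>s. ennreal pi * indicator {0..} s)) X"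
    unfolding a main by simp
qed auto

lemma nn_integral_radial:
  assumes [measurable]: "f \<in> borel_measurable borel"
  shows "(\<integral>\<^sup>+ x. f (sq_dist a x) \<partial>lborel) = (\<integral>\<^sup>+ s. ennreal pi * indicator {0..} s * f s \<partial>lborel)"
proof -
  have "(\<integral>\<^sup>+ x. f ((norm (x - a))\<^sup>2) \<partial>lborel) = (\<integral>\<^sup>+ x. f ((norm (x - a))\<^sup>2) \<partial>distr lborel borel ((+) a))"
    by (simp add: lborel_distr_plus)
  also have "\<dots> = nn_integral lborel (\<lambda>x::real^2. f ((norm x)\<^sup>2))"
    by (subst nn_integral_distr) auto
  also have "\<dots> = (\<integral>\<^sup>+ s. f s \<partial>distr lborel borel (\<lambda>x::real^2. (norm x)\<^sup>2))"
    by (subst nn_integral_distr) auto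
  also have "\<dots> = (\<integral>\<^sup>+ s. ennreal pi * indicator {0..} s * f s \<partial>lborel)"
    unfolding distr_sq_norm_lborel by (subst nn_integral_density) auto
  finally show ?thesis by (simp add: sq_dist_def)
qed

lemma integral_radial:
  fixes f :: "real \<Rightarrow> complex"
  assumes [measurable]: "f \<in> borel_measurable borel"
  shows "(LINT x|lborel. f (sq_dist a x)) = of_real pi * (LINT s|lborel. indicator {0..} s *\<^sub>R f s)"
proof -
  have "(LINT x|lborel. f ((norm (x - a))\<^sup>2)) = (LINT x|distr lborel borel ((+) a). f ((norm (x - a))\<^sup>2))"
    by (simp add: lborel_distr_plus)
  also have "\<dots> = (LINT x::real^2|lborel. f ((norm x)\<^sup>2))"
    by (subst integral_distr) auto
  also have "\<dots> = (LINT s|distr lborel borel (\<lambda>x::real^2. (norm x)\<^sup>2). f s)"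
    by (subst integral_distr) auto
  also have "\<dots> = (LINT s|density lborel (\<lambda>s. ennreal (pi * indicator {0..} s)). f s)"
    unfolding distr_sq_norm_lborel by (simp add: ennreal_mult' ennreal_indicator)
  also have "\<dots> = (LINT s|lborel. (pi * indicator {0..} s) *\<^sub>R f s)"
    by (rule integral_density) auto
  also have "\<dots> = (LINT s|lborel. of_real pi * (indicator {0..} s *\<^sub>R f s))"
    by (intro Bochner_Integration.integral_cong) (auto simp: scaleR_conv_of_real)
  also have "\<dots> = of_real pi * (LINT s|lborel. indicator {0..} s *\<^sub>R f s)"
    by (rule integral_mult_right_zero)
  finally show ?thesis by (simp add: sq_dist_def)
qed

section \<open>Square integrable functions on small and large discs\<close>

definition square_integrable :: "(real^2 \<Rightarrow> complex) \<Rightarrow> bool" where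
  "square_integrable f \<longleftrightarrow> f \<in> borel_measurable borel \<and> integrable lborel (\<lambda>x. (norm (f x))\<^sup>2)"

text \<open>
  The radius is doubled because the cutoffs of radius \<open>\<rho>\<close> used below live on this disc.
\<close>

definition mass :: "(real^2 \<Rightarrow> complex) \<Rightarrow> real^2 \<Rightarrow> real \<Rightarrow> real" where
  "mass f a \<rho> = (LINT x|lborel. indicator (cball a (2 * \<rho>)) x * norm (f x))"

lemma integrable_indicator_cball: "integrable lborel (indicator (cball (a::real^2) r) :: real^2 \<Rightarrow> real)"
  by (intro integrable_real_indicator emeasure_lborel_cball_finite) auto

lemma integral_indicator_cball: "r \<ge> 0 \<Longrightarrow> (LINT x|lborel. indicator (cball (a::real^2) r) x) = pi * r\<^sup>2"
  by (simp add: measure_def emeasure_cball unit_ball_vol_2)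

lemma amgm_weighted: "l > 0 \<Longrightarrow> t \<le> (l * t\<^sup>2 + 1 / l) / (2::real)"
proof -
  assume l: "l > 0"
  have "0 \<le> (l * t - 1)\<^sup>2 / l" using l by simp
  also have "\<dots> = l * t\<^sup>2 - 2 * t + 1 / l" using l by (simp add: power2_diff power_mult_distrib field_simps power2_eq_square)
  finally show ?thesis by simp
qed

lemma square_integrableD:
  assumes "square_integrable f"
  shows "f \<in> borel_measurable borel" "integrable lborel (\<lambda>x. (norm (f x))\<^sup>2)"
    "(\<lambda>x. indicator (cball a r) x * norm (f x)) \<in> borel_measurable lborel"
    "integrable lborel (\<lambda>x. indicator (cball a r) x * (norm (f x))\<^sup>2)"
proof -
  show m: "f \<in> borel_measurable borel" and i: "integrable lborel (\<lambda>x. (norm (f x))\<^sup>2)"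
    using assms by (auto simp: square_integrable_def)
  have "(\<lambda>x. norm (f x)) \<in> borel_measurable lborel" using m by simp
  then show "(\<lambda>x. indicator (cball a r) x * norm (f x)) \<in> borel_measurable lborel"
    by (intro borel_measurable_times borel_measurable_indicator) auto
  show "integrable lborel (\<lambda>x. indicator (cball a r) x * (norm (f x))\<^sup>2)"
    using integrable_mult_indicator[OF _ i, of "cball a r"] by simp
qed

lemma mass_integrable:
  assumes "square_integrable f"
  shows "integrable lborel (\<lambda>x. indicator (cball a r) x * norm (f x))"
proof (rule Bochner_Integration.integrable_bound)
  show "integrable lborel (\<lambda>x. (norm (f x))\<^sup>2 + indicator (cball a r) x)"
    using assms unfolding square_integrable_def by (intro Bochner_Integration.integrable_add integrable_indicator_cball) auto
  show "(\<lambda>x. indicator (cball a r) x * norm (f x)) \<in> borel_measurable lborel"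
    by (rule square_integrableD(3)[OF assms])
  show "AE x in lborel. norm (indicator (cball a r) x * norm (f x)) \<le> norm ((norm (f x))\<^sup>2 + indicator (cball a r) x)"
  proof (intro always_eventually allI)
    fix x
    have "norm (f x) * 2 \<le> (norm (f x))\<^sup>2 + 1" using amgm_weighted[of 1 "norm (f x)"] by simp
    moreover have "norm (f x) \<le> norm (f x) * 2" by simp
    ultimately have "norm (f x) \<le> (norm (f x))\<^sup>2 + 1" by (rule order.trans[rotated])
    then show "norm (indicator (cball a r) x * norm (f x)) \<le> norm ((norm (f x))\<^sup>2 + indicator (cball a r) x)"
      by (simp add: indicator_def)
  qed
qed

lemma mass_nonneg: "mass f a \<rho> \<ge> 0"
  unfolding mass_def by (intro Bochner_Integration.integral_nonneg) auto

text \<open>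
  The Cauchy-Schwarz inequality in additive form, with a weight \<open>l\<close> to be optimised.
\<close>

lemma mass_weighted_bound:
  assumes f: "square_integrable f" and "l > 0" "\<rho> \<ge> 0"
  shows "mass f a \<rho> \<le> (l * (LINT x|lborel. indicator (cball a (2 * \<rho>)) x * (norm (f x))\<^sup>2) + 4 * pi * \<rho>\<^sup>2 / l) / 2"
proof -
  let ?B = "cball a (2 * \<rho>)"
  have i2: "integrable lborel (\<lambda>x. indicator ?B x * (norm (f x))\<^sup>2)"
    by (rule square_integrableD(4)[OF f])
  have "mass f a \<rho> \<le> (LINT x|lborel. (l * (indicator ?B x * (norm (f x))\<^sup>2) + (1 / l) * indicator ?B x) / 2)"
    unfolding mass_def
  proof (rule integral_mono[OF mass_integrable[OF f]])
    show "integrable lborel (\<lambda>x. (l * (indicator ?B x * (norm (f x))\<^sup>2) + (1 / l) * indicator ?B x) / 2)"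
      by (intro integrable_divide Bochner_Integration.integrable_add integrable_mult_right i2 integrable_indicator_cball)
    show "indicator ?B x * norm (f x) \<le> (l * (indicator ?B x * (norm (f x))\<^sup>2) + (1 / l) * indicator ?B x) / 2" for x
      using amgm_weighted[OF \<open>l > 0\<close>, of "norm (f x)"] by (simp add: indicator_def)
  qed
  also have "\<dots> = (l * (LINT x|lborel. indicator ?B x * (norm (f x))\<^sup>2) + (1 / l) * (pi * (2 * \<rho>)\<^sup>2)) / 2"
    using i2 integrable_indicator_cball[of a "2 * \<rho>"] integral_indicator_cball[of "2 * \<rho>" a] \<open>\<rho> \<ge> 0\<close>
    by (simp only: integral_divide_zero integral_mult_right_zero Bochner_Integration.integral_add integrable_mult_right)
  finally show ?thesis by (simp add: power_mult_distrib mult_ac)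
qed

text \<open>
  By Cauchy-Schwarz the mass is at most \<open>\<rho>\<close> times the \<open>L\<^sup>2\<close> norm of \<open>f\<close> on the disc (up to a constant), and
  this norm tends to 0. The gain over the trivial \<open>O(\<rho>)\<close> makes the logarithmic and gradient errors
  at the poles disappear.
\<close>

lemma mass_over_radius_tendsto_0:
  assumes f: "square_integrable f" and d: "\<And>n. \<delta> n > 0" "\<delta> \<longlonglongrightarrow> 0"
  shows "(\<lambda>n. mass f a (\<delta> n) / \<delta> n) \<longlonglongrightarrow> 0"
proof -
  let ?m = "\<lambda>n. LINT x|lborel. indicator (cball a (2 * \<delta> n)) x * (norm (f x))\<^sup>2"
  have "?m \<longlonglongrightarrow> (LINT x::real^2|lborel. 0)"
  proof (rule integral_dominated_convergence)
    show "integrable lborel (\<lambda>x. (norm (f x))\<^sup>2)" using f by (simp add: square_integrable_def)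
    show "(\<lambda>x. indicator (cball a (2 * \<delta> n)) x * (norm (f x))\<^sup>2) \<in> borel_measurable lborel" for n
      using square_integrableD(4)[OF f] by auto
    show "AE x in lborel. norm (indicator (cball a (2 * \<delta> n)) x * (norm (f x))\<^sup>2) \<le> (norm (f x))\<^sup>2" for n
      by (intro always_eventually allI) (simp add: indicator_def)
    have "AE x in lborel. x \<noteq> a" by (rule AE_lborel_singleton)
    then show "AE x in lborel. (\<lambda>n. indicator (cball a (2 * \<delta> n)) x * (norm (f x))\<^sup>2) \<longlonglongrightarrow> 0"
    proof eventually_elim
      case (elim x)
      have "(\<lambda>n. 2 * \<delta> n) \<longlonglongrightarrow> 0" using tendsto_mult_right_zero[OF d(2)] .
      then have "\<forall>\<^sub>F n in sequentially. 2 * \<delta> n < dist a x" by (rule order_tendstoD(2)) (use elim in auto)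
      then have "\<forall>\<^sub>F n in sequentially. 0 = indicator (cball a (2 * \<delta> n)) x * (norm (f x))\<^sup>2"
        by eventually_elim auto
      then show ?case by (rule Lim_transform_eventually[OF tendsto_const])
    qed
  qed auto
  then have m: "?m \<longlonglongrightarrow> 0" by simp
  show ?thesis
  proof (rule LIMSEQ_I)
    fix e :: real assume e: "e > 0"
    define L where "L = 4 * pi / e"
    have L: "L > 0" using e by (simp add: L_def)
    have "\<forall>\<^sub>F n in sequentially. ?m n < e / L" by (rule order_tendstoD(2)[OF m]) (use e L in auto)
    then obtain N where N: "\<And>n. n \<ge> N \<Longrightarrow> ?m n < e / L" by (auto simp: eventually_sequentially)
    have "norm (mass f a (\<delta> n) / \<delta> n - 0) < e" if "n \<ge> N" for n
    proof -
      \<comment> \<open>The weight \<open>\<delta> L\<close> makes the area term equal to \<open>e \<delta>\<close>; the other term is smaller eventually.\<close>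
      have "mass f a (\<delta> n) \<le> (\<delta> n * L * ?m n + 4 * pi * (\<delta> n)\<^sup>2 / (\<delta> n * L)) / 2"
        by (rule mass_weighted_bound[OF f]) (use d(1)[of n] L in auto)
      also have "4 * pi * (\<delta> n)\<^sup>2 / (\<delta> n * L) = \<delta> n * e"
        using d(1)[of n] e by (simp add: L_def power2_eq_square)
      also have "(\<delta> n * L * ?m n + \<delta> n * e) / 2 < \<delta> n * e"
      proof -
        have "L * ?m n < e" using N[OF that] L by (simp add: field_simps)
        then have "\<delta> n * (L * ?m n) < \<delta> n * e" using d(1)[of n] by (intro mult_strict_left_mono) auto
        then show ?thesis by (simp add: mult_ac)
      qed
      finally have "mass f a (\<delta> n) / \<delta> n < e" using d(1)[of n] by (simp add: field_simps)
      then show ?thesis using mass_nonneg[of f a "\<delta> n"] d(1)[of n] by simp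
    qed
    then show "\<exists>no. \<forall>n\<ge>no. norm (mass f a (\<delta> n) / \<delta> n - 0) < e" by blast
  qed
qed

lemma mass_growth:
  assumes f: "square_integrable f"
  obtains C where "C > 0" "\<And>\<rho>. \<rho> \<ge> 1 \<Longrightarrow> mass f a \<rho> \<le> C * \<rho>\<^sup>2"
proof -
  let ?I = "LINT x|lborel. (norm (f x))\<^sup>2"
  have I0: "?I \<ge> 0" by simp
  show ?thesis
  proof (rule that[of "?I + 2 * pi"])
    show "?I + 2 * pi > 0" using I0 pi_gt_zero by linarith
    fix \<rho> :: real assume r: "\<rho> \<ge> 1"
    have "(LINT x|lborel. indicator (cball a (2 * \<rho>)) x * (norm (f x))\<^sup>2) \<le> ?I"
      by (rule integral_mono)
        (use square_integrableD[OF f] in \<open>auto simp: indicator_def\<close>)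
    then have "mass f a \<rho> \<le> (1 * ?I + 4 * pi * \<rho>\<^sup>2 / 1) / 2"
      using mass_weighted_bound[OF f, of 1 \<rho> a] r by simp
    also have "\<dots> \<le> ?I * 1 + 2 * pi * \<rho>\<^sup>2" using I0 by simp
    also have "\<dots> \<le> ?I * \<rho>\<^sup>2 + 2 * pi * \<rho>\<^sup>2" using r I0 by (intro add_right_mono mult_left_mono) auto
    finally show "mass f a \<rho> \<le> (?I + 2 * pi) * \<rho>\<^sup>2" by (simp add: algebra_simps)
  qed
qed

lemma integral_kernel_bound:
  fixes k :: "real^2 \<Rightarrow> complex"
  assumes f: "square_integrable f" and k: "k \<in> borel_measurable borel"
    and b: "\<And>x. x \<in> cball a (2 * \<rho>) \<Longrightarrow> norm (k x) \<le> B" and z: "\<And>x. x \<notin> cball a (2 * \<rho>) \<Longrightarrow> k x = 0"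
  shows "integrable lborel (\<lambda>x. k x * f x)"
    and "norm (LINT x|lborel. k x * f x) \<le> B * mass f a \<rho>"
proof -
  have le: "norm (k x * f x) \<le> B * (indicator (cball a (2 * \<rho>)) x * norm (f x))" for x
    using b[of x] z[of x] by (cases "x \<in> cball a (2 * \<rho>)") (auto simp: norm_mult intro: mult_right_mono)
  show "integrable lborel (\<lambda>x. k x * f x)"
  proof (rule Bochner_Integration.integrable_bound[OF integrable_mult_right[OF mass_integrable[OF f, of a "2 * \<rho>"], of B]])
    show "(\<lambda>x. k x * f x) \<in> borel_measurable lborel"
      using square_integrableD(1)[OF f] k by simp
  qed (use le in \<open>auto intro: order.trans[OF _ abs_ge_self]\<close>)
  then have "norm (LINT x|lborel. k x * f x) \<le> (LINT x|lborel. B * (indicator (cball a (2 * \<rho>)) x * norm (f x)))"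
    by (rule Bochner_Integration.integral_norm_bound_integral[OF _ integrable_mult_right[OF mass_integrable[OF f]] le])
  then show "norm (LINT x|lborel. k x * f x) \<le> B * mass f a \<rho>"
    unfolding mass_def integral_mult_right_zero .
qed

lemma integrable_compact_kernel:
  fixes k :: "real^2 \<Rightarrow> complex"
  assumes f: "square_integrable f" and k: "continuous_on UNIV k" and K: "compact K" "\<And>x. x \<notin> K \<Longrightarrow> k x = 0"
  shows "integrable lborel (\<lambda>x. k x * f x)"
proof -
  obtain R where R: "\<And>x. x \<in> K \<Longrightarrow> norm x \<le> R" using compact_imp_bounded[OF K(1)] by (auto simp: bounded_iff)
  have "bounded (k ` cball 0 R)" by (intro compact_imp_bounded compact_continuous_image continuous_on_subset[OF k]) auto
  then obtain B where "\<forall>x\<in>cball 0 R. norm (k x) \<le> B" by (auto simp: bounded_iff)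
  then show ?thesis
    by (intro integral_kernel_bound(1)[OF f borel_measurable_continuous_onI[OF k], of 0 "R / 2" B])
      (use R K(2) in auto)
qed

section \<open>The weak Helmholtz equation\<close>

definition weak_helmholtz :: "(real^2) set \<Rightarrow> complex \<Rightarrow> (real^2 \<Rightarrow> complex) \<Rightarrow> bool" where
  "weak_helmholtz X z f \<longleftrightarrow> (\<forall>\<phi>\<in>test_functions (- X).
     (LINT x|lborel. laplacian \<phi> x *\<^sub>R f x) = - z * (LINT x|lborel. \<phi> x *\<^sub>R f x))"

lemma laplacian_linear:
  assumes L: "bounded_linear L" and f: "smooth_on UNIV f"
  shows "laplacian (\<lambda>x. L (f x)) x = L (laplacian f x)"
proof -
  have "vpartial i (\<lambda>x. L (f x)) = (\<lambda>x. L (vpartial i f x))" for i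
    by (intro ext vpartial_linear[OF L smooth_on_differentiable[OF f]]) simp
  then show ?thesis
    by (simp add: laplacian_def vpartial_linear[OF L smooth_on_differentiable[OF smooth_on_vpartial[OF f]]] linear_sum[OF bounded_linear.linear[OF L]])
qed

lemma laplacian_cont: "smooth_on U f \<Longrightarrow> x \<in> U \<Longrightarrow> isCont (laplacian f) x"
  unfolding laplacian_def[abs_def]
  by (intro isCont_sum ballI) (rule smooth_on_isCont[OF smooth_on_vpartial[OF smooth_on_vpartial]])

lemma laplacian_zero_off_compact:
  assumes "compact K" "\<And>x. x \<notin> K \<Longrightarrow> f x = 0" "x \<notin> K"
  shows "laplacian f x = 0"
  unfolding laplacian_def
  by (intro sum.neutral ballI vpartial_zero_off_compact[OF assms(1) vpartial_zero_off_compact[OF assms(1,2)] assms(3)]) auto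

text \<open>
  The weak equation extends from real to complex test functions through real and imaginary parts.
\<close>

lemma weak_helmholtz_complex:
  assumes w: "weak_helmholtz X z f" and f: "square_integrable f"
    and s: "smooth_on UNIV \<Phi>" and K: "compact K" "K \<subseteq> - X" "\<And>x. x \<notin> K \<Longrightarrow> \<Phi> x = (0::complex)"
  shows "(LINT x|lborel. (laplacian \<Phi> x + z * \<Phi> x) * f x) = 0"
proof -
  have ULap: "continuous_on UNIV (laplacian \<Phi>)"
    using laplacian_cont[OF s] by (auto intro: continuous_at_imp_continuous_on)
  have UPhi: "continuous_on UNIV \<Phi>" using smooth_on_isCont[OF s] by (auto intro: continuous_at_imp_continuous_on)
  have part: "(LINT x|lborel. of_real (L (laplacian \<Phi> x)) * f x) + z * (LINT x|lborel. of_real (L (\<Phi> x)) * f x) = 0"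
    and iL: "integrable lborel (\<lambda>x. of_real (L (laplacian \<Phi> x)) * f x)"
    and iP: "integrable lborel (\<lambda>x. of_real (L (\<Phi> x)) * f x)"
    if L: "bounded_linear L" for L :: "complex \<Rightarrow> real"
  proof -
    have L0: "L 0 = 0" using bounded_linear.linear[OF L] by (simp add: linear_0)
    have "(\<lambda>x. L (\<Phi> x)) \<in> test_functions (- X)"
      by (rule test_functionI[OF smooth_on_linear[OF _ L s] K(1,2)]) (auto simp: K(3) L0)
    then have "(LINT x|lborel. laplacian (\<lambda>x. L (\<Phi> x)) x *\<^sub>R f x) = - z * (LINT x|lborel. L (\<Phi> x) *\<^sub>R f x)"
      using w unfolding weak_helmholtz_def by blast
    then show "(LINT x|lborel. of_real (L (laplacian \<Phi> x)) * f x) + z * (LINT x|lborel. of_real (L (\<Phi> x)) * f x) = 0"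
      by (simp add: laplacian_linear[OF L s] scaleR_conv_of_real)
    show "integrable lborel (\<lambda>x. of_real (L (laplacian \<Phi> x)) * f x)"
      by (rule integrable_compact_kernel[OF f _ K(1)])
        (auto intro!: continuous_intros bounded_linear.continuous_on[OF L] ULap simp: laplacian_zero_off_compact[OF K(1,3)] L0)
    show "integrable lborel (\<lambda>x. of_real (L (\<Phi> x)) * f x)"
      by (rule integrable_compact_kernel[OF f _ K(1)])
        (auto intro!: continuous_intros bounded_linear.continuous_on[OF L] UPhi simp: K(3) L0)
  qed
  note R = part[OF bounded_linear_Re] iL[OF bounded_linear_Re] iP[OF bounded_linear_Re]
  note I = part[OF bounded_linear_Im] iL[OF bounded_linear_Im] iP[OF bounded_linear_Im]
  have "(LINT x|lborel. (laplacian \<Phi> x + z * \<Phi> x) * f x) =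
    (LINT x|lborel. (of_real (Re (laplacian \<Phi> x)) * f x + z * (of_real (Re (\<Phi> x)) * f x))
       + \<i> * (of_real (Im (laplacian \<Phi> x)) * f x + z * (of_real (Im (\<Phi> x)) * f x)))"
  proof (intro Bochner_Integration.integral_cong refl)
    fix x
    have "(a + z * b) * c = ((of_real (Re a) * c + z * (of_real (Re b) * c)) + \<i> * (of_real (Im a) * c + z * (of_real (Im b) * c)))" for a b c
      by (subst (1) complex_eq[of a], subst (1) complex_eq[of b]) (simp add: algebra_simps)
    then show "(laplacian \<Phi> x + z * \<Phi> x) * f x = (of_real (Re (laplacian \<Phi> x)) * f x + z * (of_real (Re (\<Phi> x)) * f x))
       + \<i> * (of_real (Im (laplacian \<Phi> x)) * f x + z * (of_real (Im (\<Phi> x)) * f x))" .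
  qed
  also have "\<dots> = ((LINT x|lborel. of_real (Re (laplacian \<Phi> x)) * f x) + z * (LINT x|lborel. of_real (Re (\<Phi> x)) * f x))
      + \<i> * ((LINT x|lborel. of_real (Im (laplacian \<Phi> x)) * f x) + z * (LINT x|lborel. of_real (Im (\<Phi> x)) * f x))"
    using R(2,3) I(2,3) by (simp only: Bochner_Integration.integral_add integral_mult_right_zero integrable_mult_right Bochner_Integration.integrable_add)
  also have "\<dots> = 0" unfolding R(1) I(1) by simp
  finally show ?thesis .
qed

section \<open>Commutators of the Laplacian with cutoff functions\<close>

text \<open>
  Equal to 1 for \<open>|x - a| \<le> \<rho>\<close> and to 0 for \<open>|x - a| \<ge> \<surd>2 \<rho>\<close>. All derivatives live on the \<open>annulus\<close> between
  these circles, which is contained in the disc of radius \<open>2 \<rho>\<close>. Comments below denote it by \<open>\<chi>\<close>.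
\<close>

definition disc_cutoff :: "real^2 \<Rightarrow> real \<Rightarrow> real^2 \<Rightarrow> real" where
  "disc_cutoff a \<rho> x = cutoff (sq_dist a x / \<rho>\<^sup>2)"

definition annulus :: "real^2 \<Rightarrow> real \<Rightarrow> (real^2) set" where
  "annulus a \<rho> = {x. \<rho>\<^sup>2 \<le> sq_dist a x \<and> sq_dist a x \<le> 2 * \<rho>\<^sup>2}"

lemma sq_dist_cont: "continuous_on UNIV (sq_dist a)"
  unfolding sq_dist_def[abs_def] by (intro continuous_intros)

lemma sq_dist_le_imp_cball:
  assumes "sq_dist a x \<le> 2 * \<rho>\<^sup>2" "\<rho> \<ge> 0"
  shows "x \<in> cball a (2 * \<rho>)"
proof -
  have "2 * \<rho>\<^sup>2 \<le> (2 * \<rho>)\<^sup>2" by (simp add: power_mult_distrib)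
  then have "(norm (x - a))\<^sup>2 \<le> (2 * \<rho>)\<^sup>2" using assms(1) unfolding sq_dist_def by linarith
  then have "norm (x - a) \<le> 2 * \<rho>" by (rule power2_le_imp_le) (use assms in simp)
  then show ?thesis by (simp add: dist_norm norm_minus_commute)
qed

lemma compact_sq_dist_between: "compact {x. r \<le> sq_dist a x \<and> sq_dist a x \<le> 2 * \<rho>\<^sup>2}"
proof -
  have "closed {x. r \<le> sq_dist a x \<and> sq_dist a x \<le> 2 * \<rho>\<^sup>2}"
    by (intro closed_Collect_conj closed_Collect_le sq_dist_cont continuous_on_const)
  moreover have "{x. r \<le> sq_dist a x \<and> sq_dist a x \<le> 2 * \<rho>\<^sup>2} \<subseteq> cball a (2 * \<bar>\<rho>\<bar>)"
    using sq_dist_le_imp_cball[of a _ "\<bar>\<rho>\<bar>"] by auto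
  ultimately show ?thesis using compact_eq_bounded_closed bounded_subset[OF bounded_cball] by blast
qed

lemma compact_annulus: "compact (annulus a \<rho>)"
  unfolding annulus_def by (rule compact_sq_dist_between)

lemma annulus_subset_cball: "\<rho> \<ge> 0 \<Longrightarrow> annulus a \<rho> \<subseteq> cball a (2 * \<rho>)"
  using sq_dist_le_imp_cball by (auto simp: annulus_def)

lemma smooth_disc_cutoff: "smooth_on UNIV (disc_cutoff a \<rho>)"
proof -
  have "smooth_on UNIV (\<lambda>x. inverse (\<rho>\<^sup>2) *\<^sub>R sq_dist a x)"
    by (intro smooth_on_linear[OF _ bounded_linear_scaleR_right] smooth_on_sq_dist) auto
  then have "smooth_on UNIV (\<lambda>x. sq_dist a x / \<rho>\<^sup>2)" by (simp add: divide_inverse mult.commute)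
  then show ?thesis unfolding disc_cutoff_def[abs_def] by (intro smooth_on_cutoff) auto
qed

lemma cutoff_scaled_deriv:
  assumes "\<rho> > 0"
  shows "((\<lambda>s. cutoff (s / \<rho>\<^sup>2)) has_vector_derivative cutoff1 (s / \<rho>\<^sup>2) / \<rho>\<^sup>2) (at s)"
    and "((\<lambda>s. cutoff1 (s / \<rho>\<^sup>2) / \<rho>\<^sup>2) has_vector_derivative cutoff2 (s / \<rho>\<^sup>2) / \<rho>\<^sup>2 / \<rho>\<^sup>2) (at s)"
proof -
  have l: "((\<lambda>s. s / \<rho>\<^sup>2) has_real_derivative 1 / \<rho>\<^sup>2) (at s)" by (rule DERIV_cdivide[OF DERIV_ident])
  show "((\<lambda>s. cutoff (s / \<rho>\<^sup>2)) has_vector_derivative cutoff1 (s / \<rho>\<^sup>2) / \<rho>\<^sup>2) (at s)"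
    using DERIV_chain2[OF cutoff_deriv l] by (simp add: has_real_derivative_iff_has_vector_derivative)
  show "((\<lambda>s. cutoff1 (s / \<rho>\<^sup>2) / \<rho>\<^sup>2) has_vector_derivative cutoff2 (s / \<rho>\<^sup>2) / \<rho>\<^sup>2 / \<rho>\<^sup>2) (at s)"
    unfolding has_real_derivative_iff_has_vector_derivative[symmetric]
    by (rule DERIV_cong[OF DERIV_cdivide[OF DERIV_chain2[OF cutoff1_deriv l]]]) simp
qed

lemma vpartial_disc_cutoff:
  "\<rho> > 0 \<Longrightarrow> vpartial i (disc_cutoff a \<rho>) x = 2 * (x - a) $ i * (cutoff1 (sq_dist a x / \<rho>\<^sup>2) / \<rho>\<^sup>2)"
  unfolding disc_cutoff_def[abs_def]
  by (subst vpartial_compose_real[OF cutoff_scaled_deriv(1) smooth_on_differentiable[OF smooth_on_sq_dist[OF open_UNIV]]])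
    (auto simp: vpartial_sq_dist)

lemma laplacian_disc_cutoff:
  "\<rho> > 0 \<Longrightarrow> laplacian (disc_cutoff a \<rho>) x
     = 4 * (cutoff1 (sq_dist a x / \<rho>\<^sup>2) / \<rho>\<^sup>2 + sq_dist a x * (cutoff2 (sq_dist a x / \<rho>\<^sup>2) / \<rho>\<^sup>2 / \<rho>\<^sup>2))"
  unfolding disc_cutoff_def[abs_def]
  by (subst laplacian_radial[OF open_UNIV UNIV_I cutoff_scaled_deriv]) auto

lemma disc_cutoff_values:
  assumes "\<rho> > 0"
  shows "sq_dist a x \<le> \<rho>\<^sup>2 \<Longrightarrow> disc_cutoff a \<rho> x = 1" "sq_dist a x \<ge> 2 * \<rho>\<^sup>2 \<Longrightarrow> disc_cutoff a \<rho> x = 0"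
    "x \<notin> annulus a \<rho> \<Longrightarrow> vpartial i (disc_cutoff a \<rho>) x = 0" "x \<notin> annulus a \<rho> \<Longrightarrow> laplacian (disc_cutoff a \<rho>) x = 0"
proof -
  have r: "\<rho>\<^sup>2 > 0" using assms by simp
  show "sq_dist a x \<le> \<rho>\<^sup>2 \<Longrightarrow> disc_cutoff a \<rho> x = 1" "sq_dist a x \<ge> 2 * \<rho>\<^sup>2 \<Longrightarrow> disc_cutoff a \<rho> x = 0"
    unfolding disc_cutoff_def using r by (auto intro!: cutoff_eq_1 cutoff_eq_0 simp: field_simps)
  have c: "cutoff1 (sq_dist a x / \<rho>\<^sup>2) = 0 \<and> cutoff2 (sq_dist a x / \<rho>\<^sup>2) = 0" if "x \<notin> annulus a \<rho>"
  proof -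
    have "sq_dist a x / \<rho>\<^sup>2 \<notin> {1<..<2}" using that r by (auto simp: annulus_def field_simps)
    then show ?thesis using cutoff_props by blast
  qed
  show "x \<notin> annulus a \<rho> \<Longrightarrow> vpartial i (disc_cutoff a \<rho>) x = 0" "x \<notin> annulus a \<rho> \<Longrightarrow> laplacian (disc_cutoff a \<rho>) x = 0"
    using c assms by (simp_all add: vpartial_disc_cutoff laplacian_disc_cutoff)
qed

text \<open>
  Scaling: every derivative costs a factor \<open>1/\<rho>\<close>.
\<close>

lemma disc_cutoff_bounds:
  obtains M where "M \<ge> 1" "\<And>a \<rho> x. \<rho> > 0 \<Longrightarrow> \<bar>disc_cutoff a \<rho> x\<bar> \<le> M"
    "\<And>a \<rho> x i. \<rho> > 0 \<Longrightarrow> \<bar>vpartial i (disc_cutoff a \<rho>) x\<bar> \<le> M / \<rho>"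
    "\<And>a \<rho> x. \<rho> > 0 \<Longrightarrow> \<bar>laplacian (disc_cutoff a \<rho>) x\<bar> \<le> M / \<rho>\<^sup>2"
    "\<And>s. \<bar>cutoff1 s\<bar> \<le> M"
proof -
  obtain M where M: "M \<ge> 1" "\<And>s. \<bar>cutoff s\<bar> \<le> M" "\<And>s. \<bar>cutoff1 s\<bar> \<le> M" "\<And>s. \<bar>cutoff2 s\<bar> \<le> M"
    using cutoff_bounds by metis
  show ?thesis
  \<comment> \<open>The Laplacian is 4 times a sum bounded by \<open>M / \<rho>\<^sup>2 + 2 M / \<rho>\<^sup>2\<close>.\<close>
  proof (rule that[of "12 * M"])
    show "12 * M \<ge> 1" "\<bar>cutoff1 s\<bar> \<le> 12 * M" for s using M(1) M(3)[of s] by auto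
    fix a x :: "real^2" and \<rho> :: real and i assume r: "\<rho> > 0"
    have M0: "M \<ge> 0" using M(1) by simp
    show "\<bar>disc_cutoff a \<rho> x\<bar> \<le> 12 * M" using M(1) M(2)[of "sq_dist a x / \<rho>\<^sup>2"] by (simp add: disc_cutoff_def)
    let ?s = "sq_dist a x" and ?c1 = "cutoff1 (sq_dist a x / \<rho>\<^sup>2)" and ?c2 = "cutoff2 (sq_dist a x / \<rho>\<^sup>2)"
    show "\<bar>vpartial i (disc_cutoff a \<rho>) x\<bar> \<le> 12 * M / \<rho>"
    proof (cases "x \<in> annulus a \<rho>")
      case True
      have "\<bar>(x - a) $ i\<bar> \<le> norm (x - a)" by (rule component_le_norm_cart)
      also have "\<dots> \<le> 2 * \<rho>" using annulus_subset_cball[of \<rho> a] True r by (auto simp: dist_norm norm_minus_commute)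
      finally have "\<bar>2 * (x - a) $ i\<bar> * (\<bar>?c1\<bar> / \<rho>\<^sup>2) \<le> (4 * \<rho>) * (M / \<rho>\<^sup>2)"
        using M(3) r by (intro mult_mono divide_right_mono) (auto simp: abs_mult)
      also have "\<dots> = 4 * M / \<rho>" using r by (simp add: power2_eq_square)
      also have "\<dots> \<le> 12 * M / \<rho>" using M0 r by (intro divide_right_mono) auto
      finally show ?thesis unfolding vpartial_disc_cutoff[OF r] by (simp add: abs_mult)
    next
      case False
      then show ?thesis using disc_cutoff_values(3)[OF r] M0 r by simp
    qed
    show "\<bar>laplacian (disc_cutoff a \<rho>) x\<bar> \<le> 12 * M / \<rho>\<^sup>2"
    proof (cases "x \<in> annulus a \<rho>")
      case True
      then have s: "0 \<le> ?s" "?s \<le> 2 * \<rho>\<^sup>2" by (auto simp: annulus_def sq_dist_def)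
      have "\<bar>?c1 / \<rho>\<^sup>2 + ?s * (?c2 / \<rho>\<^sup>2 / \<rho>\<^sup>2)\<bar> \<le> \<bar>?c1\<bar> / \<rho>\<^sup>2 + ?s * (\<bar>?c2\<bar> / \<rho>\<^sup>2 / \<rho>\<^sup>2)"
        using s by (intro order.trans[OF abs_triangle_ineq]) (simp add: abs_mult)
      also have "\<dots> \<le> M / \<rho>\<^sup>2 + (2 * \<rho>\<^sup>2) * (M / \<rho>\<^sup>2 / \<rho>\<^sup>2)"
        using s M(3,4) M0 r by (intro add_mono mult_mono divide_right_mono) auto
      also have "\<dots> = 3 * M / \<rho>\<^sup>2"
      proof -
        have "M / q + 2 * q * (M / q / q) = 3 * M / q" if "q \<noteq> 0" for q using that by simp
        from this[of "\<rho>\<^sup>2"] show ?thesis using r by simp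
      qed
      finally show ?thesis unfolding laplacian_disc_cutoff[OF r] abs_mult by simp
    next
      case False
      then show ?thesis using disc_cutoff_values(4)[OF r] M0 r by simp
    qed
  qed
qed

text \<open>
  The commutator \<open>\<Delta>(\<psi> G) - \<psi> \<Delta>G\<close>, which involves derivatives of \<open>\<psi>\<close> only.
\<close>

definition commutator :: "(real^2 \<Rightarrow> real) \<Rightarrow> (real^2 \<Rightarrow> complex) \<Rightarrow> real^2 \<Rightarrow> complex" where
  "commutator \<psi> G x = 2 * (\<Sum>i\<in>UNIV. of_real (vpartial i \<psi> x) * vpartial i G x) + of_real (laplacian \<psi> x) * G x"

lemma commutator_continuous:
  assumes \<psi>: "smooth_on UNIV \<psi>" and G: "smooth_on (- {b}) G"
    and K: "compact K" "b \<notin> K" "\<And>x i. x \<notin> K \<Longrightarrow> vpartial i \<psi> x = 0" "\<And>x. x \<notin> K \<Longrightarrow> laplacian \<psi> x = 0"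
  shows "continuous_on UNIV (commutator \<psi> G)" "x \<notin> K \<Longrightarrow> commutator \<psi> G x = 0"
proof -
  show z: "x \<notin> K \<Longrightarrow> commutator \<psi> G x = 0" for x using K(3,4) by (simp add: commutator_def)
  show "continuous_on UNIV (commutator \<psi> G)"
  proof (rule compactly_supported_isCont[OF K(1) _ z])
    show "K \<subseteq> - {b}" using K(2) by auto
    fix x assume "x \<in> - {b}"
    then show "isCont (commutator \<psi> G) x"
      unfolding commutator_def[abs_def]
      by (intro continuous_intros smooth_on_isCont[OF smooth_on_vpartial[OF \<psi>]] smooth_on_isCont[OF smooth_on_vpartial[OF G]]
          smooth_on_isCont[OF G] laplacian_cont[OF \<psi>]) auto
  qed
qed

lemma commutator_diff:
  assumes "smooth_on UNIV \<psi>1" "smooth_on UNIV \<psi>2"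
  shows "commutator (\<lambda>x. \<psi>1 x - \<psi>2 x) G x = commutator \<psi>1 G x - commutator \<psi>2 G x"
proof -
  have v: "vpartial i (\<lambda>x. f x - g x) x = vpartial i f x - vpartial i g x"
    if "smooth_on UNIV f" "smooth_on UNIV g" for i x and f g :: "real^2 \<Rightarrow> real"
  proof -
    have "f differentiable (at x)" "g differentiable (at x)" using that smooth_on_differentiable by blast+
    from vpartial_eqI[OF has_derivative_diff[OF this[THEN has_derivative_frechet]]] show ?thesis by (simp add: vpartial_def)
  qed
  have "vpartial i (\<lambda>x. \<psi>1 x - \<psi>2 x) = (\<lambda>x. vpartial i \<psi>1 x - vpartial i \<psi>2 x)" for i
    by (intro ext v assms)
  then show ?thesis
    by (simp add: commutator_def laplacian_def v smooth_on_vpartial assms sum_subtractf algebra_simps sum_distrib_left)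
qed

lemma commutator_sum:
  fixes \<psi> :: "'a \<Rightarrow> real^2 \<Rightarrow> real"
  assumes "finite A" "\<And>a. a \<in> A \<Longrightarrow> smooth_on UNIV (\<psi> a)"
  shows "commutator (\<lambda>x. \<Sum>a\<in>A. \<psi> a x) G x = (\<Sum>a\<in>A. commutator (\<psi> a) G x)"
proof -
  have v: "vpartial i (\<lambda>x. \<Sum>a\<in>A. f a x) x = (\<Sum>a\<in>A. vpartial i (f a) x)"
    if "\<And>a. a \<in> A \<Longrightarrow> smooth_on UNIV (f a)" for i x and f :: "'a \<Rightarrow> real^2 \<Rightarrow> real"
  proof -
    have "((\<lambda>x. \<Sum>a\<in>A. f a x) has_derivative (\<lambda>h. \<Sum>a\<in>A. frechet_derivative (f a) (at x) h)) (at x)"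
      by (intro has_derivative_sum has_derivative_frechet smooth_on_differentiable[OF that]) auto
    from vpartial_eqI[OF this] show ?thesis by (simp add: vpartial_def)
  qed
  have v1: "vpartial i (\<lambda>x. \<Sum>a\<in>A. \<psi> a x) = (\<lambda>x. \<Sum>a\<in>A. vpartial i (\<psi> a) x)" for i
    by (intro ext v assms)
  have "vpartial i (\<lambda>x. \<Sum>a\<in>A. vpartial i (\<psi> a) x) x = (\<Sum>a\<in>A. vpartial i (vpartial i (\<psi> a)) x)" for i
    by (rule v) (intro smooth_on_vpartial assms)
  then have L: "laplacian (\<lambda>x. \<Sum>a\<in>A. \<psi> a x) x = (\<Sum>a\<in>A. laplacian (\<psi> a) x)"
    unfolding laplacian_def v1 by (simp add: sum.swap[of _ A])
  have "(\<Sum>i\<in>UNIV. of_real (vpartial i (\<lambda>x. \<Sum>a\<in>A. \<psi> a x) x) * vpartial i G x)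
      = (\<Sum>a\<in>A. \<Sum>i\<in>UNIV. of_real (vpartial i (\<psi> a) x) * vpartial i G x)"
    unfolding v1 of_real_sum sum_distrib_right by (rule sum.swap)
  then show ?thesis
    by (simp add: commutator_def L sum.distrib sum_distrib_left sum_distrib_right)
qed

text \<open>
  The function \<open>\<psi> G\<close> is an admissible test function because \<open>\<psi>\<close> vanishes near the pole \<open>b\<close> of \<open>G\<close>. As \<open>G\<close>
  solves the Helmholtz equation itself, \<open>(\<Delta> + z)(\<psi> G)\<close> is the commutator.
\<close>

lemma helmholtz_commutator_identity:
  assumes w: "weak_helmholtz X z f" and f: "square_integrable f"
    and \<chi>: "smooth_on UNIV \<psi>" and K: "compact K" "K \<subseteq> - X" "b \<notin> K" "\<And>x. x \<notin> K \<Longrightarrow> \<psi> x = 0"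
    and G: "smooth_on (- {b}) G" "\<And>x. x \<noteq> b \<Longrightarrow> laplacian G x = - z * G x"
  shows "(LINT x|lborel. commutator \<psi> G x * f x) = 0"
proof -
  let ?\<Phi> = "\<lambda>x. \<psi> x *\<^sub>R G x"
  have opb: "open (- {b})" and opK: "open (- K)" using compact_imp_closed[OF K(1)] by (simp_all add: open_Compl)
  have "smooth_on (- {b}) ?\<Phi>"
    by (intro smooth_on_bilinear[OF opb bounded_bilinear_scaleR] G smooth_on_subset[OF \<chi>]) auto
  moreover have "smooth_on (- K) ?\<Phi>" by (rule smooth_on_zero_outside[OF opK]) (simp add: K(4))
  ultimately have "smooth_on (- {b} \<union> - K) ?\<Phi>" by (rule smooth_on_Un)
  moreover have "- {b} \<union> - K = UNIV" using K(3) by auto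
  ultimately have s: "smooth_on UNIV ?\<Phi>" by simp
  have "(LINT x|lborel. (laplacian ?\<Phi> x + z * ?\<Phi> x) * f x) = 0"
    by (rule weak_helmholtz_complex[OF w f s K(1,2)]) (simp add: K(4))
  moreover have "laplacian ?\<Phi> x + z * ?\<Phi> x = commutator \<psi> G x" for x
  proof (cases "x = b")
    case False
    then have x: "x \<in> - {b}" by simp
    have "laplacian ?\<Phi> x = \<psi> x *\<^sub>R laplacian G x + 2 *\<^sub>R (\<Sum>i\<in>UNIV. vpartial i \<psi> x *\<^sub>R vpartial i G x) + laplacian \<psi> x *\<^sub>R G x"
      by (rule laplacian_bilinear[OF bounded_bilinear_scaleR opb x smooth_on_subset[OF \<chi>] G(1)]) simp
    then show ?thesis using G(2)[OF False] by (simp add: commutator_def scaleR_conv_of_real algebra_simps)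
  next
    case True
    then have "x \<notin> K" using K(3) by simp
    then show ?thesis
      using laplacian_zero_off_compact[OF K(1), of ?\<Phi> x] laplacian_zero_off_compact[OF K(1), of \<psi> x] vpartial_zero_off_compact[OF K(1), of \<psi> x] K(4)
      by (simp add: commutator_def)
  qed
  ultimately show ?thesis by simp
qed

section \<open>Cutting off the Green function away from its pole\<close>

text \<open>
  The free Green function with pole \<open>b\<close>.
\<close>

definition green :: "complex \<Rightarrow> real^2 \<Rightarrow> real^2 \<Rightarrow> complex" where
  "green w b x = green_profile w (of_real (sq_dist b x))"

lemma sq_dist_pos: "x \<noteq> b \<Longrightarrow> sq_dist b x > 0"
  by (simp add: sq_dist_def)

lemma of_real_not_nonpos: "s > 0 \<Longrightarrow> complex_of_real s \<notin> \<real>\<^sub>\<le>\<^sub>0"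
  by (auto simp: complex_nonpos_Reals_iff)

lemma smooth_on_green: "smooth_on (- {b}) (green w b)"
  unfolding green_def[abs_def] by (rule smooth_on_holomorphic_sq_dist[OF green_profile_holomorphic])

lemma green_profile_real_deriv:
  assumes "s > 0"
  shows "((\<lambda>s. green_profile w (of_real s)) has_vector_derivative green_profile' w (of_real s) / of_real s) (at s)"
    and "((\<lambda>s. green_profile' w (of_real s)) has_vector_derivative - (w\<^sup>2 / 4) * green_profile w (of_real s)) (at s)"
    and "((\<lambda>s. green_profile' w (of_real s) / of_real s) has_vector_derivative
       (- (w\<^sup>2 / 4) * green_profile w (of_real s) * of_real s - green_profile' w (of_real s)) / (of_real s * of_real s)) (at s)"
proof -
  note s = of_real_not_nonpos[OF assms]
  show "((\<lambda>s. green_profile w (of_real s)) has_vector_derivative green_profile' w (of_real s) / of_real s) (at s)"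
    by (rule has_field_derivative_along_reals(3)[OF green_profile_deriv[OF s]])
  show "((\<lambda>s. green_profile' w (of_real s)) has_vector_derivative - (w\<^sup>2 / 4) * green_profile w (of_real s)) (at s)"
    by (rule has_field_derivative_along_reals(3)[OF green_profile_ode[OF s]])
  have "((\<lambda>v. green_profile' w v / v) has_field_derivative
     (- (w\<^sup>2 / 4) * green_profile w (of_real s) * of_real s - green_profile' w (of_real s) * 1) / (of_real s * of_real s)) (at (of_real s))"
    by (rule DERIV_divide[OF green_profile_ode[OF s] DERIV_ident]) (use assms in simp)
  from has_field_derivative_along_reals(3)[OF this]
  show "((\<lambda>s. green_profile' w (of_real s) / of_real s) has_vector_derivative
       (- (w\<^sup>2 / 4) * green_profile w (of_real s) * of_real s - green_profile' w (of_real s)) / (of_real s * of_real s)) (at s)"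
    by simp
qed

lemma vpartial_green:
  assumes "x \<noteq> b"
  shows "vpartial i (green w b) x = of_real (2 * (x - b) $ i) * (green_profile' w (of_real (sq_dist b x)) / of_real (sq_dist b x))"
  unfolding green_def[abs_def]
  by (subst vpartial_compose_real[OF green_profile_real_deriv(1)[OF sq_dist_pos[OF assms]] smooth_on_differentiable[OF smooth_on_sq_dist[OF open_UNIV]]])
    (auto simp: vpartial_sq_dist scaleR_conv_of_real)

lemma laplacian_green:
  assumes "x \<noteq> b"
  shows "laplacian (green w b) x = - w\<^sup>2 * green w b x"
proof -
  note s = sq_dist_pos[OF assms]
  have "laplacian (green w b) x = 4 *\<^sub>R (green_profile' w (of_real (sq_dist b x)) / of_real (sq_dist b x) + sq_dist b x *\<^sub>R
     ((- (w\<^sup>2 / 4) * green_profile w (of_real (sq_dist b x)) * of_real (sq_dist b x) - green_profile' w (of_real (sq_dist b x))) / (of_real (sq_dist b x) * of_real (sq_dist b x))))"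
    unfolding green_def[abs_def]
    by (rule laplacian_radial[where U = "- {b}"])
      (use assms s sq_dist_pos green_profile_real_deriv in \<open>auto simp: open_Compl\<close>)
  also have "\<dots> = - w\<^sup>2 * green w b x"
  proof -
    have "4 *\<^sub>R (q / of_real t + t *\<^sub>R ((- (w\<^sup>2 / 4) * g * of_real t - q) / (of_real t * of_real t))) = - w\<^sup>2 * g"
      if "t \<noteq> 0" for t :: real and q g :: complex
    proof -
      have "T * ((a * T - q) / (T * T)) = a - q / T" if "T \<noteq> 0" for T a :: complex
        using that by (simp add: diff_divide_distrib right_diff_distrib)
      from this[of "of_real t" "- (w\<^sup>2 / 4) * g"]
      have "t *\<^sub>R ((- (w\<^sup>2 / 4) * g * of_real t - q) / (of_real t * of_real t)) = - (w\<^sup>2 / 4) * g - q / of_real t"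
        using that by (simp only: scaleR_conv_of_real of_real_eq_0_iff not_False_eq_True)
      then show ?thesis by (simp add: scaleR_conv_of_real)
    qed
    from this[of "sq_dist b x"] show ?thesis using s unfolding green_def by simp
  qed
  finally show ?thesis .
qed

text \<open>
  The gradient term \<open>2 \<nabla>\<psi> \<cdot> \<nabla>G\<close> of the commutator when \<open>\<psi>\<close> and \<open>G\<close> are radial about the same point.
\<close>

definition radial_commutator :: "complex \<Rightarrow> real \<Rightarrow> real \<Rightarrow> complex" where
  "radial_commutator w \<rho> s = 8 * of_real (cutoff1 (s / \<rho>\<^sup>2) / \<rho>\<^sup>2) * green_profile' w (of_real s)"

lemma commutator_green_centre:
  assumes r: "\<rho> > 0"
  shows "commutator (disc_cutoff b \<rho>) (green w b) x
     = radial_commutator w \<rho> (sq_dist b x) + of_real (laplacian (disc_cutoff b \<rho>) x) * green w b x"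
proof (cases "x = b")
  case True
  then have n: "x \<notin> annulus b \<rho>" using r by (auto simp: annulus_def sq_dist_def)
  have "cutoff1 (sq_dist b x / \<rho>\<^sup>2) = 0" using True by (intro cutoff_props) (auto simp: sq_dist_def)
  then show ?thesis using disc_cutoff_values(3,4)[OF r n] by (simp add: commutator_def radial_commutator_def)
next
  case False
  let ?s = "sq_dist b x" and ?c = "cutoff1 (sq_dist b x / \<rho>\<^sup>2) / \<rho>\<^sup>2" and ?g = "green_profile' w (of_real (sq_dist b x))"
  have "(\<Sum>i\<in>UNIV. of_real (vpartial i (disc_cutoff b \<rho>) x) * vpartial i (green w b) x)
      = (\<Sum>i\<in>UNIV. of_real (((x - b) $ i)\<^sup>2) * (4 * of_real ?c * (?g / of_real ?s)))"
  proof (intro sum.cong refl)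
    fix i
    have "(2 * t * c) * (2 * t * h) = t\<^sup>2 * (4 * c * h)" for t c h :: complex by (simp add: power2_eq_square)
    then show "of_real (vpartial i (disc_cutoff b \<rho>) x) * vpartial i (green w b) x = of_real (((x - b) $ i)\<^sup>2) * (4 * of_real ?c * (?g / of_real ?s))"
      unfolding vpartial_disc_cutoff[OF r] vpartial_green[OF False] of_real_mult of_real_power of_real_numeral .
  qed
  also have "\<dots> = of_real (\<Sum>i\<in>UNIV. ((x - b) $ i)\<^sup>2) * (4 * of_real ?c * (?g / of_real ?s))"
    by (simp only: of_real_sum sum_distrib_right)
  also have "\<dots> = 4 * of_real ?c * ?g"
    unfolding sum_sq_dist using sq_dist_pos[OF False] by simp
  finally show ?thesis by (simp add: commutator_def radial_commutator_def)
qed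

lemma laplacian_disc_cutoff_measurable:
  "(\<lambda>x. complex_of_real (laplacian (disc_cutoff a \<rho>) x)) \<in> borel_measurable borel"
  by (intro borel_measurable_continuous_onI continuous_intros continuous_at_imp_continuous_on ballI laplacian_cont[OF smooth_disc_cutoff]) auto

lemma disc_cutoff_measurable:
  "(\<lambda>x. complex_of_real (disc_cutoff a \<rho> x)) \<in> borel_measurable borel"
  by (intro borel_measurable_continuous_onI continuous_intros continuous_at_imp_continuous_on ballI smooth_on_isCont[OF smooth_disc_cutoff]) auto

lemma commutator_disc_cutoff_continuous:
  assumes "\<rho> > 0" "b \<notin> annulus a \<rho>"
  shows "continuous_on UNIV (commutator (disc_cutoff a \<rho>) (green w b))"
    "x \<notin> annulus a \<rho> \<Longrightarrow> commutator (disc_cutoff a \<rho>) (green w b) x = 0"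
proof -
  note cc = commutator_continuous[OF smooth_disc_cutoff smooth_on_green compact_annulus assms(2) disc_cutoff_values(3,4)[OF assms(1)]]
  show "continuous_on UNIV (commutator (disc_cutoff a \<rho>) (green w b))" by (rule cc(1))
  show "x \<notin> annulus a \<rho> \<Longrightarrow> commutator (disc_cutoff a \<rho>) (green w b) x = 0" by (rule cc(2))
qed

text \<open>
  The kernel is of size \<open>exp(- \<rho> Im w)\<close>, while the mass of \<open>f\<close> on the disc grows at most like \<open>\<rho>\<^sup>2\<close>.
\<close>

lemma commutator_at_infinity:
  assumes f: "square_integrable f" and w: "Im w > 0" and R: "filterlim R at_top sequentially"
  shows "(\<lambda>n. LINT x|lborel. commutator (disc_cutoff b (R n)) (green w b) x * f x) \<longlonglongrightarrow> 0"
proof -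
  obtain M where M: "M \<ge> 1" "\<And>a \<rho> x. \<rho> > 0 \<Longrightarrow> \<bar>laplacian (disc_cutoff a \<rho>) x\<bar> \<le> M / \<rho>\<^sup>2" "\<And>s. \<bar>cutoff1 s\<bar> \<le> M"
    using disc_cutoff_bounds by metis
  obtain C R0 where C: "C > 0" "R0 > 0"
    "\<And>r. r \<ge> R0 \<Longrightarrow> norm (green_profile w (of_real (r\<^sup>2))) \<le> C * exp (- Im w * r)"
    "\<And>r. r \<ge> R0 \<Longrightarrow> norm (green_profile' w (of_real (r\<^sup>2))) \<le> C * r * exp (- Im w * r)"
    using green_profile_decay[OF w] by metis
  obtain C2 where C2: "C2 > 0" "\<And>\<rho>. \<rho> \<ge> 1 \<Longrightarrow> mass f b \<rho> \<le> C2 * \<rho>\<^sup>2" using mass_growth[OF f] by metis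
  \<comment> \<open>\<open>17 = 16 + 1\<close>: the gradient term contributes \<open>8 \<cdot> 2\<close>, the term with the Laplacian of the cutoff 1.\<close>
  have bound: "norm (LINT x|lborel. commutator (disc_cutoff b \<rho>) (green w b) x * f x) \<le> 17 * M * C * C2 * (\<rho>\<^sup>2 * exp (- Im w * \<rho>))"
    if \<rho>: "\<rho> \<ge> 1" "\<rho> \<ge> R0" for \<rho>
  proof -
    have r: "\<rho> > 0" using \<rho> by simp
    have nb: "b \<notin> annulus b \<rho>" using r by (auto simp: annulus_def sq_dist_def)
    note cc = commutator_disc_cutoff_continuous[OF r nb, where w = w]
    let ?E = "exp (- Im w * \<rho>)"
    have kb: "norm (commutator (disc_cutoff b \<rho>) (green w b) x) \<le> 17 * M * C * ?E" for x
    proof (cases "x \<in> annulus b \<rho>")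
      case True
      define t where "t = norm (x - b)"
      have st: "sq_dist b x = t\<^sup>2" by (simp add: t_def sq_dist_def)
      have "\<rho>\<^sup>2 \<le> t\<^sup>2" using True st by (simp add: annulus_def)
      then have t1: "\<rho> \<le> t" using r by (simp add: t_def power2_le_iff_abs_le abs_le_square_iff[symmetric])
      have t2: "t \<le> 2 * \<rho>" using annulus_subset_cball[of \<rho> b] True r by (auto simp: t_def dist_norm norm_minus_commute)
      have E: "exp (- Im w * t) \<le> ?E" using t1 w by simp
      have g: "norm (green w b x) \<le> C * ?E"
      proof -
        have "norm (green w b x) \<le> C * exp (- Im w * t)" unfolding green_def st using C(3)[of t] t1 \<rho> by simp
        also have "\<dots> \<le> C * ?E" using E C(1) by (intro mult_left_mono) auto
        finally show ?thesis .
      qed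
      have "norm (green_profile' w (of_real (t\<^sup>2))) \<le> C * t * exp (- Im w * t)" using C(4)[of t] t1 \<rho> by simp
      also have "\<dots> \<le> C * (2 * \<rho>) * ?E" using E C(1) t2 t1 r by (intro mult_mono) auto
      finally have g': "norm (green_profile' w (of_real (sq_dist b x))) \<le> C * (2 * \<rho>) * ?E" unfolding st .
      have ir: "M / \<rho>\<^sup>2 \<le> M / \<rho>" "M / \<rho> \<le> M" using \<rho> M(1) r by (auto intro!: divide_left_mono simp: power2_eq_square field_simps)
      have "norm (radial_commutator w \<rho> (sq_dist b x)) = 8 * (\<bar>cutoff1 (sq_dist b x / \<rho>\<^sup>2)\<bar> / \<rho>\<^sup>2) * norm (green_profile' w (of_real (sq_dist b x)))"
        unfolding radial_commutator_def norm_mult norm_of_real abs_divide by simp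
      also have "\<dots> \<le> 8 * (M / \<rho>\<^sup>2) * (C * (2 * \<rho>) * ?E)"
        using M(1,3) g' r by (intro mult_mono divide_right_mono) auto
      also have "8 * (M / \<rho>\<^sup>2) * (C * (2 * \<rho>) * ?E) = 16 * (M / \<rho>) * C * ?E" using r by (simp add: power2_eq_square)
      also have "\<dots> \<le> 16 * M * C * ?E" using ir C(1) by (intro mult_right_mono mult_left_mono) auto
      finally have b1: "norm (radial_commutator w \<rho> (sq_dist b x)) \<le> 16 * M * C * ?E" .
      have "\<bar>laplacian (disc_cutoff b \<rho>) x\<bar> * norm (green w b x) \<le> (M / \<rho>\<^sup>2) * (C * ?E)"
        using M(1) M(2)[OF r] g by (intro mult_mono) auto
      also have "\<dots> \<le> M * (C * ?E)" using ir C(1) by (intro mult_right_mono) auto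
      finally have b2: "norm (of_real (laplacian (disc_cutoff b \<rho>) x) * green w b x) \<le> M * (C * ?E)" by (simp add: norm_mult)
      have "norm (commutator (disc_cutoff b \<rho>) (green w b) x) \<le> 16 * M * C * ?E + M * (C * ?E)"
        unfolding commutator_green_centre[OF r] by (rule order.trans[OF norm_triangle_ineq add_mono[OF b1 b2]])
      also have "16 * M * C * ?E + M * (C * ?E) = 17 * M * C * ?E" by (simp add: algebra_simps)
      finally show ?thesis .
    qed (use cc(2) M C(1) in auto)
    have kz: "commutator (disc_cutoff b \<rho>) (green w b) x = 0" if "x \<notin> cball b (2 * \<rho>)" for x
      by (rule cc(2)) (use annulus_subset_cball[of \<rho> b] r that in \<open>auto simp del: mem_cball\<close>)
    have "norm (LINT x|lborel. commutator (disc_cutoff b \<rho>) (green w b) x * f x) \<le> 17 * M * C * ?E * mass f b \<rho>"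
      by (rule integral_kernel_bound(2)[OF f borel_measurable_continuous_onI[OF cc(1)]])
        (use kb kz in auto)
    also have "\<dots> \<le> 17 * M * C * ?E * (C2 * \<rho>\<^sup>2)" using C2(2)[OF \<rho>(1)] M(1) C(1) by (intro mult_left_mono) auto
    finally show ?thesis by (simp add: mult_ac)
  qed
  have "((\<lambda>\<rho>. 17 * M * C * C2 * (\<rho>\<^sup>2 * exp (- Im w * \<rho>))) \<longlongrightarrow> 0) at_top"
  proof -
    have "((\<lambda>\<rho>. \<rho>\<^sup>2 * exp (- Im w * \<rho>)) \<longlongrightarrow> 0) at_top" using w by real_asymp
    then show ?thesis by (rule tendsto_mult_right_zero)
  qed
  from filterlim_compose[OF this R]
  show ?thesis
  proof (rule Lim_null_comparison[rotated])
    have "\<forall>\<^sub>F n in sequentially. R n \<ge> max 1 R0" using R unfolding filterlim_at_top by blast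
    then show "\<forall>\<^sub>F n in sequentially. norm (LINT x|lborel. commutator (disc_cutoff b (R n)) (green w b) x * f x)
        \<le> 17 * M * C * C2 * ((R n)\<^sup>2 * exp (- Im w * R n))"
      by eventually_elim (rule bound; simp)
  qed
qed

text \<open>
  Near \<open>p\<close> the function \<open>G\<close> has bounded gradient and differs from \<open>G(p)\<close> by \<open>O(\<rho>)\<close>. With the scaling of the
  cutoff, replacing the commutator by \<open>G(p) \<Delta>\<chi>\<close> changes the kernel by \<open>O(1/\<rho>)\<close> only, and the mass of \<open>f\<close> is
  \<open>o(\<rho>)\<close>.
\<close>

lemma commutator_at_pole:
  assumes f: "square_integrable f" and d: "\<And>n. \<delta> n > 0" "\<delta> \<longlonglongrightarrow> 0" and pb: "p \<noteq> b"
  shows "(\<lambda>n. (LINT x|lborel. commutator (disc_cutoff p (\<delta> n)) (green w b) x * f x)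
            - green w b p * (LINT x|lborel. of_real (laplacian (disc_cutoff p (\<delta> n)) x) * f x)) \<longlonglongrightarrow> 0"
proof -
  obtain M where M: "M \<ge> 1" "\<And>a \<rho> x i. \<rho> > 0 \<Longrightarrow> \<bar>vpartial i (disc_cutoff a \<rho>) x\<bar> \<le> M / \<rho>"
    "\<And>a \<rho> x. \<rho> > 0 \<Longrightarrow> \<bar>laplacian (disc_cutoff a \<rho>) x\<bar> \<le> M / \<rho>\<^sup>2"
    using disc_cutoff_bounds by metis
  let ?G = "green w b"
  have p: "p \<in> - {b}" using pb by simp
  have "\<exists>B. \<forall>\<^sub>F x in nhds p. norm (vpartial i ?G x) \<le> B" for i
  proof -
    have "isCont (vpartial i ?G) p" by (rule smooth_on_isCont[OF smooth_on_vpartial[OF smooth_on_green] p])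
    then have "((\<lambda>x. norm (vpartial i ?G x)) \<longlongrightarrow> norm (vpartial i ?G p)) (nhds p)"
      unfolding isCont_def by (intro tendsto_norm) (simp add: tendsto_nhds_iff)
    then have "\<forall>\<^sub>F x in nhds p. norm (vpartial i ?G x) < norm (vpartial i ?G p) + 1" by (rule order_tendstoD) simp
    then show ?thesis by (auto intro: eventually_mono less_imp_le)
  qed
  then obtain Bi where Bi: "\<And>i. \<forall>\<^sub>F x in nhds p. norm (vpartial i ?G x) \<le> Bi i" by metis
  define B where "B = (\<Sum>i\<in>UNIV. \<bar>Bi i\<bar>)"
  have "\<forall>\<^sub>F x in nhds p. \<forall>i. norm (vpartial i ?G x) \<le> Bi i"
    using Bi by (intro eventually_all_finite) auto
  then obtain d1 where d1: "d1 > 0" "\<And>x i. dist x p < d1 \<Longrightarrow> norm (vpartial i ?G x) \<le> Bi i"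
    unfolding eventually_nhds_metric by blast
  have sumB: "(\<Sum>i\<in>UNIV. norm (vpartial i ?G x)) \<le> B" if "dist x p < d1" for x
    unfolding B_def by (intro sum_mono order.trans[OF d1(2)[OF that] abs_ge_self])
  have B0: "B \<ge> 0" unfolding B_def by (intro sum_nonneg) auto
  obtain G' where G': "(?G has_derivative G') (at p)"
    using smooth_on_differentiable[OF smooth_on_green p] unfolding differentiable_def by blast
  then obtain K where K: "K > 0" "\<And>h. norm (G' h) \<le> norm h * K"
    using has_derivative_bounded_linear bounded_linear.pos_bounded by metis
  obtain d2 where d2: "d2 > 0" "\<And>y. norm (y - p) < d2 \<Longrightarrow> norm (?G y - ?G p - G' (y - p)) \<le> 1 * norm (y - p)"
    using G' unfolding has_derivative_at_alt by (metis zero_less_one)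
  define L where "L = K + 1"
  have lip: "norm (?G y - ?G p) \<le> L * norm (y - p)" if "norm (y - p) < d2" for y
    using d2(2)[OF that] K(2)[of "y - p"] norm_triangle_sub[of "?G y - ?G p" "G' (y - p)"] by (simp add: L_def algebra_simps)
  have L0: "L \<ge> 0" using K by (simp add: L_def)
  have bound: "norm ((LINT x|lborel. commutator (disc_cutoff p \<rho>) ?G x * f x)
            - ?G p * (LINT x|lborel. of_real (laplacian (disc_cutoff p \<rho>) x) * f x)) \<le> (2 * M * B + 2 * L * M) * (mass f p \<rho> / \<rho>)"
    if r: "\<rho> > 0" and sm: "2 * \<rho> < d1" "2 * \<rho> < d2" "2 * \<rho> < dist p b" for \<rho>
  proof -
    have nb: "b \<notin> annulus p \<rho>" using annulus_subset_cball[of \<rho> p] r sm(3) by auto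
    note cc = commutator_disc_cutoff_continuous[OF r nb, where w = w]
    let ?l = "\<lambda>x. complex_of_real (laplacian (disc_cutoff p \<rho>) x)"
    let ?k = "\<lambda>x. commutator (disc_cutoff p \<rho>) ?G x - ?G p * ?l x"
    have an: "x \<in> annulus p \<rho> \<Longrightarrow> x \<in> cball p (2 * \<rho>)" for x using annulus_subset_cball[of \<rho> p] r by auto
    have lz: "laplacian (disc_cutoff p \<rho>) x = 0" if "x \<notin> cball p (2 * \<rho>)" for x
      by (rule disc_cutoff_values(4)[OF r]) (use an that in blast)
    have i1: "integrable lborel (\<lambda>x. commutator (disc_cutoff p \<rho>) ?G x * f x)"
      by (rule integrable_compact_kernel[OF f cc(1) compact_annulus cc(2)])
    have i2: "integrable lborel (\<lambda>x. ?l x * f x)"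
      by (rule integral_kernel_bound(1)[OF f laplacian_disc_cutoff_measurable, of p \<rho> p \<rho> "M / \<rho>\<^sup>2"])
        (use M(3)[OF r] lz in auto)
    have "(LINT x|lborel. ?k x * f x) = (LINT x|lborel. commutator (disc_cutoff p \<rho>) ?G x * f x - ?G p * (?l x * f x))"
      by (intro Bochner_Integration.integral_cong) (auto simp: algebra_simps)
    also have "\<dots> = (LINT x|lborel. commutator (disc_cutoff p \<rho>) ?G x * f x) - ?G p * (LINT x|lborel. ?l x * f x)"
      using i1 i2 by (simp only: Bochner_Integration.integral_diff integrable_mult_right integral_mult_right_zero)
    finally have eq: "(LINT x|lborel. ?k x * f x) = (LINT x|lborel. commutator (disc_cutoff p \<rho>) ?G x * f x) - ?G p * (LINT x|lborel. ?l x * f x)" .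
    have "norm (LINT x|lborel. ?k x * f x) \<le> ((2 * M * B + 2 * L * M) / \<rho>) * mass f p \<rho>"
    proof (rule integral_kernel_bound(2)[OF f])
      show "?k \<in> borel_measurable borel"
        using borel_measurable_continuous_onI[OF cc(1)] laplacian_disc_cutoff_measurable[of p \<rho>] by simp
      show "?k x = 0" if "x \<notin> cball p (2 * \<rho>)" for x
        using an[of x] that cc(2)[of x] lz[OF that] by simp blast
      fix x assume x: "x \<in> cball p (2 * \<rho>)"
      have "?k x = 2 * (\<Sum>i\<in>UNIV. of_real (vpartial i (disc_cutoff p \<rho>) x) * vpartial i ?G x) + ?l x * (?G x - ?G p)"
        by (simp add: commutator_def algebra_simps)
      also have "norm \<dots> \<le> 2 * (\<Sum>i\<in>UNIV. (M / \<rho>) * norm (vpartial i ?G x)) + (M / \<rho>\<^sup>2) * (L * (2 * \<rho>))"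
      proof (rule order.trans[OF norm_triangle_ineq] , rule add_mono)
        have "norm (\<Sum>i\<in>UNIV. of_real (vpartial i (disc_cutoff p \<rho>) x) * vpartial i ?G x) \<le> (\<Sum>i\<in>UNIV. (M / \<rho>) * norm (vpartial i ?G x))"
        proof (rule sum_norm_le)
          fix i
          show "norm (of_real (vpartial i (disc_cutoff p \<rho>) x) * vpartial i ?G x) \<le> (M / \<rho>) * norm (vpartial i ?G x)"
            unfolding norm_mult norm_of_real by (rule mult_right_mono[OF M(2)[OF r]]) simp
        qed
        then show "norm (2 * (\<Sum>i\<in>UNIV. of_real (vpartial i (disc_cutoff p \<rho>) x) * vpartial i ?G x)) \<le> 2 * (\<Sum>i\<in>UNIV. (M / \<rho>) * norm (vpartial i ?G x))"
          by (simp add: norm_mult)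
        have "norm (x - p) \<le> 2 * \<rho>" using x by (simp add: dist_norm norm_minus_commute)
        then have "norm (?G x - ?G p) \<le> L * norm (x - p)" "L * norm (x - p) \<le> L * (2 * \<rho>)"
          using lip[of x] sm(2) L0 by (auto intro: mult_left_mono)
        then have "norm (?G x - ?G p) \<le> L * (2 * \<rho>)" by (rule order.trans)
        then show "norm (?l x * (?G x - ?G p)) \<le> (M / \<rho>\<^sup>2) * (L * (2 * \<rho>))"
          unfolding norm_mult norm_of_real using M(1) M(3)[OF r] by (intro mult_mono) auto
      qed
      also have "\<dots> = (2 * M * (\<Sum>i\<in>UNIV. norm (vpartial i ?G x)) + 2 * L * M) / \<rho>"
      proof -
        have "2 * (M / \<rho> * S) + M / \<rho>\<^sup>2 * (L * (2 * \<rho>)) = (2 * M * S + 2 * L * M) / \<rho>" for S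
          using r by (simp add: field_simps power2_eq_square)
        then show ?thesis unfolding sum_distrib_left[symmetric] .
      qed
      also have "\<dots> \<le> (2 * M * B + 2 * L * M) / \<rho>"
        using sumB[of x] x sm(1) M(1) r by (intro divide_right_mono add_right_mono mult_left_mono) (auto simp: dist_commute)
      finally show "norm (?k x) \<le> (2 * M * B + 2 * L * M) / \<rho>" .
    qed
    then show ?thesis unfolding eq by simp
  qed
  have "(\<lambda>n. (2 * M * B + 2 * L * M) * (mass f p (\<delta> n) / \<delta> n)) \<longlonglongrightarrow> 0"
    by (rule tendsto_mult_right_zero[OF mass_over_radius_tendsto_0[OF f d]])
  then show ?thesis
  proof (rule Lim_null_comparison[rotated])
    have "(\<lambda>n. 2 * \<delta> n) \<longlonglongrightarrow> 0" using tendsto_mult_right_zero[OF d(2)] .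
    then have "\<forall>\<^sub>F n in sequentially. 2 * \<delta> n < min d1 (min d2 (dist p b))"
      by (rule order_tendstoD) (use d1 d2 pb in auto)
    then show "\<forall>\<^sub>F n in sequentially. norm ((LINT x|lborel. commutator (disc_cutoff p (\<delta> n)) ?G x * f x)
            - ?G p * (LINT x|lborel. of_real (laplacian (disc_cutoff p (\<delta> n)) x) * f x)) \<le> (2 * M * B + 2 * L * M) * (mass f p (\<delta> n) / \<delta> n)"
      by eventually_elim (rule bound; use d(1) in simp)
  qed
qed

section \<open>Charges, and the mass of the commutator kernel\<close>

lemma weak_helmholtz_on_cutoff:
  assumes w: "weak_helmholtz X z f" and X: "cball a (2 * \<rho>) \<inter> X = {}" and r: "\<rho> > 0"
  shows "(LINT x|lborel. of_real (laplacian (disc_cutoff a \<rho>) x) * f x) = - z * (LINT x|lborel. of_real (disc_cutoff a \<rho> x) * f x)"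
proof -
  have "disc_cutoff a \<rho> \<in> test_functions (- X)"
  proof (rule test_functionI[OF smooth_disc_cutoff])
    show "compact {x. 0 \<le> sq_dist a x \<and> sq_dist a x \<le> 2 * \<rho>\<^sup>2}" by (rule compact_sq_dist_between)
    show "{x. 0 \<le> sq_dist a x \<and> sq_dist a x \<le> 2 * \<rho>\<^sup>2} \<subseteq> - X"
      using sq_dist_le_imp_cball[of a _ \<rho>] X r by fastforce
    show "disc_cutoff a \<rho> x = 0" if "x \<notin> {x. 0 \<le> sq_dist a x \<and> sq_dist a x \<le> 2 * \<rho>\<^sup>2}" for x
      by (rule disc_cutoff_values(2)[OF r]) (use that in \<open>auto simp: sq_dist_def\<close>)
  qed
  then show ?thesis using w unfolding weak_helmholtz_def scaleR_conv_of_real by blast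
qed

lemma disc_cutoff_integral_bound:
  assumes f: "square_integrable f" and M: "\<And>x. \<bar>disc_cutoff a \<rho> x\<bar> \<le> M" and r: "\<rho> > 0"
  shows "integrable lborel (\<lambda>x. of_real (disc_cutoff a \<rho> x) * f x)"
    "norm (LINT x|lborel. of_real (disc_cutoff a \<rho> x) * f x) \<le> M * mass f a \<rho>"
proof -
  have z: "disc_cutoff a \<rho> x = 0" if "x \<notin> cball a (2 * \<rho>)" for x
  proof (rule disc_cutoff_values(2)[OF r])
    show "2 * \<rho>\<^sup>2 \<le> sq_dist a x" using sq_dist_le_imp_cball[of a x \<rho>] that r by (meson less_imp_le linorder_not_less)
  qed
  show "integrable lborel (\<lambda>x. of_real (disc_cutoff a \<rho> x) * f x)"
    by (rule integral_kernel_bound(1)[OF f disc_cutoff_measurable, of a \<rho> a \<rho> M]) (use M z in auto)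
  show "norm (LINT x|lborel. of_real (disc_cutoff a \<rho> x) * f x) \<le> M * mass f a \<rho>"
    by (rule integral_kernel_bound(2)[OF f disc_cutoff_measurable]) (use M z in auto)
qed

lemma tendsto_mass:
  assumes f: "square_integrable f" and d: "\<And>n. \<delta> n > 0" "\<delta> \<longlonglongrightarrow> 0"
  shows "(\<lambda>n. mass f a (\<delta> n)) \<longlonglongrightarrow> 0"
proof -
  have "(\<lambda>n. mass f a (\<delta> n) / \<delta> n * \<delta> n) \<longlonglongrightarrow> 0 * 0"
    by (intro tendsto_mult mass_over_radius_tendsto_0 f d)
  moreover have "mass f a (\<delta> n) / \<delta> n * \<delta> n = mass f a (\<delta> n)" for n using d(1)[of n] by simp
  ultimately show ?thesis by simp
qed

text \<open>
  The difference of two cutoffs with the same centre is a test function off \<open>X\<close>. The equation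
  therefore expresses \<open>\<integral> \<Delta>\<chi> f\<close> for a small radius by the same integral for a fixed radius and integrals of \<open>\<chi> f\<close>,
  and the latter tend to 0 with the radius. The limit is the strength of the point source
  \<open>(\<Delta> + z) f\<close> at \<open>a\<close>.
\<close>

lemma charge_limit:
  assumes w: "weak_helmholtz X z f" and f: "square_integrable f"
    and X: "cball a (2 * \<rho>0) \<inter> X \<subseteq> {a}" "\<rho>0 > 0"
  obtains c where "\<And>\<delta>. (\<And>n. \<delta> n > 0) \<Longrightarrow> (\<And>n. \<delta> n \<le> \<rho>0) \<Longrightarrow> \<delta> \<longlonglongrightarrow> 0 \<Longrightarrow>
    (\<lambda>n. LINT x|lborel. of_real (laplacian (disc_cutoff a (\<delta> n)) x) * f x) \<longlonglongrightarrow> c"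
proof -
  obtain M where M: "M \<ge> 1" "\<And>a \<rho> x. \<rho> > 0 \<Longrightarrow> \<bar>disc_cutoff a \<rho> x\<bar> \<le> M"
    "\<And>a \<rho> x. \<rho> > 0 \<Longrightarrow> \<bar>laplacian (disc_cutoff a \<rho>) x\<bar> \<le> M / \<rho>\<^sup>2"
    using disc_cutoff_bounds by metis
  let ?l = "\<lambda>\<rho>. LINT x|lborel. of_real (laplacian (disc_cutoff a \<rho>) x) * f x"
  let ?i = "\<lambda>\<rho>. LINT x|lborel. of_real (disc_cutoff a \<rho> x) * f x"
  have il: "integrable lborel (\<lambda>x. of_real (laplacian (disc_cutoff a \<rho>) x) * f x)" if r: "\<rho> > 0" for \<rho>
  proof (rule integral_kernel_bound(1)[OF f laplacian_disc_cutoff_measurable, of a \<rho> a \<rho> "M / \<rho>\<^sup>2"])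
    show "norm (complex_of_real (laplacian (disc_cutoff a \<rho>) x)) \<le> M / \<rho>\<^sup>2" for x using M(3)[OF r] by simp
    show "complex_of_real (laplacian (disc_cutoff a \<rho>) x) = 0" if "x \<notin> cball a (2 * \<rho>)" for x
      using disc_cutoff_values(4)[OF r, of x a] annulus_subset_cball[of \<rho> a] r that by (metis less_imp_le of_real_0 subsetD)
  qed
  have eq: "?l \<rho> = ?l \<rho>0 + z * ?i \<rho>0 - z * ?i \<rho>" if r: "\<rho> > 0" "\<rho> \<le> \<rho>0" for \<rho>
  proof -
    let ?\<psi> = "\<lambda>x. disc_cutoff a \<rho>0 x - disc_cutoff a \<rho> x"
    let ?K = "{x. \<rho>\<^sup>2 \<le> sq_dist a x \<and> sq_dist a x \<le> 2 * \<rho>0\<^sup>2}"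
    have le: "\<rho>\<^sup>2 \<le> \<rho>0\<^sup>2" using r by (intro power_mono) auto
    have "?\<psi> \<in> test_functions (- X)"
    proof (rule test_functionI)
      show "smooth_on UNIV ?\<psi>" by (intro smooth_on_diff smooth_disc_cutoff) auto
      show "compact ?K" by (rule compact_sq_dist_between)
      show "?K \<subseteq> - X"
      proof
        fix x assume x: "x \<in> ?K"
        have "x \<in> cball a (2 * \<rho>0)" by (rule sq_dist_le_imp_cball) (use x X(2) in auto)
        moreover have "x \<noteq> a" using x r(1) by (auto simp: sq_dist_def)
        ultimately show "x \<in> - X" using X(1) by blast
      qed
      fix x assume "x \<notin> ?K"
      then consider "sq_dist a x \<le> \<rho>\<^sup>2" | "sq_dist a x \<ge> 2 * \<rho>0\<^sup>2" by fastforce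
      then show "?\<psi> x = 0"
      proof cases
        case 1
        then show ?thesis using le disc_cutoff_values(1)[OF r(1), of a x] disc_cutoff_values(1)[OF X(2), of a x] by linarith
      next
        case 2
        then show ?thesis using le disc_cutoff_values(2)[OF r(1), of a x] disc_cutoff_values(2)[OF X(2), of a x] by linarith
      qed
    qed
    then have "(LINT x|lborel. of_real (laplacian ?\<psi> x) * f x) = - z * (LINT x|lborel. of_real (?\<psi> x) * f x)"
      using w unfolding weak_helmholtz_def scaleR_conv_of_real by blast
    \<comment> \<open>The Laplacian is the commutator with the constant function 1.\<close>
    moreover have "laplacian ?\<psi> x = laplacian (disc_cutoff a \<rho>0) x - laplacian (disc_cutoff a \<rho>) x" for x
      using commutator_diff[OF smooth_disc_cutoff smooth_disc_cutoff, of a \<rho>0 a \<rho> "\<lambda>x. 1" x]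
        vpartial_eqI[OF has_derivative_const, of _ "1::complex" x] unfolding commutator_def
      by (simp flip: of_real_diff)
    ultimately have "(LINT x|lborel. of_real (laplacian (disc_cutoff a \<rho>0) x) * f x - of_real (laplacian (disc_cutoff a \<rho>) x) * f x)
        = - z * (LINT x|lborel. of_real (disc_cutoff a \<rho>0 x) * f x - of_real (disc_cutoff a \<rho> x) * f x)"
      by (simp add: left_diff_distrib)
    then have "?l \<rho>0 - ?l \<rho> = - z * (?i \<rho>0 - ?i \<rho>)"
      using il[OF r(1)] il[OF X(2)] disc_cutoff_integral_bound(1)[OF f M(2)[OF r(1)] r(1), of a] disc_cutoff_integral_bound(1)[OF f M(2)[OF X(2)] X(2), of a]
      by (simp only: Bochner_Integration.integral_diff)
    then show ?thesis by (simp add: algebra_simps)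
  qed
  show ?thesis
  proof (rule that[of "?l \<rho>0 + z * ?i \<rho>0"])
    fix \<delta> :: "nat \<Rightarrow> real"
    assume d: "\<And>n. \<delta> n > 0" "\<And>n. \<delta> n \<le> \<rho>0" "\<delta> \<longlonglongrightarrow> 0"
    have "(\<lambda>n. M * mass f a (\<delta> n)) \<longlonglongrightarrow> 0" by (rule tendsto_mult_right_zero[OF tendsto_mass[OF f d(1,3)]])
    then have "(\<lambda>n. ?i (\<delta> n)) \<longlonglongrightarrow> 0"
      by (rule Lim_null_comparison[rotated]) (use disc_cutoff_integral_bound(2)[OF f M(2)[OF d(1)] d(1)] in auto)
    then have "(\<lambda>n. ?l \<rho>0 + z * ?i \<rho>0 - z * ?i (\<delta> n)) \<longlonglongrightarrow> ?l \<rho>0 + z * ?i \<rho>0 - z * 0"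
      by (intro tendsto_intros)
    then show "(\<lambda>n. ?l (\<delta> n)) \<longlonglongrightarrow> ?l \<rho>0 + z * ?i \<rho>0" using eq d by simp
  qed
qed

text \<open>
  The commutator kernel at the pole of \<open>G\<close>, as a function of \<open>s\<close>, after subtracting from \<open>G\<close> its value on the
  inner circle of the annulus. The subtraction removes the logarithmic divergence, so that the
  kernel is of size \<open>1/\<rho>\<^sup>2\<close>, as an approximate identity in the plane should be.
\<close>

definition centred_kernel :: "complex \<Rightarrow> real \<Rightarrow> real \<Rightarrow> complex" where
  "centred_kernel w \<rho> s = radial_commutator w \<rho> s +
     of_real (4 * (cutoff1 (s / \<rho>\<^sup>2) / \<rho>\<^sup>2 + s * (cutoff2 (s / \<rho>\<^sup>2) / \<rho>\<^sup>2 / \<rho>\<^sup>2))) * (green_profile w (of_real s) - green_profile w (of_real (\<rho>\<^sup>2)))"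

lemma centred_kernel_zero:
  assumes "\<rho> > 0" "s \<notin> {\<rho>\<^sup>2..2 * \<rho>\<^sup>2}"
  shows "centred_kernel w \<rho> s = 0"
proof -
  have "s / \<rho>\<^sup>2 \<notin> {1<..<2}" using assms by (auto simp: field_simps)
  then show ?thesis using cutoff_props by (simp add: centred_kernel_def radial_commutator_def)
qed

text \<open>
  The kernel equals \<open>4 Q' + 4 p g'\<close>, where \<open>p\<close> is the derivative of the scaled cutoff, \<open>g'\<close> stands for
  \<open>green_profile'\<close>, and \<open>Q = s p(s) (G(s) - G(\<rho>\<^sup>2))\<close> vanishes at both ends: the second factor at the inner
  radius, \<open>p\<close> at the outer one.
\<close>

lemma centred_kernel_integral:
  assumes r: "\<rho> > 0"
  shows "(centred_kernel w \<rho> has_integral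
      4 * integral {\<rho>\<^sup>2..2 * \<rho>\<^sup>2} (\<lambda>s. of_real (cutoff1 (s / \<rho>\<^sup>2) / \<rho>\<^sup>2) * green_profile' w (of_real s))) {\<rho>\<^sup>2..2 * \<rho>\<^sup>2}"
proof -
  let ?I = "{\<rho>\<^sup>2..2 * \<rho>\<^sup>2}"
  let ?p = "\<lambda>s. cutoff1 (s / \<rho>\<^sup>2) / \<rho>\<^sup>2" and ?p' = "\<lambda>s. cutoff2 (s / \<rho>\<^sup>2) / \<rho>\<^sup>2 / \<rho>\<^sup>2"
  let ?g = "\<lambda>s. green_profile w (of_real s)" and ?g1 = "\<lambda>s. green_profile' w (of_real s)"
  let ?h = "\<lambda>s. of_real (?p s) * ?g1 s"
  let ?Q = "\<lambda>s. (?g s - ?g (\<rho>\<^sup>2)) * of_real (s * ?p s)"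
  let ?Q' = "\<lambda>s. (?g s - ?g (\<rho>\<^sup>2)) * of_real (?p s + s * ?p' s) + (?g1 s / of_real s) * of_real (s * ?p s)"
  have r2: "\<rho>\<^sup>2 > 0" using r by simp
  have pos: "s > 0" if "s \<in> ?I" for s by (rule less_le_trans[OF r2]) (use that in simp)
  have Q: "(?Q has_vector_derivative ?Q' s) (at s within ?I)" if "s \<in> ?I" for s
  proof -
    have 1: "((\<lambda>s. ?g s - ?g (\<rho>\<^sup>2)) has_vector_derivative ?g1 s / of_real s) (at s)"
      using has_vector_derivative_diff[OF green_profile_real_deriv(1)[OF pos[OF that]] has_vector_derivative_const]
      unfolding diff_0_right .
    have "(?p has_real_derivative ?p' s) (at s)"
      using cutoff_scaled_deriv(2)[OF r] by (simp only: has_real_derivative_iff_has_vector_derivative)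
    from DERIV_mult[OF DERIV_ident this]
    have "((\<lambda>s. s * ?p s) has_real_derivative ?p s + s * ?p' s) (at s)"
      by (rule DERIV_cong) simp
    then have 2: "((\<lambda>s. complex_of_real (s * ?p s)) has_vector_derivative of_real (?p s + s * ?p' s)) (at s)"
      by (intro has_vector_derivative_of_real) (simp only: has_real_derivative_iff_has_vector_derivative)
    show ?thesis by (rule has_vector_derivative_at_within[OF has_vector_derivative_mult[OF 1 2]])
  qed
  have "(?Q' has_integral ?Q (2 * \<rho>\<^sup>2) - ?Q (\<rho>\<^sup>2)) ?I"
    by (rule fundamental_theorem_of_calculus) (use r2 Q in auto)
  moreover have "?Q (2 * \<rho>\<^sup>2) - ?Q (\<rho>\<^sup>2) = 0"
  proof -
    have "2 * \<rho>\<^sup>2 / \<rho>\<^sup>2 = 2" using r by simp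
    then have "?p (2 * \<rho>\<^sup>2) = 0" using cutoff_props(1)[of 2] by (simp only:) simp
    then show ?thesis by (simp only: mult_zero_right of_real_0 diff_self mult_zero_left)
  qed
  ultimately have Q0: "(?Q' has_integral 0) ?I" by (simp only:)
  have c1: "continuous_on UNIV cutoff1" using DERIV_isCont[OF cutoff1_deriv] by (auto intro: continuous_at_imp_continuous_on)
  have "continuous_on ?I ?g1"
    by (intro continuous_at_imp_continuous_on ballI has_vector_derivative_continuous[OF green_profile_real_deriv(2)] pos)
  moreover have "continuous_on ?I (\<lambda>s. complex_of_real (?p s))"
    using r by (intro continuous_intros continuous_on_compose2[OF c1]) auto
  ultimately have hi: "?h integrable_on ?I" by (intro integrable_continuous_real continuous_on_mult)
  have "((\<lambda>s. 4 * ?Q' s + 4 * ?h s) has_integral 4 * 0 + 4 * integral ?I ?h) ?I"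
    by (intro has_integral_add has_integral_mult_right Q0 integrable_integral hi)
  then have "((\<lambda>s. 4 * ?Q' s + 4 * ?h s) has_integral 4 * integral ?I ?h) ?I" by simp
  then show ?thesis
  proof (rule has_integral_eq[rotated])
    fix s assume "s \<in> ?I"
    then have "s \<noteq> 0" using pos by blast
    then have "(?g1 s / of_real s) * of_real (s * ?p s) = ?h s" by simp
    then show "4 * ?Q' s + 4 * ?h s = centred_kernel w \<rho> s"
    proof -
      have "4 * (G * of_real c + h) + 4 * h = 8 * h + of_real (4 * c) * G" for G h :: complex and c :: real
        by (simp add: algebra_simps)
      then show ?thesis
        unfolding \<open>(?g1 s / of_real s) * of_real (s * ?p s) = ?h s\<close> centred_kernel_def radial_commutator_def mult.assoc .
    qed
  qed
qed

lemma centred_kernel_continuous: 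
  assumes r: "\<rho> > 0"
  shows "continuous_on {\<rho>\<^sup>2..2 * \<rho>\<^sup>2} (centred_kernel w \<rho>)"
proof -
  have c1: "continuous_on UNIV cutoff1" using DERIV_isCont[OF cutoff1_deriv] by (auto intro: continuous_at_imp_continuous_on)
  have c2: "continuous_on UNIV cutoff2" unfolding cutoff2_def[abs_def]
    using bump_mass_pos by (intro continuous_intros bump'_cont) auto
  have pos: "s > 0" if "s \<in> {\<rho>\<^sup>2..2 * \<rho>\<^sup>2}" for s using that r by (auto intro: less_le_trans[of 0 "\<rho>\<^sup>2"])
  have g: "continuous_on {\<rho>\<^sup>2..2 * \<rho>\<^sup>2} (\<lambda>s. green_profile' w (of_real s))" "continuous_on {\<rho>\<^sup>2..2 * \<rho>\<^sup>2} (\<lambda>s. green_profile w (of_real s))"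
    by (intro continuous_at_imp_continuous_on ballI has_vector_derivative_continuous[OF green_profile_real_deriv(2)]
        has_vector_derivative_continuous[OF green_profile_real_deriv(1)] pos; assumption)+
  show ?thesis unfolding centred_kernel_def[abs_def] radial_commutator_def
    using r by (intro continuous_intros g continuous_on_compose2[OF c1] continuous_on_compose2[OF c2]) auto
qed

lemma centred_kernel_plane_integral:
  assumes r: "\<rho> > 0"
  shows "(\<lambda>x. centred_kernel w \<rho> (sq_dist b x)) \<in> borel_measurable borel"
    "(LINT x|lborel. centred_kernel w \<rho> (sq_dist b x)) = of_real (4 * pi) * integral {\<rho>\<^sup>2..2 * \<rho>\<^sup>2} (\<lambda>s. of_real (cutoff1 (s / \<rho>\<^sup>2) / \<rho>\<^sup>2) * green_profile' w (of_real s))"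
proof -
  let ?I = "{\<rho>\<^sup>2..2 * \<rho>\<^sup>2}"
  have ind: "centred_kernel w \<rho> = (\<lambda>s. indicator ?I s *\<^sub>R centred_kernel w \<rho> s)"
    using centred_kernel_zero[OF r] by (auto simp: indicator_def)
  have si: "set_integrable lborel ?I (centred_kernel w \<rho>)"
    by (rule borel_integrable_atLeastAtMost'[OF centred_kernel_continuous[OF r]])
  then have m: "centred_kernel w \<rho> \<in> borel_measurable borel"
    by (subst ind) (auto simp: set_integrable_def)
  have sm: "sq_dist b \<in> borel_measurable borel" by (rule borel_measurable_continuous_onI[OF sq_dist_cont])
  show "(\<lambda>x. centred_kernel w \<rho> (sq_dist b x)) \<in> borel_measurable borel"
    by (rule measurable_compose[OF sm m])
  have "(LINT x|lborel. centred_kernel w \<rho> (sq_dist b x)) = of_real pi * (LINT s|lborel. indicator {0..} s *\<^sub>R centred_kernel w \<rho> s)"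
    by (rule integral_radial[OF m])
  also have "(LINT s|lborel. indicator {0..} s *\<^sub>R centred_kernel w \<rho> s) = (LINT s:?I|lborel. centred_kernel w \<rho> s)"
    unfolding set_lebesgue_integral_def
    by (intro Bochner_Integration.integral_cong refl) (use centred_kernel_zero[OF r, of _ w] in \<open>auto simp: indicator_def intro: order.trans[OF zero_le_power2[of \<rho>]]\<close>)
  also have "\<dots> = integral ?I (centred_kernel w \<rho>)" by (rule set_borel_integral_eq_integral(2)[OF si])
  also have "\<dots> = 4 * integral ?I (\<lambda>s. of_real (cutoff1 (s / \<rho>\<^sup>2) / \<rho>\<^sup>2) * green_profile' w (of_real s))"
    by (rule integral_unique[OF centred_kernel_integral[OF r]])
  finally show "(LINT x|lborel. centred_kernel w \<rho> (sq_dist b x)) = of_real (4 * pi) * integral ?I (\<lambda>s. of_real (cutoff1 (s / \<rho>\<^sup>2) / \<rho>\<^sup>2) * green_profile' w (of_real s))"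
    by simp
qed

text \<open>
  The cutoff decreases from 1 to 0, so its derivative has integral \<open>-1\<close>, and \<open>green_profile'\<close> is close to
  \<open>- 1/4\<pi>\<close> near 0. Together with the factor \<open>4\<pi>\<close> this gives total mass 1.
\<close>

lemma centred_kernel_mass:
  assumes r: "\<rho> > 0" and e: "e \<ge> 0"
    and near: "\<And>s. s \<in> {\<rho>\<^sup>2..2 * \<rho>\<^sup>2} \<Longrightarrow> norm (green_profile' w (of_real s) + 1 / (4 * of_real pi)) \<le> e"
  shows "norm ((LINT x|lborel. centred_kernel w \<rho> (sq_dist b x)) - 1) \<le> 4 * pi * e"
proof -
  let ?I = "{\<rho>\<^sup>2..2 * \<rho>\<^sup>2}"
  let ?p = "\<lambda>s. cutoff1 (s / \<rho>\<^sup>2) / \<rho>\<^sup>2" and ?g1 = "\<lambda>s. green_profile' w (of_real s)"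
  have le: "\<rho>\<^sup>2 \<le> 2 * \<rho>\<^sup>2" by simp
  have r2: "\<rho>\<^sup>2 > 0" using r by simp
  have pos: "s > 0" if "s \<in> ?I" for s by (rule less_le_trans[OF r2]) (use that in simp)
  have hp: "(?p has_integral -1) ?I"
  proof -
    have "(?p has_integral cutoff (2 * \<rho>\<^sup>2 / \<rho>\<^sup>2) - cutoff (\<rho>\<^sup>2 / \<rho>\<^sup>2)) ?I"
      by (rule fundamental_theorem_of_calculus[OF le has_vector_derivative_at_within[OF cutoff_scaled_deriv(1)[OF r]]])
    then show ?thesis using r by (simp add: cutoff_eq_0 cutoff_eq_1)
  qed
  have c1: "continuous_on UNIV cutoff1" using DERIV_isCont[OF cutoff1_deriv] by (auto intro: continuous_at_imp_continuous_on)
  have cg: "continuous_on ?I ?g1"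
    by (intro continuous_at_imp_continuous_on ballI has_vector_derivative_continuous[OF green_profile_real_deriv(2)] pos)
  have cp: "continuous_on ?I (\<lambda>s. complex_of_real (?p s))"
    using r by (intro continuous_intros continuous_on_compose2[OF c1]) auto
  have h1: "((\<lambda>s. of_real (?p s) * ?g1 s) has_integral integral ?I (\<lambda>s. of_real (?p s) * ?g1 s)) ?I"
    by (intro integrable_integral integrable_continuous_real continuous_on_mult cg cp)
  have "((\<lambda>s. complex_of_real (?p s)) has_integral of_real (-1)) ?I"
  proof -
    have bl: "bounded_linear (of_real :: real \<Rightarrow> complex)" by (rule bounded_linear_of_real)
    show ?thesis using has_integral_linear[OF hp bl] unfolding o_def .
  qed
  then have "((\<lambda>s. complex_of_real (?p s) * (1 / (4 * of_real pi))) has_integral of_real (-1) * (1 / (4 * of_real pi))) ?I"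
    by (rule has_integral_mult_left)
  from has_integral_add[OF h1 this]
  have h2: "((\<lambda>s. of_real (?p s) * (?g1 s + 1 / (4 * of_real pi))) has_integral
      integral ?I (\<lambda>s. of_real (?p s) * ?g1 s) - 1 / (4 * of_real pi)) ?I"
    unfolding distrib_left[symmetric] by simp
  have h3: "((\<lambda>s. - ?p s * e) has_integral - (-1) * e) ?I"
    by (intro has_integral_mult_left has_integral_neg hp)
  have "norm (integral ?I (\<lambda>s. of_real (?p s) * ?g1 s) - 1 / (4 * of_real pi)) \<le> integral ?I (\<lambda>s. - ?p s * e)"
    unfolding integral_unique[OF h2, symmetric]
  proof (rule integral_norm_bound_integral)
    fix s assume s: "s \<in> ?I"
    have p0: "?p s \<le> 0" using cutoff_props(3) r2 by (simp add: divide_nonpos_pos)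
    show "norm (of_real (?p s) * (?g1 s + 1 / (4 * of_real pi))) \<le> - ?p s * e"
      unfolding norm_mult norm_of_real abs_of_nonpos[OF p0] using near[OF s] p0 by (intro mult_left_mono) auto
  qed (rule has_integral_integrable[OF h2] has_integral_integrable[OF h3])+
  also have "\<dots> = e" using integral_unique[OF h3] by simp
  finally have n: "norm (integral ?I (\<lambda>s. of_real (?p s) * ?g1 s) - 1 / (4 * of_real pi)) \<le> e" .
  have "(LINT x|lborel. centred_kernel w \<rho> (sq_dist b x)) - 1 = of_real (4 * pi) * (integral ?I (\<lambda>s. of_real (?p s) * ?g1 s) - 1 / (4 * of_real pi))"
    unfolding centred_kernel_plane_integral(2)[OF r] by (simp add: right_diff_distrib)
  then have "norm ((LINT x|lborel. centred_kernel w \<rho> (sq_dist b x)) - 1) = 4 * pi * norm (integral ?I (\<lambda>s. of_real (?p s) * ?g1 s) - 1 / (4 * of_real pi))"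
    by (simp only: norm_mult norm_of_real) simp
  also have "\<dots> \<le> 4 * pi * e" using n by (intro mult_left_mono) auto
  finally show ?thesis .
qed

section \<open>Cutting off the Green function at its pole\<close>

text \<open>
  For \<open>s \<le> t \<le> 2 s\<close> the logarithm varies by at most \<open>ln 2\<close>, so the profile oscillates by a bounded amount
  although it is unbounded.
\<close>

lemma green_profile_near_0:
  obtains s0 where "s0 > 0"
    "\<And>s. 0 < s \<Longrightarrow> s < s0 \<Longrightarrow> norm (green_profile' w (of_real s)) \<le> 2"
    "\<And>s t. 0 < s \<Longrightarrow> s < s0 \<Longrightarrow> s \<le> t \<Longrightarrow> t \<le> 2 * s \<Longrightarrow> t < s0 \<Longrightarrow> norm (green_profile w (of_real t) - green_profile w (of_real s)) \<le> 3"
proof -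
  let ?m = "(- euler_mascheroni - Ln (- \<i> * w / 2)) / (2 * of_real pi) :: complex"
  have "\<forall>\<^sub>F s in at_right (0::real). dist (green_profile' w (of_real s)) (- 1 / (4 * of_real pi)) < 1"
    using tendstoD[OF green_profile_at_0(2)[of w], of 1] by simp
  moreover have "\<forall>\<^sub>F s in at_right (0::real). dist (green_profile w (of_real s) + of_real (ln s / (4 * pi))) ?m < 1"
    using tendstoD[OF green_profile_at_0(1)[of w], of 1] by simp
  ultimately have "\<forall>\<^sub>F s in at_right (0::real). dist (green_profile' w (of_real s)) (- 1 / (4 * of_real pi)) < 1 \<and>
      dist (green_profile w (of_real s) + of_real (ln s / (4 * pi))) ?m < 1" by (rule eventually_conj)
  then obtain s0 where s0: "s0 > 0" "\<And>s. 0 < s \<Longrightarrow> s < s0 \<Longrightarrow> dist (green_profile' w (of_real s)) (- 1 / (4 * of_real pi)) < 1"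
      "\<And>s. 0 < s \<Longrightarrow> s < s0 \<Longrightarrow> dist (green_profile w (of_real s) + of_real (ln s / (4 * pi))) ?m < 1"
    unfolding eventually_at_right_field by auto
  show ?thesis
  proof (rule that[OF s0(1)])
    fix s :: real assume s: "0 < s" "s < s0"
    have "norm (- 1 / (4 * complex_of_real pi)) \<le> 1" using pi_gt3 by (simp add: norm_divide)
    then show "norm (green_profile' w (of_real s)) \<le> 2"
      using s0(2)[OF s] norm_triangle_sub[of "green_profile' w (of_real s)" "- 1 / (4 * complex_of_real pi)"] by (simp add: dist_norm)
    fix t :: real assume t: "s \<le> t" "t \<le> 2 * s" "t < s0"
    have t0: "0 < t" using s t by simp
    let ?a = "green_profile w (of_real t) + of_real (ln t / (4 * pi))" and ?b = "green_profile w (of_real s) + of_real (ln s / (4 * pi))"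
    have "dist ?a ?b \<le> dist ?a ?m + dist ?b ?m" by (rule dist_triangle2)
    then have ab: "norm (?a - ?b) < 2" using s0(3)[OF t0 t(3)] s0(3)[OF s] by (simp only: dist_norm)
    have "ln s \<le> ln t" using s t t0 by simp
    moreover have "ln t \<le> ln 2 + ln s" using ln_mult[of 2 s] ln_le_cancel_iff[of t "2 * s"] s t t0 by simp
    moreover have "ln (2::real) \<le> 1" by (rule order.trans[OF ln_le_minus_one]) auto
    ultimately have l: "0 \<le> ln t - ln s" "ln t - ln s \<le> 1" by auto
    have "norm (complex_of_real ((ln t - ln s) / (4 * pi))) = (ln t - ln s) / (4 * pi)"
      unfolding norm_of_real using l by simp
    also have "\<dots> \<le> 1 / 1" using l pi_gt3 by (intro frac_le) auto
    finally have c: "norm (complex_of_real ((ln t - ln s) / (4 * pi))) \<le> 1" by simp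
    have "green_profile w (of_real t) - green_profile w (of_real s) = (?a - ?b) - complex_of_real ((ln t - ln s) / (4 * pi))"
      by (simp add: diff_divide_distrib)
    also have "norm \<dots> \<le> norm (?a - ?b) + norm (complex_of_real ((ln t - ln s) / (4 * pi)))" by (rule norm_triangle_ineq4)
    finally show "norm (green_profile w (of_real t) - green_profile w (of_real s)) \<le> 3" using ab c by linarith
  qed
qed

lemma green_profile_times_radius:
  assumes d: "\<And>n. \<delta> n > 0" "\<delta> \<longlonglongrightarrow> 0"
  shows "(\<lambda>n. green_profile w (of_real ((\<delta> n)\<^sup>2)) * of_real (\<delta> n)) \<longlonglongrightarrow> 0"
proof -
  have dr: "filterlim \<delta> (at_right 0) sequentially"
    using d(2) less_imp_neq[OF d(1)] d(1) by (auto simp: filterlim_at intro!: always_eventually)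
  have sq: "filterlim (\<lambda>x::real. x\<^sup>2) (at_right 0) (at_right 0)" by real_asymp
  note lim = filterlim_compose[OF filterlim_compose[OF green_profile_at_0(1)[of w] sq] dr]
  have "((\<lambda>x::real. ln (x\<^sup>2) / (4 * pi) * x) \<longlongrightarrow> 0) (at_right 0)" by real_asymp
  from tendsto_of_real[OF filterlim_compose[OF this dr]]
  have l: "(\<lambda>n. complex_of_real (ln ((\<delta> n)\<^sup>2) / (4 * pi) * \<delta> n)) \<longlonglongrightarrow> of_real 0" .
  have "(\<lambda>n. (green_profile w (of_real ((\<delta> n)\<^sup>2)) + of_real (ln ((\<delta> n)\<^sup>2) / (4 * pi))) * of_real (\<delta> n) - complex_of_real (ln ((\<delta> n)\<^sup>2) / (4 * pi) * \<delta> n))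
     \<longlonglongrightarrow> ((- euler_mascheroni - Ln (- \<i> * w / 2)) / (2 * of_real pi)) * of_real 0 - of_real 0"
    by (intro tendsto_diff tendsto_mult lim l tendsto_of_real d)
  moreover have "(a + of_real l) * of_real e - complex_of_real (l * e) = a * of_real e" for a l e
    by (simp add: algebra_simps)
  ultimately show ?thesis by (simp only:) simp
qed

text \<open>
  Let \<open>k\<close> be the centred kernel and \<open>g\<close> the value of \<open>G\<close> on the inner circle. The commutator is
  \<open>k + g \<Delta>\<chi>\<close>. As \<open>k\<close> has mass tending to 1 and size \<open>O(1/\<rho>\<^sup>2)\<close> on a disc of radius \<open>2\<rho>\<close>, continuity of \<open>f\<close> gives
  \<open>f(b)\<close> for the first summand. In the second one the equation replaces \<open>\<Delta>\<chi>\<close> by \<open>- z \<chi>\<close>, so it is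
  \<open>O(ln \<rho>)\<close> times the mass of \<open>f\<close>, which tends to 0.
\<close>

lemma commutator_at_centre:
  assumes w: "weak_helmholtz X z f" and f: "square_integrable f" and fc: "isCont f b"
    and X: "cball b (2 * d) \<inter> X = {}" and d: "\<And>n. \<delta> n > 0" "\<And>n. \<delta> n \<le> d" "\<delta> \<longlonglongrightarrow> 0"
  shows "(\<lambda>n. LINT x|lborel. commutator (disc_cutoff b (\<delta> n)) (green w b) x * f x) \<longlonglongrightarrow> f b"
proof -
  obtain M where M: "M \<ge> 1" "\<And>a \<rho> x. \<rho> > 0 \<Longrightarrow> \<bar>disc_cutoff a \<rho> x\<bar> \<le> M"
    "\<And>a \<rho> x. \<rho> > 0 \<Longrightarrow> \<bar>laplacian (disc_cutoff a \<rho>) x\<bar> \<le> M / \<rho>\<^sup>2" "\<And>s. \<bar>cutoff1 s\<bar> \<le> M"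
    using disc_cutoff_bounds by metis
  obtain s0 where s0: "s0 > 0" "\<And>s. 0 < s \<Longrightarrow> s < s0 \<Longrightarrow> norm (green_profile' w (of_real s)) \<le> 2"
    "\<And>s t. 0 < s \<Longrightarrow> s < s0 \<Longrightarrow> s \<le> t \<Longrightarrow> t \<le> 2 * s \<Longrightarrow> t < s0 \<Longrightarrow> norm (green_profile w (of_real t) - green_profile w (of_real s)) \<le> 3"
    using green_profile_near_0 by metis
  let ?k = "\<lambda>\<rho> x. centred_kernel w \<rho> (sq_dist b x)"
  let ?l = "\<lambda>\<rho> x. complex_of_real (laplacian (disc_cutoff b \<rho>) x)"
  let ?g = "\<lambda>\<rho>. green_profile w (of_real (\<rho>\<^sup>2))"
  have k_eq: "?k \<rho> x = radial_commutator w \<rho> (sq_dist b x) + ?l \<rho> x * (green w b x - ?g \<rho>)" if r: "\<rho> > 0" for \<rho> x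
    unfolding centred_kernel_def laplacian_disc_cutoff[OF r] green_def ..
  have kz: "?k \<rho> x = 0" if "\<rho> > 0" "x \<notin> cball b (2 * \<rho>)" for \<rho> x
  proof (rule centred_kernel_zero[OF that(1)])
    show "sq_dist b x \<notin> {\<rho>\<^sup>2..2 * \<rho>\<^sup>2}" using sq_dist_le_imp_cball[of b x \<rho>] that by auto
  qed
  have lz: "?l \<rho> x = 0" if "\<rho> > 0" "x \<notin> cball b (2 * \<rho>)" for \<rho> x
    using disc_cutoff_values(4)[OF that(1), of x b] annulus_subset_cball[of \<rho> b] that by (metis less_imp_le of_real_0 subsetD)
  \<comment> \<open>\<open>19 = 8 \<cdot> 2 + 3\<close>, from the two bounds of \<open>green_profile_near_0\<close>.\<close>
  have kb: "norm (?k \<rho> x) \<le> 19 * M / \<rho>\<^sup>2" if r: "\<rho> > 0" and sm: "2 * \<rho>\<^sup>2 < s0" for \<rho> x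
  proof (cases "sq_dist b x \<in> {\<rho>\<^sup>2..2 * \<rho>\<^sup>2}")
    case True
    have r2: "\<rho>\<^sup>2 > 0" using r by simp
    have s: "0 < sq_dist b x" by (rule less_le_trans[OF r2]) (use True in simp)
    have s1: "sq_dist b x < s0" "\<rho>\<^sup>2 < s0" using True sm by auto
    have "norm (radial_commutator w \<rho> (sq_dist b x)) = 8 * (\<bar>cutoff1 (sq_dist b x / \<rho>\<^sup>2)\<bar> / \<rho>\<^sup>2) * norm (green_profile' w (of_real (sq_dist b x)))"
      unfolding radial_commutator_def norm_mult norm_of_real abs_divide by simp
    also have "\<dots> \<le> 8 * (M / \<rho>\<^sup>2) * 2"
      using M(1,4) s0(2)[OF s s1(1)] by (intro mult_mono divide_right_mono) auto
    finally have b1: "norm (radial_commutator w \<rho> (sq_dist b x)) \<le> 8 * (M / \<rho>\<^sup>2) * 2" .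
    have b2: "norm (?l \<rho> x * (green w b x - ?g \<rho>)) \<le> (M / \<rho>\<^sup>2) * 3"
      unfolding norm_mult norm_of_real green_def
      using M(1) M(3)[OF r] s0(3)[OF r2 s1(2), of "sq_dist b x"] True s1(1) by (intro mult_mono) auto
    have "norm (?k \<rho> x) \<le> 8 * (M / \<rho>\<^sup>2) * 2 + (M / \<rho>\<^sup>2) * 3"
      unfolding k_eq[OF r] by (rule order.trans[OF norm_triangle_ineq add_mono[OF b1 b2]])
    then show ?thesis by simp
  qed (use centred_kernel_zero[OF r] M(1) in auto)
  have km: "?k \<rho> \<in> borel_measurable borel" if "\<rho> > 0" for \<rho> by (rule centred_kernel_plane_integral(1)[OF that])
  have ev_small: "\<forall>\<^sub>F n in sequentially. 2 * (\<delta> n)\<^sup>2 < e" if "e > 0" for e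
  proof -
    have "(\<lambda>n. 2 * (\<delta> n)\<^sup>2) \<longlonglongrightarrow> 2 * 0\<^sup>2" by (intro tendsto_intros d)
    then show ?thesis using that by (intro order_tendstoD) auto
  qed
  have ikf: "integrable lborel (\<lambda>x. ?k \<rho> x * f x)" if r: "\<rho> > 0" "2 * \<rho>\<^sup>2 < s0" for \<rho>
    by (rule integral_kernel_bound(1)[OF f km[OF r(1)] kb[OF r] kz[OF r(1)]])
  have ik: "integrable lborel (?k \<rho>)" if r: "\<rho> > 0" "2 * \<rho>\<^sup>2 < s0" for \<rho>
  proof (rule Bochner_Integration.integrable_bound[OF integrable_mult_left[OF integrable_indicator_cball, of b "2 * \<rho>" "19 * M / \<rho>\<^sup>2"]])
    show "?k \<rho> \<in> borel_measurable lborel" using km[OF r(1)] by simp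
    show "AE x in lborel. norm (?k \<rho> x) \<le> norm (indicator (cball b (2 * \<rho>)) x * (19 * M / \<rho>\<^sup>2))"
    proof (intro always_eventually allI)
      fix x
      have "\<bar>19 * M\<bar> = 19 * M" using M(1) by simp
      then show "norm (?k \<rho> x) \<le> norm (indicator (cball b (2 * \<rho>)) x * (19 * M / \<rho>\<^sup>2))"
        using kb[OF r, of x] kz[OF r(1), of x] by (cases "x \<in> cball b (2 * \<rho>)") (auto intro: order.trans[OF _ abs_ge_self])
    qed
  qed
  have T1: "(\<lambda>n. LINT x|lborel. ?k (\<delta> n) x * (f x - f b)) \<longlonglongrightarrow> 0"
  proof (rule LIMSEQ_I)
    fix e :: real assume e: "e > 0"
    \<comment> \<open>\<open>76 \<pi> M\<close> is the area \<open>4 \<pi> \<rho>\<^sup>2\<close> of the disc times the bound \<open>19 M / \<rho>\<^sup>2\<close> of the kernel.\<close>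
    define e1 where "e1 = e / (76 * pi * M + 1)"
    have den: "76 * pi * M + 1 > 0" using M(1) pi_gt_zero by (intro add_nonneg_pos mult_nonneg_nonneg) auto
    have e1: "e1 > 0" unfolding e1_def using e den by simp
    obtain r1 where r1: "r1 > 0" "\<And>x. dist x b < r1 \<Longrightarrow> dist (f x) (f b) < e1"
      using fc e1 unfolding continuous_at_eps_delta by (auto simp: dist_commute)
    have "(\<lambda>n. 2 * \<delta> n) \<longlonglongrightarrow> 0" using tendsto_mult_right_zero[OF d(3)] .
    then have "\<forall>\<^sub>F n in sequentially. 2 * \<delta> n < r1" by (rule order_tendstoD) (rule r1)
    with ev_small[OF s0(1)] have "\<forall>\<^sub>F n in sequentially. norm ((LINT x|lborel. ?k (\<delta> n) x * (f x - f b)) - 0) < e"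
    proof eventually_elim
      case (elim n)
      let ?\<rho> = "\<delta> n"
      have r: "?\<rho> > 0" by (rule d)
      have pw: "norm (?k ?\<rho> x * (f x - f b)) \<le> indicator (cball b (2 * ?\<rho>)) x * (19 * M / ?\<rho>\<^sup>2 * e1)" for x
      proof (cases "x \<in> cball b (2 * ?\<rho>)")
        case True
        then have "dist x b < r1" using elim by (simp add: dist_commute)
        then have "norm (f x - f b) \<le> e1" using r1(2)[of x] by (simp add: dist_norm)
        then have "norm (?k ?\<rho> x) * norm (f x - f b) \<le> 19 * M / ?\<rho>\<^sup>2 * e1"
          using kb[OF r elim(1), of x] M(1) by (intro mult_mono) auto
        then show ?thesis using True by (simp add: norm_mult)
      next
        case False
        then show ?thesis using kz[OF r False] by simp
      qed
      have "integrable lborel (\<lambda>x. ?k ?\<rho> x * f x - ?k ?\<rho> x * f b)"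
        by (intro Bochner_Integration.integrable_diff ikf[OF r elim(1)] integrable_mult_left ik[OF r elim(1)])
      then have "integrable lborel (\<lambda>x. ?k ?\<rho> x * (f x - f b))" by (simp add: right_diff_distrib)
      then have "norm (LINT x|lborel. ?k ?\<rho> x * (f x - f b)) \<le> (LINT x|lborel. indicator (cball b (2 * ?\<rho>)) x * (19 * M / ?\<rho>\<^sup>2 * e1))"
        by (rule Bochner_Integration.integral_norm_bound_integral[OF _ integrable_mult_left[OF integrable_indicator_cball] pw])
      also have "\<dots> = pi * (2 * ?\<rho>)\<^sup>2 * (19 * M / ?\<rho>\<^sup>2 * e1)"
        using integral_indicator_cball[of "2 * ?\<rho>" b] r by (simp only: integral_mult_left_zero)
      also have "\<dots> = 76 * pi * M * e1" using r by (simp add: power_mult_distrib)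
      also have "\<dots> < e"
      proof -
        have "76 * pi * M * e1 < (76 * pi * M + 1) * e1" using e1 by simp
        also have "\<dots> = e" unfolding e1_def using den by simp
        finally show ?thesis .
      qed
      finally show ?case by simp
    qed
    then show "\<exists>no. \<forall>n\<ge>no. norm ((LINT x|lborel. ?k (\<delta> n) x * (f x - f b)) - 0) < e"
      unfolding eventually_sequentially .
  qed
  have K1: "(\<lambda>n. LINT x|lborel. ?k (\<delta> n) x) \<longlonglongrightarrow> 1"
  proof (rule LIMSEQ_I)
    fix e :: real assume e: "e > 0"
    define e1 where "e1 = e / (8 * pi)"
    have e1: "e1 > 0" using e by (simp add: e1_def)
    have "\<forall>\<^sub>F s in at_right (0::real). dist (green_profile' w (of_real s)) (- 1 / (4 * of_real pi)) < e1"
      using tendstoD[OF green_profile_at_0(2)[of w] e1] .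
    then obtain s1 where s1: "s1 > 0" "\<And>s. 0 < s \<Longrightarrow> s < s1 \<Longrightarrow> dist (green_profile' w (of_real s)) (- 1 / (4 * of_real pi)) < e1"
      unfolding eventually_at_right_field by auto
    have "\<forall>\<^sub>F n in sequentially. norm ((LINT x|lborel. ?k (\<delta> n) x) - 1) < e"
      using ev_small[OF s1(1)]
    proof eventually_elim
      case (elim n)
      have r2: "(\<delta> n)\<^sup>2 > 0" using d(1)[of n] by simp
      have "norm ((LINT x|lborel. ?k (\<delta> n) x) - 1) \<le> 4 * pi * e1"
      proof (rule centred_kernel_mass[OF d(1) less_imp_le[OF e1]])
        fix s assume s: "s \<in> {(\<delta> n)\<^sup>2..2 * (\<delta> n)\<^sup>2}"
        have "0 < s" by (rule less_le_trans[OF r2]) (use s in simp)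
        then have "dist (green_profile' w (of_real s)) (- 1 / (4 * of_real pi)) < e1" using s elim by (intro s1(2)) auto
        then show "norm (green_profile' w (of_real s) + 1 / (4 * of_real pi)) \<le> e1" by (simp add: dist_norm)
      qed
      also have "\<dots> < e" using e by (simp add: e1_def)
      finally show ?case .
    qed
    then show "\<exists>no. \<forall>n\<ge>no. norm ((LINT x|lborel. ?k (\<delta> n) x) - 1) < e" unfolding eventually_sequentially .
  qed
  have T3: "(\<lambda>n. ?g (\<delta> n) * (LINT x|lborel. ?l (\<delta> n) x * f x)) \<longlonglongrightarrow> 0"
  proof -
    have "(\<lambda>n. norm (?g (\<delta> n) * of_real (\<delta> n)) * (norm z * M * (mass f b (\<delta> n) / \<delta> n))) \<longlonglongrightarrow> norm (0::complex) * (norm z * M * 0)"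
      by (intro tendsto_mult tendsto_norm green_profile_times_radius d mass_over_radius_tendsto_0 f tendsto_const)
    then have lim: "(\<lambda>n. norm (?g (\<delta> n) * of_real (\<delta> n)) * (norm z * M * (mass f b (\<delta> n) / \<delta> n))) \<longlonglongrightarrow> 0" by simp
    show ?thesis
    proof (rule Lim_null_comparison[OF _ lim], intro always_eventually allI)
      fix n
      have r: "\<delta> n > 0" by (rule d)
      have "cball b (2 * \<delta> n) \<subseteq> cball b (2 * d)" using d(2)[of n] by (intro subset_cball) simp
      then have "cball b (2 * \<delta> n) \<inter> X = {}" using X by blast
      note eq = weak_helmholtz_on_cutoff[OF w this r]
      have "norm (?g (\<delta> n) * (LINT x|lborel. ?l (\<delta> n) x * f x)) = norm (?g (\<delta> n)) * (norm z * norm (LINT x|lborel. of_real (disc_cutoff b (\<delta> n) x) * f x))"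
        unfolding eq norm_mult by simp
      also have "\<dots> \<le> norm (?g (\<delta> n)) * (norm z * (M * mass f b (\<delta> n)))"
        using disc_cutoff_integral_bound(2)[OF f M(2)[OF r] r] by (intro mult_left_mono) auto
      also have "\<dots> = norm (?g (\<delta> n) * of_real (\<delta> n)) * (norm z * M * (mass f b (\<delta> n) / \<delta> n))"
        using r unfolding norm_mult norm_of_real by simp
      finally show "norm (?g (\<delta> n) * (LINT x|lborel. ?l (\<delta> n) x * f x)) \<le> norm (?g (\<delta> n) * of_real (\<delta> n)) * (norm z * M * (mass f b (\<delta> n) / \<delta> n))" .
    qed
  qed
  have "(\<lambda>n. (LINT x|lborel. ?k (\<delta> n) x * (f x - f b)) + (LINT x|lborel. ?k (\<delta> n) x) * f b + ?g (\<delta> n) * (LINT x|lborel. ?l (\<delta> n) x * f x)) \<longlonglongrightarrow> 0 + 1 * f b + 0"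
    by (intro tendsto_add tendsto_mult T1 K1 T3 tendsto_const)
  then have lim: "(\<lambda>n. (LINT x|lborel. ?k (\<delta> n) x * (f x - f b)) + (LINT x|lborel. ?k (\<delta> n) x) * f b + ?g (\<delta> n) * (LINT x|lborel. ?l (\<delta> n) x * f x)) \<longlonglongrightarrow> f b" by simp
  show ?thesis
  proof (rule Lim_transform_eventually[OF lim])
    show "\<forall>\<^sub>F n in sequentially. (LINT x|lborel. ?k (\<delta> n) x * (f x - f b)) + (LINT x|lborel. ?k (\<delta> n) x) * f b + ?g (\<delta> n) * (LINT x|lborel. ?l (\<delta> n) x * f x)
       = (LINT x|lborel. commutator (disc_cutoff b (\<delta> n)) (green w b) x * f x)"
      using ev_small[OF s0(1)]
    proof eventually_elim
      case (elim n)
      let ?\<rho> = "\<delta> n"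
      have r: "?\<rho> > 0" by (rule d)
      note i1 = ikf[OF r elim] and i2 = integrable_mult_left[OF ik[OF r elim], of "f b"]
      have i3: "integrable lborel (\<lambda>x. ?l ?\<rho> x * f x)"
        by (rule integral_kernel_bound(1)[OF f laplacian_disc_cutoff_measurable, of b ?\<rho> b ?\<rho> "M / ?\<rho>\<^sup>2"])
          (use M(3)[OF r] lz[OF r] in auto)
      have "(LINT x|lborel. ?k ?\<rho> x * (f x - f b)) = (LINT x|lborel. ?k ?\<rho> x * f x - ?k ?\<rho> x * f b)"
        by (simp only: right_diff_distrib)
      also have "\<dots> = (LINT x|lborel. ?k ?\<rho> x * f x) - (LINT x|lborel. ?k ?\<rho> x) * f b"
        unfolding Bochner_Integration.integral_diff[OF i1 i2] by (simp only: integral_mult_left_zero)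
      finally have e1: "(LINT x|lborel. ?k ?\<rho> x * (f x - f b)) + (LINT x|lborel. ?k ?\<rho> x) * f b = (LINT x|lborel. ?k ?\<rho> x * f x)" by simp
      have "(LINT x|lborel. commutator (disc_cutoff b ?\<rho>) (green w b) x * f x) = (LINT x|lborel. ?k ?\<rho> x * f x + ?g ?\<rho> * (?l ?\<rho> x * f x))"
        by (intro Bochner_Integration.integral_cong refl) (simp add: commutator_green_centre[OF r] k_eq[OF r] algebra_simps)
      also have "\<dots> = (LINT x|lborel. ?k ?\<rho> x * f x) + ?g ?\<rho> * (LINT x|lborel. ?l ?\<rho> x * f x)"
        unfolding Bochner_Integration.integral_add[OF i1 integrable_mult_right[OF i3]] by (simp only: integral_mult_right_zero)
      finally show ?case unfolding e1 by simp
    qed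
  qed
qed

section \<open>Representation of square integrable solutions\<close>

lemma finite_separation:
  assumes "finite (Y::(real^2) set)"
  obtains d where "d > 0" "\<And>a a'. a \<in> Y \<Longrightarrow> a' \<in> Y \<Longrightarrow> a \<noteq> a' \<Longrightarrow> d \<le> dist a a'"
proof -
  let ?S = "(\<lambda>(a, a'). dist a a') ` {(a, a'). a \<in> Y \<and> a' \<in> Y \<and> a \<noteq> a'}"
  have "{(a, a'). a \<in> Y \<and> a' \<in> Y \<and> a \<noteq> a'} \<subseteq> Y \<times> Y" by auto
  then have fin: "finite ?S" using assms finite_subset by blast
  show ?thesis
  proof (rule that[of "Min (insert 1 ?S)"])
    show "0 < Min (insert 1 ?S)" using fin by (subst Min_gr_iff) auto
    show "Min (insert 1 ?S) \<le> dist a a'" if "a \<in> Y" "a' \<in> Y" "a \<noteq> a'" for a a'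
      by (rule Min_le) (use fin that in auto)
  qed
qed

text \<open>
  The cutoff to the large disc minus the cutoffs to small discs around \<open>b\<close> and all points of \<open>X\<close> vanishes
  near these points. The separation by \<open>5 \<delta>\<close> keeps the discs of radius \<open>2 \<delta>\<close> apart.
\<close>

lemma excised_cutoff_identity:
  assumes w: "weak_helmholtz X z f" "z = w\<^sup>2" and f: "square_integrable f" and X: "finite X" "b \<notin> X"
    and sep: "\<And>a a'. a \<in> insert b X \<Longrightarrow> a' \<in> insert b X \<Longrightarrow> a \<noteq> a' \<Longrightarrow> 5 * \<delta> \<le> dist a a'"
    and far: "\<And>a. a \<in> insert b X \<Longrightarrow> dist b a + 2 * \<delta> \<le> R" and d: "\<delta> > 0"
  shows "(LINT x|lborel. commutator (disc_cutoff b R) (green w b) x * f x)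
     = (\<Sum>a\<in>insert b X. LINT x|lborel. commutator (disc_cutoff a \<delta>) (green w b) x * f x)"
proof -
  let ?Y = "insert b X" and ?G = "green w b"
  have R: "R > 0" using far[of b] d by simp
  have finY: "finite ?Y" using X by simp
  define \<psi> where "\<psi> = (\<lambda>x. disc_cutoff b R x - (\<Sum>a\<in>?Y. disc_cutoff a \<delta> x))"
  have ssum: "smooth_on UNIV (\<lambda>x. \<Sum>a\<in>?Y. disc_cutoff a \<delta> x)" by (intro smooth_on_sum smooth_disc_cutoff) auto
  have s: "smooth_on UNIV \<psi>" unfolding \<psi>_def by (intro smooth_on_diff smooth_disc_cutoff ssum) auto
  let ?K = "{x. 0 \<le> sq_dist b x \<and> sq_dist b x \<le> 2 * R\<^sup>2} \<inter> (\<Inter>a\<in>?Y. {x. \<delta>\<^sup>2 \<le> sq_dist a x})"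
  have small0: "disc_cutoff a \<delta> x = 0" if "2 * \<delta> < dist a x" for a x
    by (rule disc_cutoff_values(2)[OF d]) (use sq_dist_le_imp_cball[of a x \<delta>] d that in \<open>auto intro: ccontr\<close>)
  have zero: "(LINT x|lborel. commutator \<psi> ?G x * f x) = 0"
  proof (rule helmholtz_commutator_identity[OF w(1) f s])
    show "compact ?K"
      by (intro compact_Int_closed compact_sq_dist_between closed_INT ballI closed_Collect_le sq_dist_cont continuous_on_const)
    have nK: "a \<notin> ?K" if "a \<in> ?Y" for a
    proof
      assume "a \<in> ?K"
      then have "\<delta>\<^sup>2 \<le> sq_dist a a" using that by blast
      then show False using d by (simp add: sq_dist_def)
    qed
    show "b \<notin> ?K" by (rule nK) simp
    show "?K \<subseteq> - X" using nK by blast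
    show "smooth_on (- {b}) ?G" by (rule smooth_on_green)
    show "laplacian ?G x = - z * ?G x" if "x \<noteq> b" for x unfolding w(2) by (rule laplacian_green[OF that])
    fix x assume x: "x \<notin> ?K"
    \<comment> \<open>Near a point of \<open>insert b X\<close> the large cutoff and exactly one small cutoff are 1;
      far out all of them vanish.\<close>
    show "\<psi> x = 0"
    proof (cases "\<exists>a\<in>?Y. sq_dist a x < \<delta>\<^sup>2")
      case True
      then obtain a where a: "a \<in> ?Y" "sq_dist a x < \<delta>\<^sup>2" by blast
      have ax: "dist a x < \<delta>"
      proof -
        have "norm (x - a) < \<delta>" by (rule power_less_imp_less_base[of _ 2]) (use a(2) d in \<open>simp_all add: sq_dist_def\<close>)
        then show ?thesis by (simp add: dist_norm norm_minus_commute)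
      qed
      have one: "disc_cutoff a \<delta> x = 1" by (rule disc_cutoff_values(1)[OF d]) (use a in simp)
      have zero: "disc_cutoff a' \<delta> x = 0" if "a' \<in> ?Y - {a}" for a'
      proof (rule small0)
        have "5 * \<delta> \<le> dist a' a" using sep[of a' a] that a(1) by auto
        also have "\<dots> \<le> dist a' x + dist a x" by (rule dist_triangle2)
        finally show "2 * \<delta> < dist a' x" using ax d by simp
      qed
      have "(\<Sum>a'\<in>?Y. disc_cutoff a' \<delta> x) = disc_cutoff a \<delta> x + (\<Sum>a'\<in>?Y - {a}. disc_cutoff a' \<delta> x)"
        by (rule sum.remove[OF finY a(1)])
      also have "(\<Sum>a'\<in>?Y - {a}. disc_cutoff a' \<delta> x) = 0" by (rule sum.neutral) (use zero in blast)
      finally have sum1: "(\<Sum>a'\<in>?Y. disc_cutoff a' \<delta> x) = 1" using one by simp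
      have "dist b x \<le> dist b a + dist a x" by (rule dist_triangle)
      then have "norm (x - b) \<le> R" using far[OF a(1)] ax d by (simp add: dist_norm norm_minus_commute)
      then have "sq_dist b x \<le> R\<^sup>2" unfolding sq_dist_def by (intro power_mono) auto
      then have "disc_cutoff b R x = 1" by (rule disc_cutoff_values(1)[OF R])
      then show ?thesis using sum1 by (simp add: \<psi>_def)
    next
      case False
      then have "x \<in> (\<Inter>a\<in>?Y. {x. \<delta>\<^sup>2 \<le> sq_dist a x})" by (auto simp: not_less)
      then have "\<not> (0 \<le> sq_dist b x \<and> sq_dist b x \<le> 2 * R\<^sup>2)" using x by blast
      then have big: "sq_dist b x > 2 * R\<^sup>2" by (simp add: sq_dist_def)
      have bR: "R < dist b x"
      proof (rule ccontr)
        assume "\<not> R < dist b x"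
        then have "norm (x - b) \<le> R" by (simp add: dist_norm norm_minus_commute)
        then have "sq_dist b x \<le> R\<^sup>2" unfolding sq_dist_def by (intro power_mono) auto
        moreover have "R\<^sup>2 \<le> 2 * R\<^sup>2" by simp
        ultimately show False using big by linarith
      qed
      have "disc_cutoff a \<delta> x = 0" if "a \<in> ?Y" for a
      proof (rule small0)
        have "dist b x \<le> dist b a + dist a x" by (rule dist_triangle)
        then show "2 * \<delta> < dist a x" using bR far[OF that] by linarith
      qed
      then have "(\<Sum>a\<in>?Y. disc_cutoff a \<delta> x) = 0" by (intro sum.neutral) blast
      moreover have "disc_cutoff b R x = 0" by (rule disc_cutoff_values(2)[OF R]) (use big in simp)
      ultimately show ?thesis by (simp add: \<psi>_def)
    qed
  qed
  have cm: "commutator \<psi> ?G x = commutator (disc_cutoff b R) ?G x - (\<Sum>a\<in>?Y. commutator (disc_cutoff a \<delta>) ?G x)" for x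
    unfolding \<psi>_def commutator_diff[OF smooth_disc_cutoff ssum] commutator_sum[OF finY smooth_disc_cutoff] ..
  have int: "integrable lborel (\<lambda>x. commutator (disc_cutoff a \<rho>) ?G x * f x)" if "\<rho> > 0" "b \<notin> annulus a \<rho>" for a \<rho>
    by (rule integrable_compact_kernel[OF f commutator_disc_cutoff_continuous(1)[OF that] compact_annulus commutator_disc_cutoff_continuous(2)[OF that]])
  have nb: "b \<notin> annulus b \<rho>" if "\<rho> > 0" for \<rho> using that by (auto simp: annulus_def sq_dist_def)
  have na: "b \<notin> annulus a \<delta>" if "a \<in> ?Y" for a
  proof (cases "a = b")
    case False
    then have "5 * \<delta> \<le> dist a b" using sep[of a b] that by simp
    then show ?thesis using annulus_subset_cball[of \<delta> a] d by auto
  qed (use nb[OF d] in simp)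
  have "(LINT x|lborel. commutator \<psi> ?G x * f x)
     = (LINT x|lborel. commutator (disc_cutoff b R) ?G x * f x - (\<Sum>a\<in>?Y. commutator (disc_cutoff a \<delta>) ?G x * f x))"
    unfolding cm left_diff_distrib sum_distrib_right ..
  also have "\<dots> = (LINT x|lborel. commutator (disc_cutoff b R) ?G x * f x) - (LINT x|lborel. (\<Sum>a\<in>?Y. commutator (disc_cutoff a \<delta>) ?G x * f x))"
    by (intro Bochner_Integration.integral_diff int[OF R nb[OF R]] Bochner_Integration.integrable_sum int[OF d na])
  also have "(LINT x|lborel. (\<Sum>a\<in>?Y. commutator (disc_cutoff a \<delta>) ?G x * f x)) = (\<Sum>a\<in>?Y. LINT x|lborel. commutator (disc_cutoff a \<delta>) ?G x * f x)"
    by (intro Bochner_Integration.integral_sum int[OF d na])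
  finally show ?thesis using zero by simp
qed

text \<open>
  The four limit theorems are applied along radii \<open>\<delta>\<^sub>n\<close> tending to 0 and \<open>R\<^sub>n\<close> tending to infinity in the
  excised identity, which in the limit reads \<open>0 = f(b) + \<Sum>\<^sub>p G(p - b) c\<^sub>p\<close>. The charges \<open>c\<^sub>p\<close> depend neither on
  \<open>b\<close> nor on the radii, so one choice serves all \<open>b\<close>.
\<close>

theorem helmholtz_representation:
  assumes wh: "weak_helmholtz X (w\<^sup>2) f" and f: "square_integrable f" and X: "finite X" and w: "Im w > 0"
    and fc: "\<And>x. x \<notin> X \<Longrightarrow> isCont f x"
  obtains c where "\<And>b. b \<notin> X \<Longrightarrow> f b = (\<Sum>p\<in>X. c p * green w b p)"
proof -
  obtain d0 where d0: "d0 > 0" "\<And>a a'. a \<in> X \<Longrightarrow> a' \<in> X \<Longrightarrow> a \<noteq> a' \<Longrightarrow> d0 \<le> dist a a'"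
    using finite_separation[OF X] by metis
  have "\<exists>c. \<forall>\<delta>. (\<forall>n. \<delta> n > 0) \<longrightarrow> (\<forall>n. \<delta> n \<le> d0 / 5) \<longrightarrow> \<delta> \<longlonglongrightarrow> 0 \<longrightarrow>
    (\<lambda>n. LINT x|lborel. of_real (laplacian (disc_cutoff p (\<delta> n)) x) * f x) \<longlonglongrightarrow> c" if p: "p \<in> X" for p
  proof -
    have sub: "cball p (2 * (d0 / 5)) \<inter> X \<subseteq> {p}"
    proof
      fix x assume x: "x \<in> cball p (2 * (d0 / 5)) \<inter> X"
      show "x \<in> {p}"
      proof (rule ccontr)
        assume "x \<notin> {p}"
        then have "d0 \<le> dist p x" using d0(2)[of p x] p x by auto
        then show False using x d0(1) by auto
      qed
    qed
    have d05: "d0 / 5 > 0" using d0(1) by simp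
    show ?thesis
    proof (rule charge_limit[OF wh f sub d05])
      fix c assume c: "\<And>\<delta>. (\<And>n. \<delta> n > 0) \<Longrightarrow> (\<And>n. \<delta> n \<le> d0 / 5) \<Longrightarrow> \<delta> \<longlonglongrightarrow> 0 \<Longrightarrow>
        (\<lambda>n. LINT x|lborel. of_real (laplacian (disc_cutoff p (\<delta> n)) x) * f x) \<longlonglongrightarrow> c"
      show ?thesis
      proof (intro exI[of _ c] allI impI)
        fix \<delta> :: "nat \<Rightarrow> real" assume h: "\<forall>n. \<delta> n > 0" "\<forall>n. \<delta> n \<le> d0 / 5" "\<delta> \<longlonglongrightarrow> 0"
        show "(\<lambda>n. LINT x|lborel. of_real (laplacian (disc_cutoff p (\<delta> n)) x) * f x) \<longlonglongrightarrow> c"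
          by (rule c[OF h(1)[THEN spec] h(2)[THEN spec] h(3)])
      qed
    qed
  qed
  then have "\<forall>p\<in>X. \<exists>c. \<forall>\<delta>. (\<forall>n. \<delta> n > 0) \<longrightarrow> (\<forall>n. \<delta> n \<le> d0 / 5) \<longrightarrow> \<delta> \<longlonglongrightarrow> 0 \<longrightarrow>
    (\<lambda>n. LINT x|lborel. of_real (laplacian (disc_cutoff p (\<delta> n)) x) * f x) \<longlonglongrightarrow> c" by (rule ballI)
  from bchoice[OF this] obtain c where c': "\<forall>p\<in>X. \<forall>\<delta>. (\<forall>n. \<delta> n > 0) \<longrightarrow> (\<forall>n. \<delta> n \<le> d0 / 5) \<longrightarrow> \<delta> \<longlonglongrightarrow> 0 \<longrightarrow>
    (\<lambda>n. LINT x|lborel. of_real (laplacian (disc_cutoff p (\<delta> n)) x) * f x) \<longlonglongrightarrow> c p" by (rule exE)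
  have c: "(\<lambda>n. LINT x|lborel. of_real (laplacian (disc_cutoff p (\<delta> n)) x) * f x) \<longlonglongrightarrow> c p"
    if "p \<in> X" "\<And>n. \<delta> n > 0" "\<And>n. \<delta> n \<le> d0 / 5" "\<delta> \<longlonglongrightarrow> 0" for p \<delta>
  proof -
    have "\<forall>n. \<delta> n > 0" "\<forall>n. \<delta> n \<le> d0 / 5" by (rule allI, rule that)+
    from c'[rule_format, OF that(1) this[THEN spec] that(4)] show ?thesis .
  qed
  show ?thesis
  proof (rule that[of "\<lambda>p. - c p"])
    fix b assume b: "b \<notin> X"
    let ?Y = "insert b X"
    have finY: "finite ?Y" using X by simp
    obtain d1 where d1: "d1 > 0" "\<And>a a'. a \<in> ?Y \<Longrightarrow> a' \<in> ?Y \<Longrightarrow> a \<noteq> a' \<Longrightarrow> d1 \<le> dist a a'"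
      using finite_separation[OF finY] by metis
    define d where "d = min d0 d1 / 5"
    have d: "d > 0" "d \<le> d0 / 5" "5 * d \<le> d1" using d0(1) d1(1) by (auto simp: d_def)
    define \<delta> where "\<delta> n = d * inverse (real (Suc n))" for n
    have dn: "\<delta> n > 0" "\<delta> n \<le> d" for n
      using d(1) by (auto simp: \<delta>_def field_simps intro: mult_left_le)
    have dl: "\<delta> \<longlonglongrightarrow> 0"
      unfolding \<delta>_def using tendsto_mult_right_zero[OF LIMSEQ_inverse_real_of_nat] by simp
    have dn0: "\<delta> n \<le> d0 / 5" for n using dn(2)[of n] d(2) by linarith
    define R0 where "R0 = (\<Sum>a\<in>?Y. dist b a) + 2 * d"
    have far: "dist b a + 2 * \<delta> n \<le> real n + R0" if "a \<in> ?Y" for a n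
    proof -
      have "dist b a \<le> (\<Sum>a\<in>?Y. dist b a)" by (rule member_le_sum[OF that]) (use finY in auto)
      then show ?thesis using dn(2)[of n] unfolding R0_def by linarith
    qed
    have Rl: "filterlim (\<lambda>n. real n + R0) at_top sequentially"
      by real_asymp
    let ?I = "\<lambda>a n. LINT x|lborel. commutator (disc_cutoff a (\<delta> n)) (green w b) x * f x"
    have eq: "(LINT x|lborel. commutator (disc_cutoff b (real n + R0)) (green w b) x * f x) = ?I b n + (\<Sum>p\<in>X. ?I p n)" for n
    proof -
      have "(LINT x|lborel. commutator (disc_cutoff b (real n + R0)) (green w b) x * f x) = (\<Sum>a\<in>?Y. ?I a n)"
      proof (rule excised_cutoff_identity[OF wh refl f X b _ far dn(1)])
        show "5 * \<delta> n \<le> dist a a'" if "a \<in> ?Y" "a' \<in> ?Y" "a \<noteq> a'" for a a'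
          using d1(2)[OF that] dn(2)[of n] d(3) by linarith
      qed
      then show ?thesis using X b by simp
    qed
    have lb: "(\<lambda>n. ?I b n) \<longlonglongrightarrow> f b"
    proof (rule commutator_at_centre[OF wh f fc[OF b] _ dn dl])
      show "cball b (2 * d) \<inter> X = {}"
      proof -
        have "d1 \<le> dist b x" if "x \<in> X" for x using d1(2)[of b x] that b by auto
        then show ?thesis using d(1,3) by fastforce
      qed
    qed
    have lp: "(\<lambda>n. ?I p n) \<longlonglongrightarrow> green w b p * c p" if p: "p \<in> X" for p
    proof -
      have pb: "p \<noteq> b" using p b by auto
      have "(\<lambda>n. (?I p n - green w b p * (LINT x|lborel. of_real (laplacian (disc_cutoff p (\<delta> n)) x) * f x))
          + green w b p * (LINT x|lborel. of_real (laplacian (disc_cutoff p (\<delta> n)) x) * f x)) \<longlonglongrightarrow> 0 + green w b p * c p"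
        by (intro tendsto_add tendsto_mult tendsto_const commutator_at_pole[OF f dn(1) dl pb] c[OF p dn(1) dn0 dl])
      then show ?thesis by simp
    qed
    have "(\<lambda>n. ?I b n + (\<Sum>p\<in>X. ?I p n)) \<longlonglongrightarrow> f b + (\<Sum>p\<in>X. green w b p * c p)"
      by (intro tendsto_add tendsto_sum lb lp)
    moreover have "(\<lambda>n. ?I b n + (\<Sum>p\<in>X. ?I p n)) \<longlonglongrightarrow> 0"
      using commutator_at_infinity[OF f w Rl, of b] unfolding eq .
    ultimately have "f b + (\<Sum>p\<in>X. green w b p * c p) = 0" by (rule LIMSEQ_unique)
    then show "f b = (\<Sum>p\<in>X. - c p * green w b p)"
      by (simp add: sum_negf mult.commute eq_neg_iff_add_eq_0)
  qed
qed

section \<open>Square integrability of the Green function\<close>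

lemma integrable_radial:
  fixes h :: "real \<Rightarrow> real"
  assumes [measurable]: "h \<in> borel_measurable borel" and i: "integrable lborel (\<lambda>s. indicator {0..} s * h s)"
  shows "integrable lborel (\<lambda>x. h (sq_dist a x))"
proof (rule integrableI_bounded)
  have sq: "sq_dist a \<in> borel_measurable borel" unfolding sq_dist_def[abs_def] by measurable
  show "(\<lambda>x. h (sq_dist a x)) \<in> borel_measurable lborel"
    using measurable_compose[OF sq assms(1)] by simp
  have "(\<integral>\<^sup>+ x. ennreal (norm (h (sq_dist a x))) \<partial>lborel)
      = (\<integral>\<^sup>+ s. ennreal pi * indicator {0..} s * ennreal (norm (h s)) \<partial>lborel)"
    by (rule nn_integral_radial) measurable
  also have "\<dots> = (\<integral>\<^sup>+ s. ennreal pi * ennreal (norm (indicator {0..} s * h s)) \<partial>lborel)"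
    by (rule nn_integral_cong) (simp add: indicator_def)
  also have "\<dots> = ennreal pi * (\<integral>\<^sup>+ s. ennreal (norm (indicator {0..} s * h s)) \<partial>lborel)"
    by (rule nn_integral_cmult) measurable
  also have "\<dots> < \<infinity>"
    using i unfolding integrable_iff_bounded by (simp add: ennreal_mult_less_top)
  finally show "(\<integral>\<^sup>+ x. ennreal (norm (h (sq_dist a x))) \<partial>lborel) < \<infinity>" .
qed

lemma integrable_powr_profile:
  "integrable lborel (\<lambda>s::real. indicator {0..1} s * s powr (- 1 / 2) + indicator {1..} s * s powr (- 2))"
proof (rule Bochner_Integration.integrable_add)
  have 1: "(\<lambda>s::real. s powr (- 1 / 2)) absolutely_integrable_on {0..1}"
    by (rule nonnegative_absolutely_integrable_1[OF integrable_on_powr_from_0]) auto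
  have 2: "(\<lambda>s::real. s powr (- 2)) absolutely_integrable_on {1..}"
    by (rule nonnegative_absolutely_integrable_1[OF has_integral_integrable[OF has_integral_powr_to_inf]]) auto
  show "integrable lborel (\<lambda>s::real. indicator {0..1} s * s powr (- 1 / 2))"
    using 1 unfolding set_integrable_def by (subst (asm) integrable_completion) simp_all
  show "integrable lborel (\<lambda>s::real. indicator {1..} s * s powr (- 2))"
    using 2 unfolding set_integrable_def by (subst (asm) integrable_completion) simp_all
qed

text \<open>
  Near 0 any negative power beats the logarithm; the exponent \<open>- 1/4\<close> is chosen so that the square is
  integrable on \<open>[0, 1]\<close>. At infinity the exponential decay is weakened to a power, whose square is
  integrable on \<open>[1, \<infinity>)\<close>.
\<close>

lemma green_profile_bound:
  assumes w: "Im w > 0"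
  obtains K where "K > 0" "\<And>s. 0 < s \<Longrightarrow> s \<le> 1 \<Longrightarrow> norm (green_profile w (of_real s)) \<le> K * s powr (- 1 / 4)"
    "\<And>s. s \<ge> 1 \<Longrightarrow> norm (green_profile w (of_real s)) \<le> K * s powr (- 1)"
proof -
  let ?G = "\<lambda>s::real. green_profile w (of_real s)"
  have cont: "continuous_on {0<..} ?G"
    using has_vector_derivative_continuous[OF green_profile_real_deriv(1)]
    by (intro continuous_at_imp_continuous_on ballI) simp
  have l0: "((\<lambda>s. ?G s * of_real (s powr (1 / 4))) \<longlongrightarrow> 0) (at_right 0)"
  proof -
    have a: "((\<lambda>s::real. complex_of_real (s powr (1 / 4))) \<longlongrightarrow> of_real 0) (at_right 0)"
      by (intro tendsto_of_real) real_asymp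
    have b: "((\<lambda>s::real. complex_of_real (ln s / (4 * pi) * s powr (1 / 4))) \<longlongrightarrow> of_real 0) (at_right 0)"
    proof (intro tendsto_of_real)
      have l: "((\<lambda>s::real. ln s * s powr (1 / 4)) \<longlongrightarrow> 0) (at_right 0)" by real_asymp
      have eq: "ln s / (4 * pi) * s powr (1 / 4) = inverse (4 * pi) * (ln s * s powr (1 / 4))" for s :: real
        by (simp only: divide_inverse mult.assoc mult.left_commute)
      show "((\<lambda>s::real. ln s / (4 * pi) * s powr (1 / 4)) \<longlongrightarrow> 0) (at_right 0)"
        unfolding eq by (rule tendsto_mult_right_zero[OF l])
    qed
    have "((\<lambda>s. (?G s + of_real (ln s / (4 * pi))) * of_real (s powr (1 / 4)) - of_real (ln s / (4 * pi) * s powr (1 / 4)))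
       \<longlongrightarrow> (- euler_mascheroni - Ln (- \<i> * w / 2)) / (2 * of_real pi) * of_real 0 - of_real 0) (at_right 0)"
      by (intro tendsto_diff tendsto_mult green_profile_at_0(1) a b)
    then show ?thesis by (simp add: distrib_right)
  qed
  from tendstoD[OF l0, of 1] have "\<forall>\<^sub>F s in at_right 0. norm (?G s * of_real (s powr (1 / 4))) < 1"
    by simp
  then obtain s0 where s0: "s0 > 0" "\<And>s. 0 < s \<Longrightarrow> s < s0 \<Longrightarrow> norm (?G s * of_real (s powr (1 / 4))) < 1"
    unfolding eventually_at_right_field by blast
  obtain C R where CR: "C > 0" "R > 0" "\<And>r. r \<ge> R \<Longrightarrow> norm (green_profile w (of_real (r\<^sup>2))) \<le> C * exp (- Im w * r)"
    using green_profile_decay[OF w] by metis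
  have "((\<lambda>s. C * exp (- Im w * sqrt s) * s) \<longlongrightarrow> 0) at_top"
    using CR(1) w by real_asymp
  then have "\<forall>\<^sub>F s in at_top. C * exp (- Im w * sqrt s) * s < 1"
    by (rule order_tendstoD) simp
  then obtain S where S: "\<And>s. s \<ge> S \<Longrightarrow> C * exp (- Im w * sqrt s) * s < 1"
    by (auto simp: eventually_at_top_linorder)
  have far: "norm (?G s * of_real s) < 1" if "s \<ge> max S (R\<^sup>2)" "s > 0" for s
  proof -
    have "R \<le> sqrt s" by (rule real_le_rsqrt) (use that in simp)
    from CR(3)[OF this] have "norm (?G s) \<le> C * exp (- Im w * sqrt s)" using that by simp
    then have "norm (?G s) * s \<le> C * exp (- Im w * sqrt s) * s" using that by (intro mult_right_mono) auto
    also have "\<dots> < 1" using S that by simp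
    finally show ?thesis using that by (simp add: norm_mult)
  qed
  have "bounded ((\<lambda>s. ?G s * of_real (s powr (1 / 4))) ` {s0..1})"
    by (intro compact_imp_bounded compact_continuous_image continuous_intros continuous_on_subset[OF cont])
      (use s0(1) in auto)
  then obtain B1 where B1: "\<forall>s\<in>{s0..1}. norm (?G s * of_real (s powr (1 / 4))) \<le> B1" by (auto simp: bounded_iff)
  have "bounded ((\<lambda>s. ?G s * of_real s) ` {1..max S (R\<^sup>2)})"
    by (intro compact_imp_bounded compact_continuous_image continuous_intros continuous_on_subset[OF cont]) auto
  then obtain B2 where B2: "\<forall>s\<in>{1..max S (R\<^sup>2)}. norm (?G s * of_real s) \<le> B2" by (auto simp: bounded_iff)
  define K where "K = 1 + \<bar>B1\<bar> + \<bar>B2\<bar>"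
  show ?thesis
  proof (rule that[of K])
    show "K > 0" by (simp add: K_def add_pos_nonneg)
    fix s :: real assume s: "0 < s" "s \<le> 1"
    have "norm (?G s * of_real (s powr (1 / 4))) \<le> K"
      using s0(2)[of s] B1[THEN bspec, of s] s unfolding K_def by (cases "s < s0") auto
    then have "norm (?G s) * s powr (1 / 4) \<le> K" by (simp add: norm_mult)
    then have "norm (?G s) \<le> K / s powr (1 / 4)" using s by (simp add: pos_le_divide_eq)
    also have "\<dots> = K * s powr (- 1 / 4)" by (simp add: powr_minus_divide)
    finally show "norm (?G s) \<le> K * s powr (- 1 / 4)" .
  next
    fix s :: real assume s: "1 \<le> s"
    have "norm (?G s * of_real s) \<le> K"
      using far[of s] B2[THEN bspec, of s] s unfolding K_def by (cases "s \<ge> max S (R\<^sup>2)") auto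
    then have "norm (?G s) * s \<le> K" using s by (simp add: norm_mult)
    then have "norm (?G s) \<le> K / s" using s by (simp add: pos_le_divide_eq)
    then show "norm (?G s) \<le> K * s powr (- 1)" using s by (simp add: powr_minus_divide)
  qed
qed

lemma green_measurable: "green w b \<in> borel_measurable borel"
proof -
  have c: "continuous_on (- {b}) (green w b)"
    using smooth_on_isCont[OF smooth_on_green] by (intro continuous_at_imp_continuous_on) auto
  have "(\<lambda>x. if x \<in> - {b} then green w b x else green w b b) \<in> borel_measurable borel"
    by (rule borel_measurable_continuous_on_if) (use c in auto)
  moreover have "(\<lambda>x. if x \<in> - {b} then green w b x else green w b b) = green w b" by auto
  ultimately show ?thesis by simp
qed

text \<open>
  In the squared radius the plane measure is \<open>\<pi> ds\<close>, so the bounds on the profile suffice.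
\<close>

lemma square_integrable_green:
  assumes w: "Im w > 0"
  shows "square_integrable (green w b)"
  unfolding square_integrable_def
proof
  show "green w b \<in> borel_measurable borel" by (rule green_measurable)
  obtain K where K: "K > 0" "\<And>s. 0 < s \<Longrightarrow> s \<le> 1 \<Longrightarrow> norm (green_profile w (of_real s)) \<le> K * s powr (- 1 / 4)"
    "\<And>s. s \<ge> 1 \<Longrightarrow> norm (green_profile w (of_real s)) \<le> K * s powr (- 1)"
    using green_profile_bound[OF w] by metis
  define h where "h s = indicator {0..1} s * s powr (- 1 / 2) + indicator {1..} s * s powr (- 2)" for s :: real
  have i: "integrable lborel h" unfolding h_def by (rule integrable_powr_profile)
  have "integrable lborel (\<lambda>x. h (sq_dist b x))"
  proof (rule integrable_radial)
    show "h \<in> borel_measurable borel" unfolding h_def by measurable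
    show "integrable lborel (\<lambda>s. indicator {0..} s * h s)"
      using integrable_mult_indicator[OF _ i, of "{0..}"] by simp
  qed
  then have i': "integrable lborel (\<lambda>x. K\<^sup>2 * h (sq_dist b x))" by (rule integrable_mult_right)
  have bound: "(norm (green_profile w (of_real s)))\<^sup>2 \<le> K\<^sup>2 * h s" if s: "s > 0" for s
  proof (cases "s \<le> 1")
    case True
    have "(norm (green_profile w (of_real s)))\<^sup>2 \<le> (K * s powr (- 1 / 4))\<^sup>2" by (intro power_mono K(2) s True) simp
    also have "\<dots> = K\<^sup>2 * s powr (- 1 / 2)" by (simp add: power_mult_distrib power2_eq_square flip: powr_add)
    also have "\<dots> \<le> K\<^sup>2 * h s" using s True by (intro mult_left_mono) (auto simp: h_def)
    finally show ?thesis .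
  next
    case False
    then have s1: "s \<ge> 1" by simp
    have "(norm (green_profile w (of_real s)))\<^sup>2 \<le> (K * s powr (- 1))\<^sup>2" by (intro power_mono K(3) s1) simp
    also have "\<dots> = K\<^sup>2 * s powr (- 2)" using s1 by (simp add: power_mult_distrib powr_minus power_inverse)
    also have "\<dots> \<le> K\<^sup>2 * h s" using s1 by (intro mult_left_mono) (auto simp: h_def)
    finally show ?thesis .
  qed
  show "integrable lborel (\<lambda>x. (norm (green w b x))\<^sup>2)"
  proof (rule Bochner_Integration.integrable_bound[OF i'])
    show "(\<lambda>x. (norm (green w b x))\<^sup>2) \<in> borel_measurable lborel" using green_measurable by measurable
    have "AE x in lborel. x \<noteq> b" by (rule AE_lborel_singleton)
    then show "AE x in lborel. norm ((norm (green w b x))\<^sup>2) \<le> norm (K\<^sup>2 * h (sq_dist b x))"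
    proof eventually_elim
      case (elim x)
      have "(norm (green w b x))\<^sup>2 \<le> K\<^sup>2 * h (sq_dist b x)" unfolding green_def by (rule bound[OF sq_dist_pos[OF elim]])
      then show ?case unfolding real_norm_def abs_power2 by (rule order_trans[OF _ abs_ge_self])
    qed
  qed
qed

section \<open>Superpositions of Green functions\<close>

lemma norm_smult_vec: "norm (c *s (v :: complex^'n)) = norm c * norm v"
proof -
  have "norm (c *s v) = L2_set (\<lambda>i. norm c * norm (v $ i)) UNIV"
    by (simp add: norm_vec_def norm_mult)
  also have "\<dots> = norm c * norm v"
    unfolding norm_vec_def by (rule L2_set_right_distrib[symmetric]) simp
  finally show ?thesis .
qed

lemma bounded_linear_smult_left: "bounded_linear (\<lambda>c. c *s (v :: complex^'n))"
proof (rule bounded_linear_intro)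
  show "norm (c *s v) \<le> norm c * norm v" for c by (simp add: norm_smult_vec)
qed (simp_all add: vec_eq_iff distrib_right)

lemma vpartial_sum_linear:
  assumes "\<And>j. j \<in> A \<Longrightarrow> bounded_linear (L j)" "\<And>j. j \<in> A \<Longrightarrow> g j differentiable (at x)"
  shows "vpartial i (\<lambda>x. \<Sum>j\<in>A. L j (g j x)) x = (\<Sum>j\<in>A. L j (vpartial i (g j) x))"
proof -
  have "((\<lambda>x. \<Sum>j\<in>A. L j (g j x)) has_derivative (\<lambda>h. \<Sum>j\<in>A. L j (frechet_derivative (g j) (at x) h))) (at x)"
    by (rule has_derivative_sum[OF bounded_linear.has_derivative[OF assms(1) has_derivative_frechet[OF assms(2)]]])
  from vpartial_eqI[OF this] show ?thesis by (simp add: vpartial_def)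
qed

lemma laplacian_cong_open:
  assumes U: "open U" "x \<in> U" and eq: "\<And>y. y \<in> U \<Longrightarrow> f y = g y" and f: "smooth_on U f"
  shows "laplacian f x = laplacian g x"
proof -
  have v: "vpartial i f y = vpartial i g y" if "y \<in> U" for i y
    by (rule vpartial_cong_open[OF U(1) that eq smooth_on_differentiable[OF f that]])
  have "vpartial i (vpartial i f) x = vpartial i (vpartial i g) x" for i
    by (rule vpartial_cong_open[OF U v smooth_on_differentiable[OF smooth_on_vpartial[OF f] U(2)]])
  then show ?thesis by (simp add: laplacian_def)
qed

lemma laplacian_sum_linear:
  assumes U: "open U" "x \<in> U" and L: "\<And>j. j \<in> A \<Longrightarrow> bounded_linear (L j)" and g: "\<And>j. j \<in> A \<Longrightarrow> smooth_on U (g j)"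
  shows "laplacian (\<lambda>x. \<Sum>j\<in>A. L j (g j x)) x = (\<Sum>j\<in>A. L j (laplacian (g j) x))"
proof -
  let ?f = "\<lambda>x. \<Sum>j\<in>A. L j (g j x)"
  have s: "smooth_on U ?f" by (rule smooth_on_sum[OF U(1) smooth_on_linear[OF U(1) L g]])
  have v: "vpartial i ?f y = (\<Sum>j\<in>A. L j (vpartial i (g j) y))" if "y \<in> U" for i y
    by (rule vpartial_sum_linear[OF L smooth_on_differentiable[OF g that]])
  have "vpartial i (vpartial i ?f) x = (\<Sum>j\<in>A. L j (vpartial i (vpartial i (g j)) x))" for i
  proof -
    have "vpartial i (vpartial i ?f) x = vpartial i (\<lambda>y. \<Sum>j\<in>A. L j (vpartial i (g j) y)) x"
      by (rule vpartial_cong_open[OF U v smooth_on_differentiable[OF smooth_on_vpartial[OF s] U(2)]])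
    also have "\<dots> = (\<Sum>j\<in>A. L j (vpartial i (vpartial i (g j)) x))"
      by (rule vpartial_sum_linear[OF L smooth_on_differentiable[OF smooth_on_vpartial[OF g] U(2)]])
    finally show ?thesis .
  qed
  then have "laplacian ?f x = (\<Sum>i\<in>UNIV. \<Sum>j\<in>A. L j (vpartial i (vpartial i (g j)) x))"
    by (simp only: laplacian_def)
  also have "\<dots> = (\<Sum>j\<in>A. \<Sum>i\<in>UNIV. L j (vpartial i (vpartial i (g j)) x))" by (rule sum.swap)
  also have "\<dots> = (\<Sum>j\<in>A. L j (laplacian (g j) x))"
    unfolding laplacian_def by (rule sum.cong[OF refl linear_sum[OF bounded_linear.linear[OF L], symmetric]])
  finally show ?thesis .
qed

text \<open>
  The value 0 at the centres is the normalisation of the representatives in \<open>dom_H_adj\<close>.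
\<close>

definition green_sum :: "complex \<Rightarrow> ('m::finite \<Rightarrow> real^2) \<Rightarrow> complex^'n^'m \<Rightarrow> real^2 \<Rightarrow> complex^'n" where
  "green_sum w p \<xi> x = (if x \<in> range p then 0 else (\<Sum>j\<in>UNIV. green w (p j) x *s (\<xi> $ j)))"

lemma smooth_on_green_terms: "smooth_on (- range p) (\<lambda>x. \<Sum>j\<in>UNIV. green w (p j) x *s (\<xi> $ j))"
  for p :: "'m::finite \<Rightarrow> real^2"
proof -
  have o: "open (- range p)" by (simp add: open_Compl finite_imp_closed)
  show ?thesis
    by (rule smooth_on_sum[OF o smooth_on_linear[OF o bounded_linear_smult_left smooth_on_subset[OF smooth_on_green]]]) auto
qed

lemma smooth_on_green_sum: "smooth_on (- range p) (green_sum w p \<xi>)"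
  by (rule smooth_on_cong[OF _ _ smooth_on_green_terms]) (auto simp: green_sum_def open_Compl finite_imp_closed)

lemma laplacian_green_sum:
  assumes "x \<notin> range p"
  shows "laplacian (green_sum w p \<xi>) x = - (w\<^sup>2 *s green_sum w p \<xi> x)"
proof -
  have o: "open (- range p)" by (simp add: open_Compl finite_imp_closed)
  have x: "x \<in> - range p" using assms by simp
  have "laplacian (green_sum w p \<xi>) x = laplacian (\<lambda>x. \<Sum>j\<in>UNIV. green w (p j) x *s (\<xi> $ j)) x"
    by (rule laplacian_cong_open[OF o x _ smooth_on_green_sum]) (simp add: green_sum_def)
  also have "\<dots> = (\<Sum>j\<in>UNIV. laplacian (green w (p j)) x *s (\<xi> $ j))"
    by (rule laplacian_sum_linear[OF o x bounded_linear_smult_left smooth_on_subset[OF smooth_on_green]]) auto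
  also have "\<dots> = (\<Sum>j\<in>UNIV. - (w\<^sup>2 *s (green w (p j) x *s (\<xi> $ j))))"
  proof (rule sum.cong[OF refl])
    fix j
    have "x \<noteq> p j" using assms by auto
    from laplacian_green[OF this]
    show "laplacian (green w (p j)) x *s (\<xi> $ j) = - (w\<^sup>2 *s (green w (p j) x *s (\<xi> $ j)))"
      by (simp add: vec_eq_iff)
  qed
  also have "\<dots> = - (w\<^sup>2 *s green_sum w p \<xi> x)"
    using assms by (simp add: green_sum_def vec_eq_iff sum_negf sum_distrib_left mult.assoc)
  finally show ?thesis .
qed

lemma green_sum_L2:
  fixes p :: "'m::finite \<Rightarrow> real^2" and \<xi> :: "complex^'n::finite^'m"
  assumes w: "Im w > 0"
  shows "green_sum w p \<xi> \<in> L2"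
proof -
  have m: "green_sum w p \<xi> \<in> borel_measurable borel"
  proof -
    have c: "continuous_on (- range p) (green_sum w p \<xi>)"
      using smooth_on_isCont[OF smooth_on_green_sum] by (intro continuous_at_imp_continuous_on) blast
    have "(\<lambda>x. if x \<in> - range p then green_sum w p \<xi> x else 0) \<in> borel_measurable borel"
      by (rule borel_measurable_continuous_on_if) (use c in \<open>auto simp: open_Compl finite_imp_closed\<close>)
    moreover have "(\<lambda>x. if x \<in> - range p then green_sum w p \<xi> x else 0) = green_sum w p \<xi>"
      by (auto simp: green_sum_def)
    ultimately show ?thesis by simp
  qed
  let ?b = "\<lambda>x. (\<Sum>j\<in>UNIV. (norm (\<xi> $ j))\<^sup>2 * (norm (green w (p j) x))\<^sup>2) * real CARD('m)"
  have "integrable lborel (\<lambda>x. (norm (green_sum w p \<xi> x))\<^sup>2)"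
  proof (rule Bochner_Integration.integrable_bound)
    show "integrable lborel ?b"
      by (intro integrable_mult_left Bochner_Integration.integrable_sum integrable_mult_right
          square_integrableD(2)[OF square_integrable_green[OF w]])
    show "(\<lambda>x. (norm (green_sum w p \<xi> x))\<^sup>2) \<in> borel_measurable lborel" using m by measurable
    have le: "(norm (green_sum w p \<xi> x))\<^sup>2 \<le> ?b x" for x
    proof (cases "x \<in> range p")
      case True
      then have "green_sum w p \<xi> x = 0" by (simp add: green_sum_def)
      then show ?thesis by (simp add: sum_nonneg)
    next
      case False
      then have "norm (green_sum w p \<xi> x) \<le> (\<Sum>j\<in>UNIV. norm (\<xi> $ j) * norm (green w (p j) x))"
        unfolding green_sum_def by (simp add: norm_smult_vec sum_norm_le mult.commute)
      then have "(norm (green_sum w p \<xi> x))\<^sup>2 \<le> (\<Sum>j\<in>UNIV. norm (\<xi> $ j) * norm (green w (p j) x))\<^sup>2"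
        by (rule power_mono) simp
      also have "\<dots> \<le> (\<Sum>j\<in>UNIV. (norm (\<xi> $ j) * norm (green w (p j) x))\<^sup>2) * real CARD('m)"
        by (rule sum_squared_le_sum_of_squares)
      also have "\<dots> = ?b x" by (simp only: power_mult_distrib)
      finally show ?thesis .
    qed
    show "AE x in lborel. norm ((norm (green_sum w p \<xi> x))\<^sup>2) \<le> norm (?b x)"
    proof (rule AE_I2)
      fix x
      show "norm ((norm (green_sum w p \<xi> x))\<^sup>2) \<le> norm (?b x)"
        unfolding real_norm_def abs_power2 by (rule order_trans[OF _ abs_ge_self]) (use le[of x] in simp)
    qed
  qed
  then show ?thesis using m by (simp add: L2_def)
qed

lemma L2_smult:
  assumes f: "f \<in> L2"
  shows "(\<lambda>x. z *s f x) \<in> L2"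
proof -
  have L: "bounded_linear (\<lambda>v. z *s (v :: complex^'a))"
    by (rule bounded_linear_intro[of _ "norm z"]) (simp_all add: norm_smult_vec vec_eq_iff algebra_simps)
  have m: "f \<in> borel_measurable borel" using f by (simp add: L2_def)
  have "(\<lambda>x. z *s f x) \<in> borel_measurable borel"
    by (rule borel_measurable_continuous_on[OF linear_continuous_on[OF L] m])
  moreover have "integrable lborel (\<lambda>x. (norm z)\<^sup>2 * (norm (f x))\<^sup>2)"
    using f by (intro integrable_mult_right) (simp add: L2_def)
  ultimately show ?thesis by (simp add: L2_def norm_smult_vec power_mult_distrib)
qed

theorem green_sum_in_defect_space:
  fixes p :: "'m::finite \<Rightarrow> real^2" and \<xi> :: "complex^'n::finite^'m"
  assumes w: "Im w > 0"
  shows "green_sum w p \<xi> \<in> defect_space (H_adj p) (w\<^sup>2)"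
proof -
  let ?F = "green_sum w p \<xi>"
  have o: "open (- range p)" by (simp add: open_Compl finite_imp_closed)
  have c: "continuous_on (- range p) ?F"
    using smooth_on_isCont[OF smooth_on_green_sum] by (intro continuous_at_imp_continuous_on) blast
  have z: "\<forall>x\<in>range p. ?F x = 0" by (simp add: green_sum_def)
  have W: "?F \<in> W2_loc 2 (- range p)" by (rule smooth_on_W2_loc[OF o smooth_on_green_sum])
  have wl: "weak_laplacian (- range p) ?F (\<lambda>x. - (w\<^sup>2 *s ?F x))"
    unfolding weak_laplacian_def
  proof
    fix \<phi> assume \<phi>: "\<phi> \<in> test_functions (- range p)"
    have "(LINT x|lborel. (\<Sum>i\<in>UNIV. partial i (partial i \<phi>) x) *\<^sub>R ?F x) = (LINT x|lborel. \<phi> x *\<^sub>R laplacian ?F x)"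
      using smooth_on_weak_laplacian[OF o smooth_on_green_sum] \<phi> unfolding weak_laplacian_def by (rule bspec)
    also have "\<dots> = (LINT x|lborel. \<phi> x *\<^sub>R (- (w\<^sup>2 *s ?F x)))"
    proof (rule Bochner_Integration.integral_cong[OF refl])
      fix x
      obtain K where K: "smooth_on UNIV \<phi>" "compact K" "K \<subseteq> - range p" "\<And>x. x \<notin> K \<Longrightarrow> \<phi> x = 0"
        using test_functionE[OF \<phi>] by metis
      show "\<phi> x *\<^sub>R laplacian ?F x = \<phi> x *\<^sub>R (- (w\<^sup>2 *s ?F x))"
      proof (cases "x \<in> K")
        case True
        then have "x \<notin> range p" using K(3) by auto
        from laplacian_green_sum[OF this, of w \<xi>] show ?thesis by (simp only:)
      next
        case False
        then show ?thesis by (simp add: K(4))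
      qed
    qed
    finally show "(LINT x|lborel. (\<Sum>i\<in>UNIV. partial i (partial i \<phi>) x) *\<^sub>R ?F x) = (LINT x|lborel. \<phi> x *\<^sub>R (- (w\<^sup>2 *s ?F x)))" .
  qed
  have L: "(\<lambda>x. w\<^sup>2 *s ?F x) \<in> L2" by (rule L2_smult[OF green_sum_L2[OF w]])
  have nL: "(\<lambda>x. - (w\<^sup>2 *s ?F x)) \<in> L2" using L by (simp add: L2_def)
  have "\<exists>g\<in>L2. weak_laplacian (- range p) ?F g" by (rule bexI[of _ "\<lambda>x. - (w\<^sup>2 *s ?F x)"], rule wl, rule nL)
  with c z W green_sum_L2[OF w, of p \<xi>] have "?F \<in> dom_H_adj p" by (simp add: dom_H_adj_def)
  with L wl show ?thesis by (simp add: defect_space_def H_adj_def)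
qed

section \<open>Boundary values\<close>

text \<open>
  The finite part of the Green function at its pole.
\<close>

definition green_constant :: "complex \<Rightarrow> complex" where
  "green_constant w = (- euler_mascheroni - Ln (- \<i> * w / 2)) / (2 * of_real pi)"

lemma green_at_centre:
  "((\<lambda>x. green w b x + of_real (ln (dist x b) / (2 * pi))) \<longlongrightarrow> green_constant w) (at b)"
proof -
  have "(sq_dist b \<longlongrightarrow> sq_dist b b) (at b)"
    unfolding sq_dist_def[abs_def] by (intro tendsto_intros)
  then have "(sq_dist b \<longlongrightarrow> 0) (at b)" by (simp add: sq_dist_def)
  moreover have "\<forall>\<^sub>F x in at b. sq_dist b x \<in> {0<..}"
    unfolding eventually_at_filter using sq_dist_pos by (intro always_eventually) auto
  ultimately have "filterlim (sq_dist b) (at_right 0) (at b)"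
    unfolding filterlim_at by (auto elim: eventually_mono)
  from filterlim_compose[OF green_profile_at_0(1) this]
  have lim: "((\<lambda>x. green_profile w (of_real (sq_dist b x)) + of_real (ln (sq_dist b x) / (4 * pi))) \<longlongrightarrow> green_constant w) (at b)"
    unfolding green_constant_def .
  have eq: "ln (sq_dist b x) / (4 * pi) = ln (dist x b) / (2 * pi)" if "x \<noteq> b" for x
    using that by (simp add: sq_dist_def dist_norm ln_realpow)
  show ?thesis
  proof (rule Lim_transform_eventually[OF lim])
    show "\<forall>\<^sub>F x in at b. green_profile w (of_real (sq_dist b x)) + of_real (ln (sq_dist b x) / (4 * pi))
       = green w b x + of_real (ln (dist x b) / (2 * pi))"
      unfolding eventually_at_filter by (intro always_eventually allI impI) (simp add: eq green_def)
  qed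
qed

lemma scaleR_eq_smult: "r *\<^sub>R (v :: complex^'n) = of_real r *s v"
  by (simp add: vec_eq_iff scaleR_conv_of_real[where 'a = complex])

text \<open>
  The action on \<open>\<xi>\<close> of the matrix with entries \<open>G(x\<^sub>j - x\<^sub>k)\<close> off the diagonal and the finite part of \<open>G\<close> on it.
\<close>

definition boundary_value :: "complex \<Rightarrow> ('m::finite \<Rightarrow> real^2) \<Rightarrow> complex^'n^'m \<Rightarrow> complex^'n^'m" where
  "boundary_value w p \<xi> = (\<chi> j. \<Sum>k\<in>UNIV. (if k = j then green_constant w else green w (p k) (p j)) *s (\<xi> $ k))"

lemma green_sum_at_centre:
  fixes p :: "'m::finite \<Rightarrow> real^2" and \<xi> :: "complex^'n::finite^'m"
  assumes inj: "inj p"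
  shows "((\<lambda>x. green_sum w p \<xi> x + (ln (dist x (p j)) / (2 * pi)) *\<^sub>R (\<xi> $ j)) \<longlongrightarrow> boundary_value w p \<xi> $ j) (at (p j))"
proof -
  let ?c = "\<lambda>k. if k = j then green_constant w else green w (p k) (p j)"
  let ?g = "\<lambda>k x. if k = j then green w (p k) x + complex_of_real (ln (dist x (p j)) / (2 * pi)) else green w (p k) x"
  have g: "(?g k \<longlongrightarrow> ?c k) (at (p j))" for k
  proof (cases "k = j")
    case True
    then show ?thesis using green_at_centre[of w "p j"] by simp
  next
    case False
    then have "p j \<in> - {p k}" using injD[OF inj] by auto
    from smooth_on_isCont[OF smooth_on_green this] show ?thesis using False by (simp add: isCont_def)
  qed
  have lim: "((\<lambda>x. \<Sum>k\<in>UNIV. ?g k x *s (\<xi> $ k)) \<longlongrightarrow> (\<Sum>k\<in>UNIV. ?c k *s (\<xi> $ k))) (at (p j))"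
    by (rule tendsto_sum) (rule bounded_linear.tendsto[OF bounded_linear_smult_left g])
  have split: "(\<Sum>k\<in>UNIV. ?g k x *s (\<xi> $ k)) = (\<Sum>k\<in>UNIV. green w (p k) x *s (\<xi> $ k)) + (ln (dist x (p j)) / (2 * pi)) *\<^sub>R (\<xi> $ j)" for x
  proof -
    have "(\<Sum>k\<in>UNIV. ?g k x *s (\<xi> $ k))
      = (\<Sum>k\<in>UNIV. green w (p k) x *s (\<xi> $ k) + (if k = j then (ln (dist x (p j)) / (2 * pi)) *\<^sub>R (\<xi> $ k) else 0))"
      by (rule sum.cong[OF refl]) (simp only: scaleR_eq_smult vector_sadd_rdistrib add_0_right split: if_split, simp)
    then show ?thesis by (simp add: sum.distrib)
  qed
  have ev: "\<forall>\<^sub>F x in at (p j). x \<notin> range p"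
  proof -
    have "open (- (range p - {p j}))" by (intro open_Compl finite_imp_closed) simp
    then have "\<forall>\<^sub>F x in at (p j). x \<in> - (range p - {p j})" by (rule eventually_at_in_open') simp
    moreover have "\<forall>\<^sub>F x in at (p j). x \<noteq> p j" by (rule eventually_neq_at_within)
    ultimately show ?thesis by eventually_elim auto
  qed
  show ?thesis unfolding boundary_value_def vec_lambda_beta
  proof (rule Lim_transform_eventually[OF lim])
    show "\<forall>\<^sub>F x in at (p j). (\<Sum>k\<in>UNIV. ?g k x *s (\<xi> $ k)) = green_sum w p \<xi> x + (ln (dist x (p j)) / (2 * pi)) *\<^sub>R (\<xi> $ j)"
      using ev
    proof eventually_elim
      case (elim x)
      then have "green_sum w p \<xi> x = (\<Sum>k\<in>UNIV. green w (p k) x *s (\<xi> $ k))" by (simp add: green_sum_def)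
      with split[of x] show ?case by (simp only:)
    qed
  qed
qed

text \<open>
  The expansion determines both boundary maps: division by the logarithm isolates \<open>\<xi>\<close>, and what
  remains after subtracting the logarithmic term is \<open>\<eta>\<close>.
\<close>

lemma boundary_maps_eqI:
  fixes p :: "'m::finite \<Rightarrow> real^2" and \<xi> \<eta> :: "complex^'n::finite^'m"
  assumes lim: "\<And>j. ((\<lambda>x. f x + (ln (dist x (p j)) / (2 * pi)) *\<^sub>R (\<xi> $ j)) \<longlongrightarrow> \<eta> $ j) (at (p j))"
  shows "\<Gamma>\<^sub>0 p f = \<xi>" "\<Gamma>\<^sub>1 p f = \<eta>"
proof -
  have "((\<lambda>x. f x /\<^sub>R ln (dist x (p j))) \<longlongrightarrow> - (1 / (2 * pi)) *\<^sub>R (\<xi> $ j)) (at (p j))" for j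
  proof -
    have "filterlim (\<lambda>x. dist x (p j)) (at_right 0) (at (p j))"
    proof -
      have "((\<lambda>x. dist x (p j)) \<longlongrightarrow> dist (p j) (p j)) (at (p j))" by (intro tendsto_intros)
      then have "((\<lambda>x. dist x (p j)) \<longlongrightarrow> 0) (at (p j))" by simp
      moreover have "\<forall>\<^sub>F x in at (p j). dist x (p j) \<in> {0<..}"
        unfolding eventually_at_filter by (intro always_eventually) auto
      ultimately show ?thesis unfolding filterlim_at by (auto elim: eventually_mono)
    qed
    then have ln: "filterlim (\<lambda>x. ln (dist x (p j))) at_bot (at (p j))"
      by (rule filterlim_compose[OF ln_at_0])
    then have inv: "((\<lambda>x. inverse (ln (dist x (p j)))) \<longlongrightarrow> 0) (at (p j))"
      by (intro filterlim_compose[OF tendsto_inverse_0] filterlim_at_bot_imp_at_infinity)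
    have ne: "\<forall>\<^sub>F x in at (p j). ln (dist x (p j)) < 0" using ln by (simp add: filterlim_at_bot_dense)
    have "((\<lambda>x. inverse (ln (dist x (p j))) *\<^sub>R (f x + (ln (dist x (p j)) / (2 * pi)) *\<^sub>R (\<xi> $ j)) - (1 / (2 * pi)) *\<^sub>R (\<xi> $ j))
       \<longlongrightarrow> 0 *\<^sub>R (\<eta> $ j) - (1 / (2 * pi)) *\<^sub>R (\<xi> $ j)) (at (p j))"
      by (intro tendsto_diff tendsto_scaleR inv lim tendsto_const)
    then have l: "((\<lambda>x. inverse (ln (dist x (p j))) *\<^sub>R (f x + (ln (dist x (p j)) / (2 * pi)) *\<^sub>R (\<xi> $ j)) - (1 / (2 * pi)) *\<^sub>R (\<xi> $ j))
       \<longlongrightarrow> - (1 / (2 * pi)) *\<^sub>R (\<xi> $ j)) (at (p j))" by simp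
    show ?thesis
    proof (rule Lim_transform_eventually[OF l])
      show "\<forall>\<^sub>F x in at (p j). inverse (ln (dist x (p j))) *\<^sub>R (f x + (ln (dist x (p j)) / (2 * pi)) *\<^sub>R (\<xi> $ j)) - (1 / (2 * pi)) *\<^sub>R (\<xi> $ j)
         = f x /\<^sub>R ln (dist x (p j))"
        using ne
      proof eventually_elim
        case (elim x)
        have "inverse (ln (dist x (p j))) * (ln (dist x (p j)) / (2 * pi)) = 1 / (2 * pi)" using elim by simp
        then show ?case by (simp only: scaleR_add_right scaleR_scaleR) simp
      qed
    qed
  qed
  then have lc: "log_coeff p f $ j = - (1 / (2 * pi)) *\<^sub>R (\<xi> $ j)" for j
    unfolding log_coeff_def vec_lambda_beta by (intro tendsto_Lim) simp_all
  have c: "(- 2 * pi) *\<^sub>R (- (1 / (2 * pi)) *\<^sub>R v) = v" for v :: "complex^'n"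
    unfolding scaleR_scaleR by simp
  have "\<Gamma>\<^sub>0 p f $ j = \<xi> $ j" for j
    unfolding \<Gamma>\<^sub>0_def vector_scaleR_component lc by (rule c)
  then show "\<Gamma>\<^sub>0 p f = \<xi>" by (simp only: vec_eq_iff) simp
  have "\<Gamma>\<^sub>1 p f $ j = \<eta> $ j" for j
  proof -
    have "(\<lambda>x. f x - ln (dist x (p j)) *\<^sub>R (log_coeff p f $ j)) = (\<lambda>x. f x + (ln (dist x (p j)) / (2 * pi)) *\<^sub>R (\<xi> $ j))"
      unfolding lc scaleR_scaleR by (simp add: fun_eq_iff)
    then show ?thesis unfolding \<Gamma>\<^sub>1_def vec_lambda_beta
      by (simp only:) (intro tendsto_Lim lim; simp)
  qed
  then show "\<Gamma>\<^sub>1 p f = \<eta>" by (simp only: vec_eq_iff) simp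
qed

lemma green_eq_hankel:
  assumes "Im w > 0" "Re w > 0" "x \<noteq> b"
  shows "green w b x = \<i> / 4 * hankel1 0 (w * of_real (dist x b))"
  using green_profile_eq_hankel[OF assms(1,2), of "dist x b"] assms(3)
  by (simp add: green_def sq_dist_def dist_norm)

text \<open>
  Here \<open>\<psi>(1) = - \<gamma>\<close> and \<open>w / 2i = - i w / 2\<close>.
\<close>

lemma green_constant_eq:
  "1 / (2 * of_real pi) * (deriv Gamma 1 / Gamma 1 - ln (w / (2 * \<i>))) = green_constant w"
proof -
  have "(Gamma has_field_derivative Gamma 1 * Digamma 1) (at (1::complex))"
    by (rule has_field_derivative_Gamma) auto
  then have d: "deriv Gamma 1 = (- euler_mascheroni :: complex)"
    by (simp add: DERIV_imp_deriv)
  have "w / (2 * \<i>) = - \<i> * w / 2" by (simp add: field_simps)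
  then have "ln (w / (2 * \<i>)) = Ln (- \<i> * w / 2)" by simp
  then show ?thesis by (simp only: d green_constant_def Gamma_1) simp
qed

lemma direct_sum_weyl_matrix:
  fixes p :: "'m::finite \<Rightarrow> real^2" and \<xi> :: "complex^'n::finite^'m"
  assumes inj: "inj p" and z: "Im z > 0"
  shows "direct_sum_copies (weyl_matrix p z) \<xi> = boundary_value (upper_sqrt z) p \<xi>"
proof -
  let ?w = "upper_sqrt z"
  have w: "Im ?w > 0" "Re ?w > 0" using upper_sqrt_pos[OF z] by auto
  have "weyl_matrix p z $ j $ k = (if k = j then green_constant ?w else green ?w (p k) (p j))" for j k
  proof (cases "k = j")
    case True
    then show ?thesis by (simp add: weyl_matrix_def green_tilde_def green_constant_eq[symmetric])
  next
    case False
    then have "p j \<noteq> p k" using injD[OF inj] by auto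
    then show ?thesis using False green_eq_hankel[OF w, of "p j" "p k"]
      by (simp add: weyl_matrix_def green_tilde_def dist_norm)
  qed
  then show ?thesis by (simp only: direct_sum_copies_def boundary_value_def)
qed

section \<open>The defect space\<close>

lemma test_laplacian:
  assumes \<phi>: "\<phi> \<in> test_functions \<Omega>"
  shows "laplacian \<phi> \<in> test_functions \<Omega>"
proof -
  obtain K where K: "smooth_on UNIV \<phi>" "compact K" "K \<subseteq> \<Omega>" "\<And>x. x \<notin> K \<Longrightarrow> \<phi> x = 0"
    using test_functionE[OF \<phi>] by metis
  have s: "smooth_on UNIV (laplacian \<phi>)"
    unfolding laplacian_def[abs_def] by (rule smooth_on_sum[OF open_UNIV smooth_on_vpartial[OF smooth_on_vpartial[OF K(1)]]])
  show ?thesis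
    by (rule test_functionI[OF s K(2,3) laplacian_zero_off_compact[OF K(2,4)]])
qed

text \<open>
  The weak equation for a vector-valued function passes to components because integration
  commutes with the coordinate functionals.
\<close>

lemma defect_component:
  fixes p :: "'m::finite \<Rightarrow> real^2" and f :: "real^2 \<Rightarrow> complex^'n::finite"
  assumes f: "f \<in> defect_space (H_adj p) z"
  shows "weak_helmholtz (range p) z (\<lambda>x. f x $ i)" "square_integrable (\<lambda>x. f x $ i)"
    "\<And>x. x \<notin> range p \<Longrightarrow> isCont (\<lambda>x. f x $ i) x"
proof -
  have F: "continuous_on (- range p) f" "f \<in> L2" "weak_laplacian (- range p) f (\<lambda>x. - (z *s f x))"
    using f by (auto simp: defect_space_def H_adj_def dom_H_adj_def)
  have o: "open (- range p)" by (simp add: open_Compl finite_imp_closed)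
  have c: "isCont f x" if "x \<in> - range p" for x
    using F(1) o that by (simp add: continuous_on_eq_continuous_at)
  show "isCont (\<lambda>x. f x $ i) x" if "x \<notin> range p" for x
    by (rule isCont_vec_nth) (use c that in simp)
  have m: "f \<in> borel_measurable borel" and i2: "integrable lborel (\<lambda>x. (norm (f x))\<^sup>2)"
    using F(2) by (simp_all add: L2_def)
  have mi: "(\<lambda>x. f x $ i) \<in> borel_measurable borel"
    by (rule borel_measurable_continuous_on[OF _ m]) (intro continuous_intros)
  have "integrable lborel (\<lambda>x. (norm (f x $ i))\<^sup>2)"
  proof (rule Bochner_Integration.integrable_bound[OF i2])
    show "(\<lambda>x. (norm (f x $ i))\<^sup>2) \<in> borel_measurable lborel" using mi by measurable
    show "AE x in lborel. norm ((norm (f x $ i))\<^sup>2) \<le> norm ((norm (f x))\<^sup>2)"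
      by (intro always_eventually allI) (simp add: power_mono Finite_Cartesian_Product.norm_nth_le)
  qed
  with mi show "square_integrable (\<lambda>x. f x $ i)" by (simp add: square_integrable_def)
  show "weak_helmholtz (range p) z (\<lambda>x. f x $ i)"
    unfolding weak_helmholtz_def
  proof
    fix \<phi> assume \<phi>: "\<phi> \<in> test_functions (- range p)"
    have comp: "(LINT x|lborel. (\<psi> x *\<^sub>R f x)) $ i = (LINT x|lborel. \<psi> x *\<^sub>R (f x $ i))"
      if "\<psi> \<in> test_functions (- range p)" for \<psi>
      using integral_bounded_linear[OF bounded_linear_vec_nth[of i] integrable_test_times[OF that c]]
      by (simp only: vector_scaleR_component)
    have "(LINT x|lborel. laplacian \<phi> x *\<^sub>R f x) = (LINT x|lborel. \<phi> x *\<^sub>R (- (z *s f x)))"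
      using F(3) \<phi> unfolding weak_laplacian_def laplacian_def partial_eq_vpartial by (rule bspec)
    then have "(LINT x|lborel. laplacian \<phi> x *\<^sub>R f x) $ i = (LINT x|lborel. \<phi> x *\<^sub>R (- (z *s f x))) $ i"
      by (rule arg_cong)
    also have "\<dots> = (LINT x|lborel. (- (z *s (\<phi> x *\<^sub>R f x)))) $ i"
    proof -
      have "\<phi> x *\<^sub>R (- (z *s f x)) = - (z *s (\<phi> x *\<^sub>R f x))" for x by (simp add: vec_eq_iff)
      then show ?thesis by (simp only:)
    qed
    also have "\<dots> = (LINT x|lborel. - z * (\<phi> x *\<^sub>R (f x $ i)))"
    proof -
      have L: "bounded_linear (\<lambda>v :: complex^'n. - (z *s v))"
        by (rule bounded_linear_intro[of _ "norm z"]) (simp_all add: norm_smult_vec vec_eq_iff algebra_simps)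
      note I = integrable_bounded_linear[OF L integrable_test_times[OF \<phi> c]]
      show ?thesis
        using integral_bounded_linear[OF bounded_linear_vec_nth[of i] I] by simp
    qed
    also have "\<dots> = - z * (LINT x|lborel. \<phi> x *\<^sub>R (f x $ i))" by (rule integral_mult_right_zero)
    finally show "(LINT x|lborel. laplacian \<phi> x *\<^sub>R (f x $ i)) = - z * (LINT x|lborel. \<phi> x *\<^sub>R (f x $ i))"
      unfolding comp[OF test_laplacian[OF \<phi>]] .
  qed
qed

text \<open>
  The representation theorem applies to every component. The charges of all components at \<open>x\<^sub>j\<close>
  form the vector \<open>\<xi>\<^sub>j\<close>; injectivity of \<open>p\<close> makes this well defined as a family over the indices.
\<close>

theorem defect_space_eq_green_sums:
  fixes p :: "'m::finite \<Rightarrow> real^2"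
  assumes inj: "inj p" and w: "Im w > 0"
  shows "defect_space (H_adj p) (w\<^sup>2) = range (green_sum w p :: complex^'n::finite^'m \<Rightarrow> _)"
proof
  show "range (green_sum w p :: complex^'n^'m \<Rightarrow> _) \<subseteq> defect_space (H_adj p) (w\<^sup>2)"
    using green_sum_in_defect_space[OF w] by blast
  show "defect_space (H_adj p) (w\<^sup>2) \<subseteq> range (green_sum w p :: complex^'n^'m \<Rightarrow> _)"
  proof
    fix f :: "real^2 \<Rightarrow> complex^'n" assume f: "f \<in> defect_space (H_adj p) (w\<^sup>2)"
    have "\<exists>c. \<forall>b. b \<notin> range p \<longrightarrow> f b $ i = (\<Sum>q\<in>range p. c q * green w b q)" for i
    proof (rule helmholtz_representation[OF defect_component(1,2)[OF f] _ w defect_component(3)[OF f]])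
      show "finite (range p)" by simp
      fix c assume "\<And>b. b \<notin> range p \<Longrightarrow> f b $ i = (\<Sum>q\<in>range p. c q * green w b q)"
      then show ?thesis by (intro exI[of _ c] allI impI)
    qed
    then have "\<forall>i. \<exists>c. \<forall>b. b \<notin> range p \<longrightarrow> f b $ i = (\<Sum>q\<in>range p. c q * green w b q)" by (rule allI)
    from choice[OF this] obtain c where c: "\<forall>i b. b \<notin> range p \<longrightarrow> f b $ i = (\<Sum>q\<in>range p. c i q * green w b q)"
      by (rule exE)
    define \<xi> :: "complex^'n^'m" where "\<xi> = (\<chi> j i. c i (p j))"
    have sym: "green w b q = green w q b" for b q by (simp add: green_def sq_dist_def norm_minus_commute)
    have "f x = green_sum w p \<xi> x" for x
    proof (cases "x \<in> range p")
      case True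
      then show ?thesis using f by (auto simp: green_sum_def defect_space_def H_adj_def dom_H_adj_def)
    next
      case False
      have "f x $ i = green_sum w p \<xi> x $ i" for i
      proof -
        have "f x $ i = (\<Sum>q\<in>range p. c i q * green w x q)" using c False by blast
        also have "\<dots> = (\<Sum>j\<in>UNIV. c i (p j) * green w x (p j))"
          by (subst sum.reindex[OF inj]) (simp only: o_def)
        also have "\<dots> = (\<Sum>j\<in>UNIV. green w (p j) x * (\<xi> $ j $ i))"
          by (rule sum.cong[OF refl]) (simp add: \<xi>_def sym[of x] mult.commute)
        also have "\<dots> = green_sum w p \<xi> x $ i" using False by (simp add: green_sum_def)
        finally show ?thesis .
      qed
      then show ?thesis by (simp only: vec_eq_iff) simp
    qed
    then have "f = green_sum w p \<xi>" by (rule ext)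
    then show "f \<in> range (green_sum w p :: complex^'n^'m \<Rightarrow> _)" by (rule range_eqI)
  qed
qed

section \<open>Gamma field and Weyl function\<close>

theorem proposition5p2:
  fixes p :: "'m::finite \<Rightarrow> real^2" and z :: complex
  assumes distinct: "inj p"
    and z: "Im z > 0"
  shows
    "bij_betw (\<Gamma>\<^sub>0 p) (defect_space (H_adj p) z) (UNIV :: (complex^'n::finite^'m) set)
     \<and> (weyl_function p z :: complex^'n^'m \<Rightarrow> complex^'n^'m)
         = direct_sum_copies (weyl_matrix p z)
     \<and> (\<forall>(\<xi> :: complex^'n^'m) x. x \<notin> range p \<longrightarrow>
          gamma_field p z \<xi> x
            = (\<Sum>j\<in>UNIV. (\<i> / 4 * hankel1 0 (upper_sqrt z * of_real (dist x (p j)))) *s (\<xi> $ j)))"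
proof -
  let ?w = "upper_sqrt z" and ?N = "defect_space (H_adj p) z :: (real^2 \<Rightarrow> complex^'n) set"
  note w = upper_sqrt_pos[OF z]
  have N: "?N = range (green_sum ?w p)"
    using defect_space_eq_green_sums[OF distinct w(1)] unfolding w(3) .
  note b = boundary_maps_eqI[OF green_sum_at_centre[OF distinct]]
  have inj: "inj_on (\<Gamma>\<^sub>0 p) ?N"
  proof (rule inj_onI)
    fix f g assume "f \<in> ?N" "g \<in> ?N" and eq: "\<Gamma>\<^sub>0 p f = \<Gamma>\<^sub>0 p g"
    then obtain \<xi> \<eta> where "f = green_sum ?w p \<xi>" "g = green_sum ?w p \<eta>" unfolding N by blast
    with eq show "f = g" by (simp only: b(1))
  qed
  have onto: "\<Gamma>\<^sub>0 p ` ?N = UNIV" unfolding N image_image b(1) by simp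
  have \<gamma>: "gamma_field p z \<xi> = green_sum ?w p \<xi>" for \<xi> :: "complex^'n^'m"
  proof -
    have "green_sum ?w p \<xi> \<in> ?N" unfolding N by (rule rangeI)
    from inv_into_f_f[OF inj this] show ?thesis unfolding gamma_field_def b(1) .
  qed
  show ?thesis
  proof (intro conjI allI impI)
    show "bij_betw (\<Gamma>\<^sub>0 p) ?N UNIV" using inj onto by (simp add: bij_betw_def)
    show "(weyl_function p z :: complex^'n^'m \<Rightarrow> complex^'n^'m) = direct_sum_copies (weyl_matrix p z)"
      by (rule ext) (simp only: weyl_function_def o_def \<gamma> b(2) direct_sum_weyl_matrix[OF distinct z])
    fix \<xi> :: "complex^'n^'m" and x assume x: "x \<notin> range p"
    have "green ?w (p j) x = \<i> / 4 * hankel1 0 (?w * of_real (dist x (p j)))" for j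
      by (rule green_eq_hankel[OF w(1,2)]) (use x in auto)
    with x show "gamma_field p z \<xi> x = (\<Sum>j\<in>UNIV. (\<i> / 4 * hankel1 0 (?w * of_real (dist x (p j)))) *s (\<xi> $ j))"
      by (simp only: \<gamma> green_sum_def if_False)
  qed
qed

end
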